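(* Let $P=(P(i,j))_{(i,j)\in\mathbb{N}^2}$ be an irreducible and aperiodic Markov kernel on $\mathbb{N}$ with a unique invariant probability measure $\pi=(\pi(i))_{i\in\mathbb{N}}$, and assume that there exist $i_0\in\mathbb{N}$ and an integer $N\ge 1$ such that for all $i\ge i_0$ and all $j\in\mathbb{N}$, $|i-j|>N$ implies $P(i,j)=0$. Assume moreover: (i) for every $m=-N,\dots,N$, $P(i,i+m)\to a_m\in[0,1]$ as $i\to+\infty$; (ii) $\pi(i+1)/\pi(i)\to\tau\in[0,1)$ as $i\to+\infty$; (iii) $\sum_{k=-N}^N k\,a_k<0$. Let $$\alpha_0 := \sum_{m=-N}^N \limsup_{i\to+\infty} \sqrt{P(i,i+m)\, P^*(i+m,i)} = \begin{cases}\displaystyle\sum_{m=-N}^{N} a_m\,\tau^{-m/2} & \text{if }\tau\in(0,1),\\ a_0 & \text{if }\tau=0.\end{cases}$$ Then $\alpha_0<1$, $P$ satisfies both the spectral gap property on $\ell^2(\pi)$ and the spectral gap property on $\mathcal{B}_V$ with $V:=(\pi(n)^{-1/2})_{n\in\mathbb{N}}$, we have $$\max\big(r_{ess}(P_{|\mathcal{B}_V}),\,r_{ess}(P_{|\ell^2(\pi)})\big)\le\alpha_0,$$ and the following assertions hold: (a) if $\varrho_V\le\alpha_0$, then $\varrho_2\le\alpha_0$; (b) if $\varrho_V>\alpha_0$, then $\varrho_2=\varrho_V$.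
   Context: $\mathbb{N}=\{0,1,2,\dots\}$. By irreducibility $\pi(i)>0$ for all $i$. $\ell^2(\pi)$ is the Hilbert space of sequences $f\in\mathbb{C}^{\mathbb{N}}$ with $\|f\|_2:=[\sum_{i\ge0}|f(i)|^2\pi(i)]^{1/2}<\infty$. $P$ acts by $(Pf)(i)=\sum_jP(i,j)f(j)$; its adjoint on $\ell^2(\pi)$ is given by the kernel $P^*(i,j):=\pi(j)P(j,i)/\pi(i)$. Put $\pi(f):=\sum_{i\ge0}f(i)\pi(i)$ and $\Pi f:=\pi(f)1_{\mathbb{N}}$, with $1_{\mathbb{N}}$ the constant sequence $1$. $\mathcal{B}_V$ is the Banach space of sequences $g\in\mathbb{C}^{\mathbb{N}}$ with $\|g\|_V:=\sup_{n}V(n)^{-1}|g(n)|<\infty$. Spectral gap property on $\ell^2(\pi)$ at rate $\rho\in(0,1)$: there is $C\in(0,+\infty)$ with $\|P^nf-\Pi f\|_2\le C\rho^n\|f\|_2$ for all $n\ge1$, $f\in\ell^2(\pi)$. Spectral gap property on $\mathcal{B}_V$ at rate $\rho\in(0,1)$ ($V$-geometric ergodicity): there is $C\in(0,+\infty)$ with $\|P^nf-\Pi f\|_V\le C\rho^n\|f\|_V$ for all $n\ge1$, $f\in\mathcal{B}_V$. Each property is said to hold if it holds at some rate $\rho\in(0,1)$; $\varrho_2$ and $\varrho_V$ are the infima of the $\rho\in(0,1)$ for which the property holds at rate $\rho$ on $\ell^2(\pi)$ and on $\mathcal{B}_V$ respectively. For a bounded linear operator $T$ on a Banach space, $r_{ess}(T)$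 denotes its essential spectral radius, i.e. $r_{ess}(T)=\lim_n(\inf\{\|T^n-K\|:K\text{ compact}\})^{1/n}$; $P_{|\ell^2(\pi)}$ and $P_{|\mathcal{B}_V}$ denote $P$ acting on the indicated space. *)

theory Defs
  imports "HOL-Analysis.Analysis"
begin

section \<open>Markov kernels on the natural numbers\<close>

definition markov_kernel :: "(nat \<Rightarrow> nat \<Rightarrow> real) \<Rightarrow> bool" where
  "markov_kernel P \<longleftrightarrow> (\<forall>i j. 0 \<le> P i j) \<and> (\<forall>i. P i sums 1)"

fun kernel_power :: "(nat \<Rightarrow> nat \<Rightarrow> real) \<Rightarrow> nat \<Rightarrow> nat \<Rightarrow> nat \<Rightarrow> real" where
  "kernel_power P 0 i j = (if i = j then 1 else 0)"
| "kernel_power P (Suc n) i j = (\<Sum>k. P i k * kernel_power P n k j)"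

definition irreducible_kernel :: "(nat \<Rightarrow> nat \<Rightarrow> real) \<Rightarrow> bool" where
  "irreducible_kernel P \<longleftrightarrow> (\<forall>i j. \<exists>n. 0 < kernel_power P n i j)"

definition aperiodic_kernel :: "(nat \<Rightarrow> nat \<Rightarrow> real) \<Rightarrow> bool" where
  "aperiodic_kernel P \<longleftrightarrow> (\<forall>i. Gcd {n. 1 \<le> n \<and> 0 < kernel_power P n i i} = 1)"

definition invariant_prob :: "(nat \<Rightarrow> nat \<Rightarrow> real) \<Rightarrow> (nat \<Rightarrow> real) \<Rightarrow> bool" where
  "invariant_prob P \<mu> \<longleftrightarrow>
     (\<forall>i. 0 \<le> \<mu> i) \<and> \<mu> sums 1 \<and> (\<forall>j. (\<lambda>i. \<mu> i * P i j) sums \<mu> j)"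

definition unique_invariant_prob :: "(nat \<Rightarrow> nat \<Rightarrow> real) \<Rightarrow> (nat \<Rightarrow> real) \<Rightarrow> bool" where
  "unique_invariant_prob P \<pi> \<longleftrightarrow>
     invariant_prob P \<pi> \<and> (\<forall>\<mu>. invariant_prob P \<mu> \<longrightarrow> \<mu> = \<pi>)"

definition adjoint_kernel :: "(nat \<Rightarrow> real) \<Rightarrow> (nat \<Rightarrow> nat \<Rightarrow> real) \<Rightarrow> nat \<Rightarrow> nat \<Rightarrow> real" where
  "adjoint_kernel \<pi> P i j = \<pi> j * P j i / \<pi> i"

definition kernel_op :: "(nat \<Rightarrow> nat \<Rightarrow> real) \<Rightarrow> (nat \<Rightarrow> complex) \<Rightarrow> nat \<Rightarrow> complex" where
  "kernel_op P f i = (\<Sum>j. of_real (P i j) * f j)"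

definition mean_op :: "(nat \<Rightarrow> real) \<Rightarrow> (nat \<Rightarrow> complex) \<Rightarrow> nat \<Rightarrow> complex" where
  "mean_op \<pi> f = (\<lambda>_. \<Sum>i. f i * of_real (\<pi> i))"

text \<open>The limsup is taken in the extended reals, so that no boundedness has to be presupposed.
  For \<open>m < 0\<close> the truncation by \<^const>\<open>nat\<close> affects only the finitely many \<open>i < -m\<close>.\<close>

definition alpha0 :: "(nat \<Rightarrow> real) \<Rightarrow> (nat \<Rightarrow> nat \<Rightarrow> real) \<Rightarrow> nat \<Rightarrow> ereal" where
  "alpha0 \<pi> P N =
     (\<Sum>m = - int N..int N.
        limsup (\<lambda>i. ereal (sqrt (P i (nat (int i + m))
                                  * adjoint_kernel \<pi> P (nat (int i + m)) i))))"

section \<open>The sequence spaces\<close>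

text \<open>Since the spaces depend on \<open>\<pi>\<close> and \<open>V\<close>, a normed space is given by a carrier set and a norm;
  the norm is meaningful on the carrier only.\<close>

definition l2_space :: "(nat \<Rightarrow> real) \<Rightarrow> (nat \<Rightarrow> complex) set" where
  "l2_space \<pi> = {f. summable (\<lambda>i. (cmod (f i))\<^sup>2 * \<pi> i)}"

definition l2_norm :: "(nat \<Rightarrow> real) \<Rightarrow> (nat \<Rightarrow> complex) \<Rightarrow> real" where
  "l2_norm \<pi> f = sqrt (\<Sum>i. (cmod (f i))\<^sup>2 * \<pi> i)"

definition BV_space :: "(nat \<Rightarrow> real) \<Rightarrow> (nat \<Rightarrow> complex) set" where
  "BV_space V = {g. bdd_above (range (\<lambda>n. cmod (g n) / V n))}"

definition BV_norm :: "(nat \<Rightarrow> real) \<Rightarrow> (nat \<Rightarrow> complex) \<Rightarrow> real" where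
  "BV_norm V g = (SUP n. cmod (g n) / V n)"

section \<open>Operators and the essential spectral radius\<close>

type_synonym seq_op = "(nat \<Rightarrow> complex) \<Rightarrow> nat \<Rightarrow> complex"

definition linear_op_on :: "(nat \<Rightarrow> complex) set \<Rightarrow> seq_op \<Rightarrow> bool" where
  "linear_op_on X T \<longleftrightarrow>
     (\<forall>f\<in>X. T f \<in> X) \<and>
     (\<forall>f\<in>X. \<forall>g\<in>X. \<forall>a b. T (\<lambda>i. a * f i + b * g i) = (\<lambda>i. a * T f i + b * T g i))"

definition bounded_op_on ::
    "(nat \<Rightarrow> complex) set \<Rightarrow> ((nat \<Rightarrow> complex) \<Rightarrow> real) \<Rightarrow> seq_op \<Rightarrow> bool" where
  "bounded_op_on X nrm T \<longleftrightarrow> linear_op_on X T \<and> (\<exists>C. \<forall>f\<in>X. nrm (T f) \<le> C * nrm f)"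

definition op_norm_on ::
    "(nat \<Rightarrow> complex) set \<Rightarrow> ((nat \<Rightarrow> complex) \<Rightarrow> real) \<Rightarrow> seq_op \<Rightarrow> real" where
  "op_norm_on X nrm T = (SUP f \<in> {f \<in> X. nrm f \<le> 1}. nrm (T f))"

text \<open>The value 0 off the carrier is there because \<^locale>\<open>Metric_space\<close> asks for nonnegativity
  everywhere, not only on the carrier.\<close>

definition norm_dist ::
    "(nat \<Rightarrow> complex) set \<Rightarrow> ((nat \<Rightarrow> complex) \<Rightarrow> real) \<Rightarrow>
     (nat \<Rightarrow> complex) \<Rightarrow> (nat \<Rightarrow> complex) \<Rightarrow> real" where
  "norm_dist X nrm f g = (if f \<in> X \<and> g \<in> X then nrm (\<lambda>i. f i - g i) else 0)"

definition norm_topology ::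
    "(nat \<Rightarrow> complex) set \<Rightarrow> ((nat \<Rightarrow> complex) \<Rightarrow> real) \<Rightarrow> (nat \<Rightarrow> complex) topology" where
  "norm_topology X nrm = Metric_space.mtopology X (norm_dist X nrm)"

definition compact_op_on ::
    "(nat \<Rightarrow> complex) set \<Rightarrow> ((nat \<Rightarrow> complex) \<Rightarrow> real) \<Rightarrow> seq_op \<Rightarrow> bool" where
  "compact_op_on X nrm K \<longleftrightarrow>
     linear_op_on X K \<and>
     compactin (norm_topology X nrm) (norm_topology X nrm closure_of (K ` {f \<in> X. nrm f \<le> 1}))"

definition ess_norm_on ::
    "(nat \<Rightarrow> complex) set \<Rightarrow> ((nat \<Rightarrow> complex) \<Rightarrow> real) \<Rightarrow> seq_op \<Rightarrow> real" where
  "ess_norm_on X nrm T =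
     Inf {op_norm_on X nrm (\<lambda>f i. T f i - K f i) |K. compact_op_on X nrm K}"

definition ess_spectral_radius ::
    "(nat \<Rightarrow> complex) set \<Rightarrow> ((nat \<Rightarrow> complex) \<Rightarrow> real) \<Rightarrow> seq_op \<Rightarrow> real" where
  "ess_spectral_radius X nrm T = lim (\<lambda>n. root n (ess_norm_on X nrm (T ^^ n)))"

section \<open>Spectral gap\<close>

text \<open>Membership of the difference in the carrier expresses that its norm is finite.\<close>

definition spectral_gap_at ::
    "(nat \<Rightarrow> complex) set \<Rightarrow> ((nat \<Rightarrow> complex) \<Rightarrow> real) \<Rightarrow>
     (nat \<Rightarrow> nat \<Rightarrow> real) \<Rightarrow> (nat \<Rightarrow> real) \<Rightarrow> real \<Rightarrow> bool" where
  "spectral_gap_at X nrm P \<pi> \<rho> \<longleftrightarrow>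
     (\<exists>C>0. \<forall>n\<ge>1. \<forall>f\<in>X.
        (\<lambda>i. (kernel_op P ^^ n) f i - mean_op \<pi> f i) \<in> X \<and>
        nrm (\<lambda>i. (kernel_op P ^^ n) f i - mean_op \<pi> f i) \<le> C * \<rho> ^ n * nrm f)"

definition spectral_gap ::
    "(nat \<Rightarrow> complex) set \<Rightarrow> ((nat \<Rightarrow> complex) \<Rightarrow> real) \<Rightarrow>
     (nat \<Rightarrow> nat \<Rightarrow> real) \<Rightarrow> (nat \<Rightarrow> real) \<Rightarrow> bool" where
  "spectral_gap X nrm P \<pi> \<longleftrightarrow> (\<exists>\<rho>\<in>{0<..<1}. spectral_gap_at X nrm P \<pi> \<rho>)"

definition gap_rate ::
    "(nat \<Rightarrow> complex) set \<Rightarrow> ((nat \<Rightarrow> complex) \<Rightarrow> real) \<Rightarrow>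
     (nat \<Rightarrow> nat \<Rightarrow> real) \<Rightarrow> (nat \<Rightarrow> real) \<Rightarrow> real" where
  "gap_rate X nrm P \<pi> = Inf {\<rho> \<in> {0<..<1}. spectral_gap_at X nrm P \<pi> \<rho>}"

end

theory Submission
  imports Defs
begin

text \<open>
  Write \<open>T\<close> for \<open>P\<close> acting on sequences, \<open>V = \<pi> powr (- 1/2)\<close>, and \<open>\<Pi>\<close> for the mean. For the shift
  by \<open>m\<close> the quantity \<open>P(i, i + m) * sqrt (\<pi> i / \<pi> (i + m))\<close> converges as \<open>i\<close> grows, and the sum over
  \<open>m\<close> of the limits is \<open>\<alpha>\<^sub>0\<close>. That \<open>\<alpha>\<^sub>0 < 1\<close> for \<open>\<tau> > 0\<close> is strict convexity: the function
  \<open>\<phi>(s) = (\<Sum>m. a m * \<tau> powr (- m * s))\<close> has \<open>\<phi>(0) = 1\<close>, the invariance of \<open>\<pi>\<close> passes to the limit as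
  \<open>\<phi>(1) \<le> 1\<close>, and \<open>\<alpha>\<^sub>0 = \<phi>(1/2)\<close>; the negative drift excludes that all mass sits at \<open>m = 0\<close>. For
  \<open>\<tau> = 0\<close> the latter is all one has to know, since \<open>\<alpha>\<^sub>0 = a 0\<close>.

  The same weights control \<open>T\<close> far out on both spaces. Let \<open>r > \<alpha>\<^sub>0\<close>. If \<open>M\<close> is large, then the rows of
  \<open>P\<close> from \<open>M\<close> on form an operator \<open>R\<close> of norm at most \<open>r\<close>, on \<open>\<B>\<^sub>V\<close> as well as on \<open>\<ell>\<^sup>2(\<pi>)\<close>
  (\<open>ex_contracting_tail\<close>), and \<open>K = T - R\<close> has finite rank. Hence \<open>T\<^sup>n - R\<^sup>n\<close> is compact and
  the essential spectral radius is at most \<open>r\<close> (\<open>ess_spectral_radius_le\<close>). Since the radius is a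
  limit, this includes its existence, which is Fekete's lemma for the essential norm.

  The spectral gaps are compared through the same splitting. Since \<open>\<ell>\<^sup>2(\<pi>)\<close> is contained in \<open>\<B>\<^sub>V\<close> with
  smaller \<open>V\<close>-norm, and \<open>K\<close> maps \<open>\<B>\<^sub>V\<close> boundedly into \<open>\<ell>\<^sup>2(\<pi>)\<close>, a gap at a rate \<open>\<rho> > r\<close> passes from one
  space to the other. From \<open>\<B>\<^sub>V\<close> to \<open>\<ell>\<^sup>2(\<pi>)\<close> one uses
  \<open>T\<^sup>n\<^sup>+\<^sup>1 - \<Pi> = R (T\<^sup>n - \<Pi>) + K (T\<^sup>n - \<Pi>)\<close> (\<open>gap_BV_imp_gap_l2\<close>), in the other direction
  \<open>T\<^sup>n\<^sup>+\<^sup>1 - \<Pi> = (T\<^sup>n - \<Pi>) R + (T\<^sup>n - \<Pi>) K\<close> (\<open>gap_l2_imp_gap_BV\<close>); in both cases the term with \<open>K\<close>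
  is controlled by the hypothesis and the other one by induction. So the two spaces have the same rates
  above \<open>\<alpha>\<^sub>0\<close>, which gives the comparison of the infima (\<open>rates_from_tails\<close>).

  It remains to find one rate below \<open>1\<close> (\<open>geometric_ergodicity\<close>). The bound on \<open>R\<close> is a drift
  condition for \<open>V\<close>, whose level sets are finite, and aperiodicity makes some power of \<open>P\<close> charge a
  fixed state from every point of such a set. Harris' theorem then yields \<open>V\<close>-geometric
  ergodicity; it is proved with independent couplings of two copies of the chain
  (\<open>oscillation_contraction\<close>).
\<close>

section \<open>Roots of submultiplicative sequences\<close>

text \<open>This is Fekete's lemma in multiplicative form. If \<open>a m < q ^ m\<close> for one \<open>m\<close>, then dividing with
  remainder by \<open>m\<close> gives \<open>a n \<le> C * q ^ n\<close> for all \<open>n\<close>, and \<open>root n C\<close> tends to \<open>1\<close>; hence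
  the roots converge to their infimum. The essential spectral radius is a limit of such roots.\<close>

lemma submultiplicative_root_convergent:
  fixes a :: "nat \<Rightarrow> real"
  assumes nonneg: "\<And>n. 0 \<le> a n" and submult: "\<And>m n. a (m + n) \<le> a m * a n"
  shows "convergent (\<lambda>n. root n (a n))"
proof -
  define L where "L = (INF n\<in>{1..}. root n (a n))"
  have bdd: "bdd_below ((\<lambda>n. root n (a n)) ` {1..})"
    by (rule bdd_belowI[of _ 0]) (auto simp: nonneg)
  have lower: "L \<le> root n (a n)" if "n \<ge> 1" for n
    unfolding L_def using that by (intro cINF_lower[OF bdd]) auto
  have "(\<lambda>n. root n (a n)) \<longlonglongrightarrow> L"
  proof (rule order_tendstoI)
    fix l assume "l < L"
    then show "\<forall>\<^sub>F n in sequentially. l < root n (a n)"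
      using lower by (intro eventually_sequentiallyI[of 1]) force
  next
    fix u assume "L < u"
    then obtain m where m: "m \<ge> 1" "root m (a m) < u"
      unfolding L_def using cINF_less_iff[OF _ bdd] by fastforce
    then obtain q where q: "root m (a m) < q" "q < u" using dense by blast
    have "0 \<le> root m (a m)" using nonneg m by simp
    then have q0: "q > 0" using q by linarith
    have am: "a m \<le> q ^ m"
      using m q q0 nonneg[of m] by (metis less_eq_real_def power_mono real_root_ge_zero real_root_pow_pos2
          zero_less_one order_less_le_trans less_numeral_extra(1) Suc_le_eq One_nat_def)
    define C where "C = (\<Sum>s<m. a s / q ^ s) + 1"
    have C0: "C > 0" unfolding C_def using nonneg q0 by (simp add: add_nonneg_pos sum_nonneg)
    have le: "a n \<le> C * q ^ n" for n
    proof (induction n rule: less_induct)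
      case (less n)
      show ?case
      proof (cases "n < m")
        case True
        then have "a n / q ^ n \<le> (\<Sum>s<m. a s / q ^ s)"
          using nonneg q0 by (intro member_le_sum) auto
        then have "a n / q ^ n \<le> C" unfolding C_def by simp
        then show ?thesis using q0 by (simp add: divide_le_eq)
      next
        case False
        then have n: "n = m + (n - m)" by simp
        have "a n \<le> a m * a (n - m)" using submult[of m "n - m"] n by simp
        also have "\<dots> \<le> q ^ m * (C * q ^ (n - m))"
          using less[of "n - m"] False m am nonneg q0 by (intro mult_mono) auto
        also have "\<dots> = C * q ^ n" using n by (metis mult.left_commute power_add)
        finally show ?thesis .
      qed
    qed
    have "(\<lambda>n. root n C * q) \<longlonglongrightarrow> 1 * q"
      by (intro tendsto_intros LIMSEQ_root_const C0)
    then have "\<forall>\<^sub>F n in sequentially. root n C * q < u"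
      using q(2) by (intro order_tendstoD(2)) auto
    then show "\<forall>\<^sub>F n in sequentially. root n (a n) < u"
      using eventually_ge_at_top[of 1]
    proof eventually_elim
      case (elim n)
      have "root n (a n) \<le> root n (C * q ^ n)" using elim le by simp
      also have "\<dots> = root n C * q" using elim q0 by (simp add: real_root_mult real_root_power_cancel)
      finally show ?case using elim by linarith
    qed
  qed
  then show ?thesis by (auto simp: convergent_def)
qed

section \<open>Normed spaces of sequences with the Fatou property\<close>

text \<open>Both \<open>\<ell>\<^sup>2(\<pi>)\<close> and \<open>\<B>\<^sub>V\<close> are of this kind. Bounded coordinates make norm-Cauchy sequences
  converge pointwise, and the Fatou property then puts the pointwise limit into the space; so these
  axioms imply completeness.\<close>

locale seq_space =
  fixes X :: "(nat \<Rightarrow> complex) set" and nrm :: "(nat \<Rightarrow> complex) \<Rightarrow> real"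
  assumes zero_mem: "(\<lambda>_. 0) \<in> X"
    and add_mem: "f \<in> X \<Longrightarrow> g \<in> X \<Longrightarrow> (\<lambda>i. f i + g i) \<in> X"
    and scale_mem: "f \<in> X \<Longrightarrow> (\<lambda>i. c * f i) \<in> X"
    and nrm_nonneg: "f \<in> X \<Longrightarrow> 0 \<le> nrm f"
    and nrm_add: "f \<in> X \<Longrightarrow> g \<in> X \<Longrightarrow> nrm (\<lambda>i. f i + g i) \<le> nrm f + nrm g"
    and nrm_scale_le: "f \<in> X \<Longrightarrow> nrm (\<lambda>i. c * f i) \<le> cmod c * nrm f"
    and coord_bound: "\<exists>w. \<forall>f\<in>X. cmod (f i) \<le> w * nrm f"
    and fatou: "(\<And>k. F k \<in> X \<and> nrm (F k) \<le> M) \<Longrightarrow> (\<And>i. (\<lambda>k. F k i) \<longlonglongrightarrow> h i) \<Longrightarrow>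
                  h \<in> X \<and> nrm h \<le> M"
    and unit_mem: "(\<lambda>i. if i = j then 1 else 0) \<in> X"
begin

lemma nrm_zero: "nrm (\<lambda>_. 0) = 0"
  using nrm_scale_le[OF zero_mem, of 0] nrm_nonneg[OF zero_mem] by simp

lemma nrm_scale:
  assumes f: "f \<in> X"
  shows "nrm (\<lambda>i. c * f i) = cmod c * nrm f"
proof (cases "c = 0")
  case False
  then have "nrm f \<le> cmod (1 / c) * nrm (\<lambda>i. c * f i)"
    using nrm_scale_le[OF scale_mem[OF f], of "1 / c" c] by simp
  then show ?thesis
    using nrm_scale_le[OF f, of c] False by (simp add: norm_divide field_simps)
qed (simp add: nrm_zero)

lemma diff_mem: "f \<in> X \<Longrightarrow> g \<in> X \<Longrightarrow> (\<lambda>i. f i - g i) \<in> X"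
  using add_mem[of f "\<lambda>i. (-1) * g i"] scale_mem[of g "-1"] by simp

lemma nrm_diff: "f \<in> X \<Longrightarrow> g \<in> X \<Longrightarrow> nrm (\<lambda>i. f i - g i) \<le> nrm f + nrm g"
  using nrm_add[of f "\<lambda>i. (-1) * g i"] scale_mem[of g "-1"] nrm_scale[of g "-1"] by simp

lemma nrm_minus_commute: "f \<in> X \<Longrightarrow> g \<in> X \<Longrightarrow> nrm (\<lambda>i. f i - g i) = nrm (\<lambda>i. g i - f i)"
  using nrm_scale[OF diff_mem, of f g "-1"] by simp

lemma nrm_diff_triangle:
  assumes "f \<in> X" "g \<in> X" "h \<in> X"
  shows "nrm (\<lambda>i. f i - h i) \<le> nrm (\<lambda>i. f i - g i) + nrm (\<lambda>i. g i - h i)"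
  using nrm_add[OF diff_mem[of f g] diff_mem[of g h]] assms by simp

lemma nrm_le_zero_imp:
  assumes "f \<in> X" "nrm f \<le> 0"
  shows "f = (\<lambda>_. 0)"
proof
  fix i
  obtain w where "\<forall>f\<in>X. cmod (f i) \<le> w * nrm f" using coord_bound by blast
  then have "cmod (f i) \<le> w * nrm f" using assms by blast
  moreover have "nrm f = 0" using assms nrm_nonneg by force
  ultimately show "f i = 0" by simp
qed

lemma sum_mem:
  assumes "finite A" "\<And>a. a \<in> A \<Longrightarrow> F a \<in> X"
  shows "(\<lambda>i. \<Sum>a\<in>A. F a i) \<in> X \<and> nrm (\<lambda>i. \<Sum>a\<in>A. F a i) \<le> (\<Sum>a\<in>A. nrm (F a))"
  using assms
proof (induction A rule: finite_induct)
  case empty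
  then show ?case by (simp add: zero_mem nrm_zero)
next
  case (insert x A)
  then show ?case
    using add_mem[of "F x" "\<lambda>i. \<Sum>a\<in>A. F a i"] nrm_add[of "F x" "\<lambda>i. \<Sum>a\<in>A. F a i"] by fastforce
qed

sublocale norm_metric: Metric_space X "norm_dist X nrm"
proof
  fix f g h
  show "0 \<le> norm_dist X nrm f g" by (simp add: norm_dist_def nrm_nonneg diff_mem)
  show "norm_dist X nrm f g = norm_dist X nrm g f"
    using nrm_minus_commute[of f g] by (auto simp: norm_dist_def)
  show "norm_dist X nrm f g = 0 \<longleftrightarrow> f = g" if "f \<in> X" "g \<in> X"
  proof
    assume "norm_dist X nrm f g = 0"
    then have "(\<lambda>i. f i - g i) = (\<lambda>_. 0)"
      using that by (intro nrm_le_zero_imp) (auto simp: norm_dist_def diff_mem)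
    then show "f = g" by (auto simp: fun_eq_iff)
  qed (use that in \<open>auto simp: norm_dist_def nrm_zero\<close>)
  show "norm_dist X nrm f h \<le> norm_dist X nrm f g + norm_dist X nrm g h"
    if "f \<in> X" "g \<in> X" "h \<in> X"
    using that nrm_diff_triangle by (simp add: norm_dist_def)
qed

lemma complete: "norm_metric.mcomplete"
  unfolding norm_metric.mcomplete_def
proof (intro allI impI)
  fix s assume "norm_metric.MCauchy s"
  then have mem: "\<And>n. s n \<in> X"
    and cauchy: "\<And>e. e > 0 \<Longrightarrow> \<exists>N. \<forall>m\<ge>N. \<forall>n\<ge>N. nrm (\<lambda>i. s m i - s n i) < e"
    unfolding norm_metric.MCauchy_def norm_dist_def by (auto simp: image_subset_iff)
  have "Cauchy (\<lambda>n. s n i)" for i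
  proof (rule metric_CauchyI)
    fix e :: real assume "e > 0"
    obtain w where w: "\<And>f. f \<in> X \<Longrightarrow> cmod (f i) \<le> w * nrm f" using coord_bound by blast
    obtain N where N: "\<And>m n. m \<ge> N \<Longrightarrow> n \<ge> N \<Longrightarrow> nrm (\<lambda>i. s m i - s n i) < e / (\<bar>w\<bar> + 1)"
      using cauchy[of "e / (\<bar>w\<bar> + 1)"] \<open>e > 0\<close> by auto
    have "dist (s m i) (s n i) < e" if "m \<ge> N" "n \<ge> N" for m n
    proof -
      have "dist (s m i) (s n i) \<le> w * nrm (\<lambda>i. s m i - s n i)"
        using w[OF diff_mem[OF mem mem]] by (simp add: dist_norm)
      also have "\<dots> \<le> (\<bar>w\<bar> + 1) * nrm (\<lambda>i. s m i - s n i)"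
        by (intro mult_right_mono nrm_nonneg diff_mem mem) auto
      also have "\<dots> < e" using N[OF that] by (simp add: pos_less_divide_eq mult.commute)
      finally show ?thesis .
    qed
    then show "\<exists>N. \<forall>m\<ge>N. \<forall>n\<ge>N. dist (s m i) (s n i) < e" by blast
  qed
  then have "\<forall>i. \<exists>l. (\<lambda>n. s n i) \<longlonglongrightarrow> l" by (simp add: Cauchy_convergent_iff convergent_def)
  then obtain h where h: "\<And>i. (\<lambda>n. s n i) \<longlonglongrightarrow> h i" by metis
  have tail: "(\<lambda>i. s m i - h i) \<in> X \<and> nrm (\<lambda>i. s m i - h i) \<le> e"
    if "\<And>n. n \<ge> N \<Longrightarrow> nrm (\<lambda>i. s m i - s n i) \<le> e" for m N e
  proof (rule fatou)
    show "(\<lambda>i. s m i - s (k + N) i) \<in> X \<and> nrm (\<lambda>i. s m i - s (k + N) i) \<le> e" for k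
      using that[of "k + N"] by (simp add: diff_mem mem)
    show "(\<lambda>k. s m i - s (k + N) i) \<longlonglongrightarrow> s m i - h i" for i
      by (intro tendsto_intros LIMSEQ_ignore_initial_segment h)
  qed
  obtain N1 where "\<And>m n. m \<ge> N1 \<Longrightarrow> n \<ge> N1 \<Longrightarrow> nrm (\<lambda>i. s m i - s n i) < 1"
    using cauchy[of 1] by auto
  then have "(\<lambda>i. s N1 i - h i) \<in> X" using tail[of N1 N1 1] by force
  then have hX: "h \<in> X" using diff_mem[OF mem[of N1]] by fastforce
  have "\<forall>\<^sub>F n in sequentially. s n \<in> X \<and> norm_dist X nrm (s n) h < e" if e: "e > 0" for e
  proof -
    obtain N where N: "\<And>m n. m \<ge> N \<Longrightarrow> n \<ge> N \<Longrightarrow> nrm (\<lambda>i. s m i - s n i) < e / 2"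
      using cauchy[OF half_gt_zero[OF e]] by blast
    have "norm_dist X nrm (s m) h < e" if "m \<ge> N" for m
      using tail[of N m "e / 2"] N[OF that] e hX mem by (force simp: norm_dist_def)
    then show ?thesis using mem by (auto simp: eventually_sequentially)
  qed
  then show "\<exists>h. limitin norm_metric.mtopology s h sequentially"
    using hX by (auto simp: norm_metric.limitin_metric)
qed

subsection \<open>Compact operators\<close>

text \<open>In a complete space, an operator is compact if and only if the image of the unit ball has
  finite \<open>\<epsilon>\<close>-nets; nets are easy to transport through sums and compositions.\<close>

definition has_nets :: "seq_op \<Rightarrow> bool" where
  "has_nets K \<longleftrightarrow> (\<forall>e>0. \<exists>G. finite G \<and> G \<subseteq> X \<and>
     (\<forall>f\<in>X. nrm f \<le> 1 \<longrightarrow> (\<exists>g\<in>G. nrm (\<lambda>i. K f i - g i) < e)))"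

lemma linear_op_onD:
  assumes "linear_op_on X T"
  shows "f \<in> X \<Longrightarrow> T f \<in> X"
    and "f \<in> X \<Longrightarrow> g \<in> X \<Longrightarrow> T (\<lambda>i. f i + g i) = (\<lambda>i. T f i + T g i)"
    and "f \<in> X \<Longrightarrow> g \<in> X \<Longrightarrow> T (\<lambda>i. f i - g i) = (\<lambda>i. T f i - T g i)"
    and "f \<in> X \<Longrightarrow> T (\<lambda>i. c * f i) = (\<lambda>i. c * T f i)"
proof -
  have lin: "\<And>f g a b. f \<in> X \<Longrightarrow> g \<in> X \<Longrightarrow> T (\<lambda>i. a * f i + b * g i) = (\<lambda>i. a * T f i + b * T g i)"
    and maps: "f \<in> X \<Longrightarrow> T f \<in> X" for f
    using assms by (auto simp: linear_op_on_def)
  show "f \<in> X \<Longrightarrow> T f \<in> X" by (rule maps)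
  show "f \<in> X \<Longrightarrow> g \<in> X \<Longrightarrow> T (\<lambda>i. f i + g i) = (\<lambda>i. T f i + T g i)" using lin[of f g 1 1] by simp
  show "f \<in> X \<Longrightarrow> g \<in> X \<Longrightarrow> T (\<lambda>i. f i - g i) = (\<lambda>i. T f i - T g i)"
    using lin[of f g 1 "-1"] by simp
  show "f \<in> X \<Longrightarrow> T (\<lambda>i. c * f i) = (\<lambda>i. c * T f i)" using lin[of f f c 0] by simp
qed

lemma totally_bounded_iff_nets:
  assumes S: "S \<subseteq> X"
  shows "norm_metric.mtotally_bounded S \<longleftrightarrow>
    (\<forall>e>0. \<exists>G. finite G \<and> G \<subseteq> X \<and> (\<forall>x\<in>S. \<exists>g\<in>G. nrm (\<lambda>i. x i - g i) < e))"
    (is "_ \<longleftrightarrow> ?nets")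
proof
  assume tb: "norm_metric.mtotally_bounded S"
  show ?nets
  proof (intro allI impI)
    fix e :: real assume "e > 0"
    then obtain G where G: "finite G" "G \<subseteq> S" "S \<subseteq> (\<Union>g\<in>G. norm_metric.mball g e)"
      using tb unfolding norm_metric.mtotally_bounded_def by meson
    have "\<exists>g\<in>G. nrm (\<lambda>i. x i - g i) < e" if x: "x \<in> S" for x
    proof -
      obtain g where g: "g \<in> G" "g \<in> X" "x \<in> X" "norm_dist X nrm g x < e"
        using subsetD[OF G(3) x] by auto
      then have "nrm (\<lambda>i. x i - g i) < e"
        using nrm_minus_commute[of x g] by (simp add: norm_dist_def)
      then show ?thesis using g(1) by (rule bexI)
    qed
    then show "\<exists>G. finite G \<and> G \<subseteq> X \<and> (\<forall>x\<in>S. \<exists>g\<in>G. nrm (\<lambda>i. x i - g i) < e)"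
      using G(1) order_trans[OF G(2) S] by (intro exI[of _ G]) simp
  qed
next
  assume nets: ?nets
  show "norm_metric.mtotally_bounded S"
    unfolding norm_metric.mtotally_bounded_def
  proof (intro allI impI)
    fix e :: real assume "e > 0"
    then obtain G where G: "finite G" "G \<subseteq> X" "\<forall>x\<in>S. \<exists>g\<in>G. nrm (\<lambda>i. x i - g i) < e / 2"
      using nets half_gt_zero by meson
    \<comment> \<open>The centres have to be moved into the set itself, at the price of doubling the radius.\<close>
    define H where "H = {g \<in> G. \<exists>x\<in>S. nrm (\<lambda>i. x i - g i) < e / 2}"
    have "\<forall>g\<in>H. \<exists>x. x \<in> S \<and> nrm (\<lambda>i. x i - g i) < e / 2" by (simp add: H_def Bex_def)
    then obtain c where c: "\<forall>g\<in>H. c g \<in> S \<and> nrm (\<lambda>i. c g i - g i) < e / 2"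
      by (rule bchoice[THEN exE])
    have "x \<in> (\<Union>y\<in>c ` H. norm_metric.mball y e)" if x: "x \<in> S" for x
    proof -
      obtain g where g: "g \<in> G" "nrm (\<lambda>i. x i - g i) < e / 2" using G(3) x by meson
      then have gH: "g \<in> H" unfolding H_def using x by (intro CollectI conjI bexI[of _ x])
      have cg: "c g \<in> S" "nrm (\<lambda>i. c g i - g i) < e / 2" using bspec[OF c gH] by simp_all
      have mem: "x \<in> X" "g \<in> X" "c g \<in> X"
        using subsetD[OF S x] subsetD[OF G(2) g(1)] subsetD[OF S cg(1)] .
      have "nrm (\<lambda>i. c g i - x i) \<le> nrm (\<lambda>i. c g i - g i) + nrm (\<lambda>i. g i - x i)"
        by (rule nrm_diff_triangle[OF mem(3,2,1)])
      also have "\<dots> < e" using cg g nrm_minus_commute[OF mem(1,2)] by simp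
      finally have "x \<in> norm_metric.mball (c g) e" using mem by (simp add: norm_dist_def)
      then show ?thesis using gH by (intro UN_I[of "c g"] imageI)
    qed
    then have "S \<subseteq> (\<Union>y\<in>c ` H. norm_metric.mball y e)" by (rule subsetI)
    moreover have "finite (c ` H)" "c ` H \<subseteq> S" using G(1) c by (auto simp: H_def)
    ultimately show "\<exists>G. finite G \<and> G \<subseteq> S \<and> S \<subseteq> (\<Union>x\<in>G. norm_metric.mball x e)"
      by (intro exI[of _ "c ` H"] conjI)
  qed
qed

lemma compact_op_on_iff: "compact_op_on X nrm K \<longleftrightarrow> linear_op_on X K \<and> has_nets K"
proof (cases "linear_op_on X K")
  case True
  let ?S = "K ` {f \<in> X. nrm f \<le> 1}"
  have S: "?S \<subseteq> X" using linear_op_onD(1)[OF True] by auto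
  have image: "(\<forall>x\<in>?S. Q x) \<longleftrightarrow> (\<forall>f\<in>X. nrm f \<le> 1 \<longrightarrow> Q (K f))" for Q by auto
  have "norm_metric.mtotally_bounded ?S \<longleftrightarrow> has_nets K"
    unfolding totally_bounded_iff_nets[OF S] has_nets_def image by simp
  then show ?thesis
    using norm_metric.mtotally_bounded_eq_compact_closure_of[OF complete, of ?S] S True
    by (simp add: compact_op_on_def norm_topology_def)
qed (simp add: compact_op_on_def)

lemma linear_op_on_add:
  assumes "linear_op_on X T" "linear_op_on X S"
  shows "linear_op_on X (\<lambda>f i. T f i + S f i)"
  using assms add_mem unfolding linear_op_on_def by (auto simp: algebra_simps)

lemma linear_op_on_diff:
  assumes "linear_op_on X T" "linear_op_on X S"
  shows "linear_op_on X (\<lambda>f i. T f i - S f i)"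
  using assms diff_mem unfolding linear_op_on_def by (auto simp: algebra_simps)

lemma linear_op_on_comp:
  assumes "linear_op_on X T" "linear_op_on X S"
  shows "linear_op_on X (\<lambda>f. T (S f))"
  using assms unfolding linear_op_on_def by auto

lemma compact_op_add:
  assumes "compact_op_on X nrm K" "compact_op_on X nrm L"
  shows "compact_op_on X nrm (\<lambda>f i. K f i + L f i)"
proof -
  have lin: "linear_op_on X K" "linear_op_on X L" and nets: "has_nets K" "has_nets L"
    using assms by (auto simp: compact_op_on_iff)
  have "has_nets (\<lambda>f i. K f i + L f i)"
    unfolding has_nets_def
  proof (intro allI impI)
    fix e :: real assume "e > 0"
    then have e: "e / 2 > 0" by simp
    obtain G where G: "finite G" "G \<subseteq> X"
      "\<And>f. f \<in> X \<Longrightarrow> nrm f \<le> 1 \<Longrightarrow> \<exists>g\<in>G. nrm (\<lambda>i. K f i - g i) < e / 2"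
      using nets(1) e unfolding has_nets_def by meson
    obtain H where H: "finite H" "H \<subseteq> X"
      "\<And>f. f \<in> X \<Longrightarrow> nrm f \<le> 1 \<Longrightarrow> \<exists>g\<in>H. nrm (\<lambda>i. L f i - g i) < e / 2"
      using nets(2) e unfolding has_nets_def by meson
    let ?S = "(\<lambda>(g, h) i. g i + h i) ` (G \<times> H)"
    have "\<exists>s\<in>?S. nrm (\<lambda>i. K f i + L f i - s i) < e" if f: "f \<in> X" "nrm f \<le> 1" for f
    proof -
      obtain g where g: "g \<in> G" "nrm (\<lambda>i. K f i - g i) < e / 2" using G(3)[OF f] by blast
      obtain h where h: "h \<in> H" "nrm (\<lambda>i. L f i - h i) < e / 2" using H(3)[OF f] by blast
      have "(\<lambda>i. K f i - g i) \<in> X" "(\<lambda>i. L f i - h i) \<in> X"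
        using g(1) h(1) G(2) H(2) f(1)
        by (auto intro!: diff_mem linear_op_onD(1)[OF lin(1)] linear_op_onD(1)[OF lin(2)])
      then have "nrm (\<lambda>i. (K f i - g i) + (L f i - h i)) < e"
        using nrm_add g h by fastforce
      then have "nrm (\<lambda>i. K f i + L f i - (g i + h i)) < e" by (simp add: algebra_simps)
      then show ?thesis using g h by (intro bexI[of _ "\<lambda>i. g i + h i"]) auto
    qed
    then show "\<exists>S. finite S \<and> S \<subseteq> X \<and>
        (\<forall>f\<in>X. nrm f \<le> 1 \<longrightarrow> (\<exists>s\<in>S. nrm (\<lambda>i. K f i + L f i - s i) < e))"
      using G(1,2) H(1,2) by (intro exI[of _ ?S]) (auto intro!: add_mem)
  qed
  then show ?thesis using linear_op_on_add[OF lin] by (simp add: compact_op_on_iff)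
qed

lemma compact_op_comp_left:
  assumes "bounded_op_on X nrm T" "compact_op_on X nrm K"
  shows "compact_op_on X nrm (\<lambda>f. T (K f))"
proof -
  have lin: "linear_op_on X T" "linear_op_on X K" and nets: "has_nets K"
    using assms by (auto simp: compact_op_on_iff bounded_op_on_def)
  obtain C where C: "\<And>f. f \<in> X \<Longrightarrow> nrm (T f) \<le> C * nrm f" using assms by (auto simp: bounded_op_on_def)
  have "has_nets (\<lambda>f. T (K f))"
    unfolding has_nets_def
  proof (intro allI impI)
    fix e :: real assume "e > 0"
    then have "e / (\<bar>C\<bar> + 1) > 0" by simp
    then obtain G where G: "finite G" "G \<subseteq> X"
      "\<And>f. f \<in> X \<Longrightarrow> nrm f \<le> 1 \<Longrightarrow> \<exists>g\<in>G. nrm (\<lambda>i. K f i - g i) < e / (\<bar>C\<bar> + 1)"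
      using nets unfolding has_nets_def by meson
    have "\<exists>g\<in>T ` G. nrm (\<lambda>i. T (K f) i - g i) < e" if f: "f \<in> X" "nrm f \<le> 1" for f
    proof -
      obtain g where g: "g \<in> G" "nrm (\<lambda>i. K f i - g i) < e / (\<bar>C\<bar> + 1)" using G(3)[OF f] by blast
      have mem: "K f \<in> X" "g \<in> X" using linear_op_onD(1)[OF lin(2) f(1)] g(1) G(2) by auto
      then have mem': "(\<lambda>i. K f i - g i) \<in> X" by (rule diff_mem)
      have "nrm (\<lambda>i. T (K f) i - T g i) = nrm (T (\<lambda>i. K f i - g i))"
        using linear_op_onD(3)[OF lin(1)] mem by simp
      also have "\<dots> \<le> C * nrm (\<lambda>i. K f i - g i)" by (rule C[OF mem'])
      also have "\<dots> \<le> (\<bar>C\<bar> + 1) * nrm (\<lambda>i. K f i - g i)"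
        by (intro mult_right_mono nrm_nonneg mem') auto
      also have "\<dots> < e" using g by (simp add: pos_less_divide_eq mult.commute)
      finally show ?thesis using g by blast
    qed
    then show "\<exists>G. finite G \<and> G \<subseteq> X \<and>
        (\<forall>f\<in>X. nrm f \<le> 1 \<longrightarrow> (\<exists>g\<in>G. nrm (\<lambda>i. T (K f) i - g i) < e))"
      using G linear_op_onD(1)[OF lin(1)] by (intro exI[of _ "T ` G"]) auto
  qed
  then show ?thesis using linear_op_on_comp[OF lin] by (simp add: compact_op_on_iff)
qed

lemma compact_op_comp_right:
  assumes "compact_op_on X nrm K" "bounded_op_on X nrm T"
  shows "compact_op_on X nrm (\<lambda>f. K (T f))"
proof -
  have lin: "linear_op_on X T" "linear_op_on X K" and nets: "has_nets K"
    using assms by (auto simp: compact_op_on_iff bounded_op_on_def)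
  obtain C0 where C0: "\<And>f. f \<in> X \<Longrightarrow> nrm (T f) \<le> C0 * nrm f"
    using assms by (auto simp: bounded_op_on_def)
  define C where "C = \<bar>C0\<bar> + 1"
  have Cpos: "C > 0" by (simp add: C_def)
  have C: "nrm (T f) \<le> C * nrm f" if "f \<in> X" for f
  proof -
    have "C0 * nrm f \<le> C * nrm f" by (intro mult_right_mono nrm_nonneg that) (simp add: C_def)
    then show ?thesis using C0[OF that] by linarith
  qed
  have "has_nets (\<lambda>f. K (T f))"
    unfolding has_nets_def
  proof (intro allI impI)
    fix e :: real assume "e > 0"
    then have "e / C > 0" using Cpos by simp
    then obtain G where G: "finite G" "G \<subseteq> X"
      "\<And>f. f \<in> X \<Longrightarrow> nrm f \<le> 1 \<Longrightarrow> \<exists>g\<in>G. nrm (\<lambda>i. K f i - g i) < e / C"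
      using nets unfolding has_nets_def by meson
    let ?H = "(\<lambda>g i. of_real C * g i) ` G"
    have "\<exists>g\<in>?H. nrm (\<lambda>i. K (T f) i - g i) < e" if f: "f \<in> X" "nrm f \<le> 1" for f
    proof -
      let ?u = "\<lambda>i. of_real (1 / C) * T f i"
      have Tf: "T f \<in> X" using linear_op_onD(1)[OF lin(1)] f by blast
      then have u: "?u \<in> X" by (rule scale_mem)
      have "nrm ?u = nrm (T f) / C"
        using nrm_scale[OF Tf, of "of_real (1 / C)"] Cpos by (simp add: norm_divide)
      moreover have "nrm (T f) \<le> C"
        using C[OF f(1)] mult_left_le[OF f(2), of C] Cpos by linarith
      ultimately have "nrm ?u \<le> 1" using Cpos by simp
      then obtain g where g: "g \<in> G" "nrm (\<lambda>i. K ?u i - g i) < e / C" using G(3)[OF u] by blast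
      have mem: "(\<lambda>i. K ?u i - g i) \<in> X" using diff_mem[OF linear_op_onD(1)[OF lin(2) u], of g] g(1) G(2) by blast
      have "T f = (\<lambda>i. of_real C * ?u i)" using Cpos by (auto simp: fun_eq_iff)
      then have "K (T f) = K (\<lambda>i. of_real C * ?u i)" by (rule arg_cong)
      also have "\<dots> = (\<lambda>i. of_real C * K ?u i)" by (rule linear_op_onD(4)[OF lin(2) u])
      finally have "nrm (\<lambda>i. K (T f) i - of_real C * g i) = nrm (\<lambda>i. of_real C * (K ?u i - g i))"
        by (simp add: algebra_simps)
      also have "\<dots> = C * nrm (\<lambda>i. K ?u i - g i)" using nrm_scale[OF mem] Cpos by simp
      also have "\<dots> < e" using g Cpos by (simp add: pos_less_divide_eq mult.commute)
      finally show ?thesis using g by (intro bexI[of _ "\<lambda>i. of_real C * g i"]) auto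
    qed
    then show "\<exists>G. finite G \<and> G \<subseteq> X \<and>
        (\<forall>f\<in>X. nrm f \<le> 1 \<longrightarrow> (\<exists>g\<in>G. nrm (\<lambda>i. K (T f) i - g i) < e))"
      using G scale_mem by (intro exI[of _ ?H]) auto
  qed
  then show ?thesis using linear_op_on_comp[OF lin(2,1)] by (simp add: compact_op_on_iff)
qed

lemma compact_op_zero: "compact_op_on X nrm (\<lambda>f i. 0)"
proof -
  have "has_nets (\<lambda>f i. 0)"
    unfolding has_nets_def
  proof (intro allI impI)
    fix e :: real assume "e > 0"
    then show "\<exists>G. finite G \<and> G \<subseteq> X \<and>
        (\<forall>f\<in>X. nrm f \<le> 1 \<longrightarrow> (\<exists>g\<in>G. nrm (\<lambda>i. 0 - g i) < e))"
      by (intro exI[of _ "{\<lambda>_. 0}"]) (simp add: zero_mem nrm_zero)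
  qed
  then show ?thesis by (simp add: compact_op_on_iff linear_op_on_def zero_mem)
qed

lemma compact_op_scale:
  assumes "compact_op_on X nrm K"
  shows "compact_op_on X nrm (\<lambda>f i. c * K f i)"
proof -
  have "bounded_op_on X nrm (\<lambda>f i. c * f i)"
    unfolding bounded_op_on_def linear_op_on_def
    by (intro conjI ballI allI exI[of _ "cmod c"]) (simp_all add: scale_mem nrm_scale algebra_simps)
  from compact_op_comp_left[OF this assms] show ?thesis .
qed

lemma compact_op_rank_one:
  assumes h: "h \<in> X"
    and lin: "\<And>f g a b. f \<in> X \<Longrightarrow> g \<in> X \<Longrightarrow> \<phi> (\<lambda>i. a * f i + b * g i) = a * \<phi> f + b * \<phi> g"
    and bound: "\<And>f. f \<in> X \<Longrightarrow> cmod (\<phi> f) \<le> B * nrm f"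
  shows "compact_op_on X nrm (\<lambda>f i. \<phi> f * h i)"
proof -
  have "has_nets (\<lambda>f i. \<phi> f * h i)"
    unfolding has_nets_def
  proof (intro allI impI)
    fix e :: real assume "e > 0"
    define d where "d = e / (nrm h + 1)"
    have h0: "0 \<le> nrm h" using h by (rule nrm_nonneg)
    then have "d > 0" using \<open>e > 0\<close> by (simp add: d_def)
    obtain k where k: "finite k" "cball (0::complex) \<bar>B\<bar> \<subseteq> (\<Union>x\<in>k. ball x d)"
      using compact_cball[of "0::complex" "\<bar>B\<bar>"] \<open>d > 0\<close> unfolding compact_eq_totally_bounded by meson
    have "\<exists>g\<in>(\<lambda>z i. z * h i) ` k. nrm (\<lambda>i. \<phi> f * h i - g i) < e" if f: "f \<in> X" "nrm f \<le> 1" for f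
    proof -
      have "B * nrm f \<le> \<bar>B\<bar> * 1" using f nrm_nonneg by (intro mult_mono) auto
      then have "\<phi> f \<in> cball 0 \<bar>B\<bar>" using bound[OF f(1)] by simp
      then obtain z where z: "z \<in> k" "cmod (\<phi> f - z) < d" using k by (auto simp: dist_norm norm_minus_commute)
      have "nrm (\<lambda>i. \<phi> f * h i - z * h i) = cmod (\<phi> f - z) * nrm h"
        using nrm_scale[OF h, of "\<phi> f - z"] by (simp add: algebra_simps)
      also have "\<dots> \<le> d * nrm h" using z h0 by (intro mult_right_mono) auto
      also have "\<dots> < e" using h0 \<open>e > 0\<close> by (simp add: d_def field_simps)
      finally show ?thesis using z by auto
    qed
    then show "\<exists>G. finite G \<and> G \<subseteq> X \<and>
        (\<forall>f\<in>X. nrm f \<le> 1 \<longrightarrow> (\<exists>g\<in>G. nrm (\<lambda>i. \<phi> f * h i - g i) < e))"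
      using k scale_mem[OF h] by (intro exI[of _ "(\<lambda>z i. z * h i) ` k"]) auto
  qed
  moreover have "linear_op_on X (\<lambda>f i. \<phi> f * h i)"
    unfolding linear_op_on_def using lin scale_mem[OF h] by (auto simp: algebra_simps)
  ultimately show ?thesis by (simp add: compact_op_on_iff)
qed

lemma compact_op_sum:
  assumes "finite A" "\<And>a. a \<in> A \<Longrightarrow> compact_op_on X nrm (K a)"
  shows "compact_op_on X nrm (\<lambda>f i. \<Sum>a\<in>A. K a f i)"
  using assms by (induction A rule: finite_induct) (simp_all add: compact_op_zero compact_op_add)

lemma compact_op_bounded:
  assumes "compact_op_on X nrm K"
  shows "bounded_op_on X nrm K"
proof -
  have lin: "linear_op_on X K" and nets: "has_nets K" using assms by (auto simp: compact_op_on_iff)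
  obtain G where G: "finite G" "G \<subseteq> X"
      "\<And>f. f \<in> X \<Longrightarrow> nrm f \<le> 1 \<Longrightarrow> \<exists>g\<in>G. nrm (\<lambda>i. K f i - g i) < 1"
    using nets unfolding has_nets_def by (meson zero_less_one)
  define C where "C = 1 + (\<Sum>g\<in>G. nrm g)"
  have unit: "nrm (K f) \<le> C" if f: "f \<in> X" "nrm f \<le> 1" for f
  proof -
    obtain g where g: "g \<in> G" "nrm (\<lambda>i. K f i - g i) < 1" using G(3)[OF f] by blast
    have mem: "K f \<in> X" "g \<in> X" using linear_op_onD(1)[OF lin] f g G by blast+
    have "nrm (K f) \<le> nrm (\<lambda>i. K f i - g i) + nrm g"
      using nrm_add[OF diff_mem[OF mem] mem(2)] by simp
    moreover have "nrm g \<le> (\<Sum>g\<in>G. nrm g)"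
      using G nrm_nonneg g by (intro member_le_sum) auto
    ultimately show ?thesis using g by (simp add: C_def)
  qed
  have "nrm (K f) \<le> C * nrm f" if f: "f \<in> X" for f
  proof (cases "nrm f = 0")
    case True
    then have "f = (\<lambda>_. 0)" using nrm_le_zero_imp f by simp
    then have "K f = (\<lambda>i. 0)" using linear_op_onD(4)[OF lin zero_mem, of 0] by simp
    then show ?thesis by (simp add: nrm_zero True)
  next
    case False
    then have pos: "nrm f > 0" using nrm_nonneg[OF f] by simp
    let ?u = "\<lambda>i. of_real (1 / nrm f) * f i"
    have "nrm ?u = 1" using nrm_scale[OF f, of "of_real (1 / nrm f)"] pos by (simp add: norm_divide)
    then have "nrm (K ?u) \<le> C" by (intro unit scale_mem[OF f]) simp
    moreover have "nrm (K ?u) = nrm (K f) / nrm f"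
      using linear_op_onD(4)[OF lin f, of "of_real (1 / nrm f)"] linear_op_onD(1)[OF lin f]
        nrm_scale[of "K f" "of_real (1 / nrm f)"] pos by (simp add: norm_divide)
    ultimately show ?thesis using pos by (simp add: divide_le_eq)
  qed
  then show ?thesis using lin by (auto simp: bounded_op_on_def)
qed

subsection \<open>The essential norm and the essential spectral radius\<close>

lemma bounded_op_diff:
  assumes "bounded_op_on X nrm T" "bounded_op_on X nrm S"
  shows "bounded_op_on X nrm (\<lambda>f i. T f i - S f i)"
proof -
  obtain C D where CD: "\<And>f. f \<in> X \<Longrightarrow> nrm (T f) \<le> C * nrm f" "\<And>f. f \<in> X \<Longrightarrow> nrm (S f) \<le> D * nrm f"
    using assms by (auto simp: bounded_op_on_def)
  have lin: "linear_op_on X T" "linear_op_on X S" using assms by (auto simp: bounded_op_on_def)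
  have "nrm (\<lambda>i. T f i - S f i) \<le> (C + D) * nrm f" if "f \<in> X" for f
    using nrm_diff[of "T f" "S f"] linear_op_onD(1)[OF lin(1) that] linear_op_onD(1)[OF lin(2) that]
      CD[OF that] by (simp add: algebra_simps)
  then show ?thesis using linear_op_on_diff[OF lin] by (auto simp: bounded_op_on_def)
qed

lemma bounded_op_comp:
  assumes "bounded_op_on X nrm T" "bounded_op_on X nrm S"
  shows "bounded_op_on X nrm (\<lambda>f. T (S f))"
proof -
  obtain C0 D where CD: "\<And>f. f \<in> X \<Longrightarrow> nrm (T f) \<le> C0 * nrm f" "\<And>f. f \<in> X \<Longrightarrow> nrm (S f) \<le> D * nrm f"
    using assms by (auto simp: bounded_op_on_def)
  have lin: "linear_op_on X T" "linear_op_on X S" using assms by (auto simp: bounded_op_on_def)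
  have "nrm (T (S f)) \<le> (\<bar>C0\<bar> * D) * nrm f" if f: "f \<in> X" for f
  proof -
    have Sf: "S f \<in> X" using linear_op_onD(1)[OF lin(2) f] .
    have "nrm (T (S f)) \<le> C0 * nrm (S f)" by (rule CD(1)[OF Sf])
    also have "\<dots> \<le> \<bar>C0\<bar> * nrm (S f)" by (intro mult_right_mono nrm_nonneg Sf) auto
    also have "\<dots> \<le> \<bar>C0\<bar> * (D * nrm f)" by (intro mult_left_mono CD(2) f) auto
    finally show ?thesis by (simp add: mult.assoc)
  qed
  then show ?thesis using linear_op_on_comp[OF lin] by (auto simp: bounded_op_on_def)
qed

lemma bounded_op_id: "bounded_op_on X nrm id"
  unfolding bounded_op_on_def linear_op_on_def by (intro conjI exI[of _ 1]) auto

lemma bounded_op_power: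
  assumes "bounded_op_on X nrm T"
  shows "bounded_op_on X nrm (T ^^ n)"
proof (induction n)
  case 0
  then show ?case using bounded_op_id by (simp add: id_def)
next
  case (Suc n)
  then show ?case using bounded_op_comp[OF assms Suc] by (simp add: o_def)
qed

lemma op_norm_bdd:
  assumes "bounded_op_on X nrm T"
  shows "bdd_above ((\<lambda>f. nrm (T f)) ` {f \<in> X. nrm f \<le> 1})"
proof -
  obtain C where C: "\<And>f. f \<in> X \<Longrightarrow> nrm (T f) \<le> C * nrm f" using assms by (auto simp: bounded_op_on_def)
  have "nrm (T f) \<le> \<bar>C\<bar>" if "f \<in> X" "nrm f \<le> 1" for f
  proof -
    have "C * nrm f \<le> \<bar>C\<bar> * 1" using that nrm_nonneg by (intro mult_mono) auto
    then show ?thesis using C[OF that(1)] by simp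
  qed
  then show ?thesis by (intro bdd_aboveI[of _ "\<bar>C\<bar>"]) auto
qed

lemma op_norm_nonneg:
  assumes "bounded_op_on X nrm T"
  shows "0 \<le> op_norm_on X nrm T"
proof -
  have "0 \<le> nrm (T (\<lambda>_. 0))"
    using assms zero_mem by (auto simp: bounded_op_on_def linear_op_on_def intro: nrm_nonneg)
  also have "\<dots> \<le> op_norm_on X nrm T"
    unfolding op_norm_on_def
    by (rule cSUP_upper[OF _ op_norm_bdd[OF assms]]) (simp add: zero_mem nrm_zero)
  finally show ?thesis .
qed

lemma op_norm_bound:
  assumes "bounded_op_on X nrm T" "f \<in> X"
  shows "nrm (T f) \<le> op_norm_on X nrm T * nrm f"
proof (cases "nrm f = 0")
  case True
  obtain C where "\<And>f. f \<in> X \<Longrightarrow> nrm (T f) \<le> C * nrm f" using assms by (auto simp: bounded_op_on_def)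
  then show ?thesis using True assms(2) by fastforce
next
  case False
  then have pos: "nrm f > 0" using nrm_nonneg[OF assms(2)] by simp
  have lin: "linear_op_on X T" using assms by (auto simp: bounded_op_on_def)
  let ?u = "\<lambda>i. of_real (1 / nrm f) * f i"
  have "nrm ?u = 1" using nrm_scale[OF assms(2), of "of_real (1 / nrm f)"] pos by (simp add: norm_divide)
  then have "nrm (T ?u) \<le> op_norm_on X nrm T"
    unfolding op_norm_on_def
    by (intro cSUP_upper[OF _ op_norm_bdd[OF assms(1)]]) (intro CollectI conjI scale_mem[OF assms(2)], simp)
  moreover have "nrm (T ?u) = nrm (T f) / nrm f"
    using linear_op_onD(4)[OF lin assms(2), of "of_real (1 / nrm f)"] linear_op_onD(1)[OF lin assms(2)]
      nrm_scale[of "T f" "of_real (1 / nrm f)"] pos by (simp add: norm_divide)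
  ultimately show ?thesis using pos by (simp add: divide_le_eq)
qed

lemma op_norm_le:
  assumes "\<And>f. f \<in> X \<Longrightarrow> nrm (T f) \<le> c * nrm f" "0 \<le> c"
  shows "op_norm_on X nrm T \<le> c"
  unfolding op_norm_on_def
proof (rule cSUP_least)
  have "(\<lambda>_. 0) \<in> {f \<in> X. nrm f \<le> 1}" by (simp add: zero_mem nrm_zero)
  then show "{f \<in> X. nrm f \<le> 1} \<noteq> {}" by (metis empty_iff)
  fix f assume f: "f \<in> {f \<in> X. nrm f \<le> 1}"
  then have "nrm (T f) \<le> c * nrm f" using assms(1)[of f] by simp
  also have "\<dots> \<le> c * 1" using f assms by (intro mult_left_mono) auto
  finally show "nrm (T f) \<le> c" by simp
qed

context
  fixes T assumes T: "bounded_op_on X nrm T"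
begin

lemma diff_compact_bounded: "compact_op_on X nrm K \<Longrightarrow> bounded_op_on X nrm (\<lambda>f i. T f i - K f i)"
  by (intro bounded_op_diff T compact_op_bounded)

lemma ess_norm_bdd: "bdd_below {op_norm_on X nrm (\<lambda>f i. T f i - K f i) |K. compact_op_on X nrm K}"
  by (rule bdd_belowI[of _ 0]) (auto intro: op_norm_nonneg diff_compact_bounded)

lemma ess_norm_nonneg: "0 \<le> ess_norm_on X nrm T"
  unfolding ess_norm_on_def
proof (rule cInf_greatest)
  show "{op_norm_on X nrm (\<lambda>f i. T f i - K f i) |K. compact_op_on X nrm K} \<noteq> {}"
    using compact_op_zero by auto
qed (auto intro: op_norm_nonneg diff_compact_bounded)

lemma ess_norm_le:
  assumes "compact_op_on X nrm K" "0 \<le> c"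
    and "\<And>f. f \<in> X \<Longrightarrow> nrm (\<lambda>i. T f i - K f i) \<le> c * nrm f"
  shows "ess_norm_on X nrm T \<le> c"
proof -
  have "ess_norm_on X nrm T \<le> op_norm_on X nrm (\<lambda>f i. T f i - K f i)"
    unfolding ess_norm_on_def by (rule cInf_lower[OF _ ess_norm_bdd]) (use assms(1) in auto)
  also have "\<dots> \<le> c" by (rule op_norm_le) (use assms in auto)
  finally show ?thesis .
qed

lemma ess_norm_approx:
  assumes "ess_norm_on X nrm T < c"
  obtains K where "compact_op_on X nrm K" "\<And>f. f \<in> X \<Longrightarrow> nrm (\<lambda>i. T f i - K f i) \<le> c * nrm f"
proof -
  have ne: "{op_norm_on X nrm (\<lambda>f i. T f i - K f i) |K. compact_op_on X nrm K} \<noteq> {}"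
    using compact_op_zero by auto
  obtain K where K: "compact_op_on X nrm K" "op_norm_on X nrm (\<lambda>f i. T f i - K f i) < c"
    using assms cInf_less_iff[OF ne ess_norm_bdd] unfolding ess_norm_on_def by auto
  have "nrm (\<lambda>i. T f i - K f i) \<le> c * nrm f" if "f \<in> X" for f
  proof -
    have "nrm (\<lambda>i. T f i - K f i) \<le> op_norm_on X nrm (\<lambda>f i. T f i - K f i) * nrm f"
      by (rule op_norm_bound[OF diff_compact_bounded[OF K(1)] that])
    also have "\<dots> \<le> c * nrm f" using K nrm_nonneg[OF that] by (intro mult_right_mono) auto
    finally show ?thesis .
  qed
  then show ?thesis using that[OF K(1)] by simp
qed

end

text \<open>Writing \<open>T S - (T - K) (S - L) = T L + K S - K L\<close> exhibits a compact perturbation of \<open>T S\<close>,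
  so the essential norm is submultiplicative like the norm itself.\<close>

lemma ess_norm_comp:
  assumes T: "bounded_op_on X nrm T" and S: "bounded_op_on X nrm S"
  shows "ess_norm_on X nrm (\<lambda>f. T (S f)) \<le> ess_norm_on X nrm T * ess_norm_on X nrm S"
proof -
  let ?t = "ess_norm_on X nrm T" and ?s = "ess_norm_on X nrm S"
  have TS: "bounded_op_on X nrm (\<lambda>f. T (S f))" by (rule bounded_op_comp[OF T S])
  have le: "ess_norm_on X nrm (\<lambda>f. T (S f)) \<le> (?t + e) * (?s + e)" if e: "e > 0" for e
  proof -
    obtain K where K: "compact_op_on X nrm K"
      "\<And>f. f \<in> X \<Longrightarrow> nrm (\<lambda>i. T f i - K f i) \<le> (?t + e) * nrm f"
      by (rule ess_norm_approx[OF T, of "?t + e"]) (use e in auto)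
    obtain L where L: "compact_op_on X nrm L"
      "\<And>f. f \<in> X \<Longrightarrow> nrm (\<lambda>i. S f i - L f i) \<le> (?s + e) * nrm f"
      by (rule ess_norm_approx[OF S, of "?s + e"]) (use e in auto)
    let ?C = "\<lambda>f i. (T (L f) i + K (S f) i) + (-1) * K (L f) i"
    have C: "compact_op_on X nrm ?C"
      by (intro compact_op_add compact_op_scale compact_op_comp_left[OF T L(1)]
          compact_op_comp_right[OF K(1) S] compact_op_comp_right[OF K(1)] compact_op_bounded L(1))
    have t: "0 \<le> ?t + e" "0 \<le> ?s + e"
      using ess_norm_nonneg[OF T] ess_norm_nonneg[OF S] that by auto
    have linT: "linear_op_on X T" and linK: "linear_op_on X K"
      and linS: "linear_op_on X S" and linL: "linear_op_on X L"
      using T S K L by (auto simp: bounded_op_on_def compact_op_on_def)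
    show ?thesis
    proof (rule ess_norm_le[OF TS C])
      show "0 \<le> (?t + e) * (?s + e)" using t by simp
      fix f assume f: "f \<in> X"
      define u where "u = (\<lambda>i. S f i - L f i)"
      have mem: "S f \<in> X" "L f \<in> X" using linear_op_onD(1)[OF linS f] linear_op_onD(1)[OF linL f] .
      then have u: "u \<in> X" unfolding u_def by (rule diff_mem)
      have "nrm (\<lambda>i. T (S f) i - ?C f i) = nrm (\<lambda>i. T u i - K u i)"
        unfolding u_def using linear_op_onD(3)[OF linT mem] linear_op_onD(3)[OF linK mem]
        by (simp add: algebra_simps)
      also have "\<dots> \<le> (?t + e) * nrm u" by (rule K(2)[OF u])
      also have "\<dots> \<le> (?t + e) * ((?s + e) * nrm f)"
        unfolding u_def by (intro mult_left_mono L(2) f t)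
      finally show "nrm (\<lambda>i. T (S f) i - ?C f i) \<le> (?t + e) * (?s + e) * nrm f"
        by (simp add: mult.assoc)
    qed
  qed
  have lim: "((\<lambda>e. (?t + e) * (?s + e)) \<longlongrightarrow> (?t + 0) * (?s + 0)) (at_right 0)"
    by (intro tendsto_intros)
  have "ess_norm_on X nrm (\<lambda>f. T (S f)) \<le> (?t + 0) * (?s + 0)"
    by (rule tendsto_lowerbound[OF lim]) (auto simp: eventually_at_right_less le eventually_at_filter)
  then show ?thesis by simp
qed

text \<open>If \<open>T - R\<close> is compact, then so is \<open>T\<^sup>n - R\<^sup>n\<close>, by induction on
  \<open>T\<^sup>n\<^sup>+\<^sup>1 - R\<^sup>n\<^sup>+\<^sup>1 = T (T\<^sup>n - R\<^sup>n) + (T - R) R\<^sup>n\<close>; hence the essential norm of \<open>T\<^sup>n\<close> is at most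
  the \<open>n\<close>-th power of the norm of \<open>R\<close>.\<close>

lemma ess_spectral_radius_le:
  assumes T: "bounded_op_on X nrm T" and R: "linear_op_on X R"
    and compact: "compact_op_on X nrm (\<lambda>f i. T f i - R f i)"
    and r: "0 \<le> r" "\<And>f. f \<in> X \<Longrightarrow> nrm (R f) \<le> r * nrm f"
  shows "ess_spectral_radius X nrm T \<le> r"
proof -
  have Rb: "bounded_op_on X nrm R" using R r by (auto simp: bounded_op_on_def)
  have linT: "linear_op_on X T" using T by (simp add: bounded_op_on_def)
  have pow_mem: "f \<in> X \<Longrightarrow> (R ^^ n) f \<in> X \<and> (T ^^ n) f \<in> X" for f n
    using bounded_op_power[OF Rb, of n] bounded_op_power[OF T, of n]
    by (auto simp: bounded_op_on_def linear_op_on_def)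
  have cpt: "\<exists>K. compact_op_on X nrm K \<and> (\<forall>f\<in>X. \<forall>i. (T ^^ n) f i - K f i = (R ^^ n) f i)" for n
  proof (induction n)
    case 0
    show ?case using compact_op_zero by (intro exI[of _ "\<lambda>f i. 0"]) simp
  next
    case (Suc n)
    then obtain K where K: "compact_op_on X nrm K" "\<forall>f\<in>X. \<forall>i. (T ^^ n) f i - K f i = (R ^^ n) f i"
      by (elim exE conjE)
    let ?L = "\<lambda>f i. T (K f) i + (T ((R ^^ n) f) i - R ((R ^^ n) f) i)"
    have "compact_op_on X nrm ?L"
      using compact_op_add[OF compact_op_comp_left[OF T K(1)]
          compact_op_comp_right[OF compact bounded_op_power[OF Rb, of n]]] .
    moreover have "(T ^^ Suc n) f i - ?L f i = (R ^^ Suc n) f i" if f: "f \<in> X" for f i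
    proof -
      have Kf: "K f \<in> X" using K(1) f by (auto simp: compact_op_on_def linear_op_on_def)
      have "(R ^^ n) f = (\<lambda>i. (T ^^ n) f i - K f i)" using K(2) f by auto
      then have "T ((R ^^ n) f) = (\<lambda>i. T ((T ^^ n) f) i - T (K f) i)"
        using linear_op_onD(3)[OF linT] pow_mem[OF f] Kf by simp
      then show ?thesis by simp
    qed
    ultimately show ?case by (intro exI[of _ ?L] conjI ballI allI)
  qed
  have Rn: "nrm ((R ^^ n) f) \<le> r ^ n * nrm f" if "f \<in> X" for f n
  proof (induction n)
    case (Suc n)
    have "nrm ((R ^^ Suc n) f) \<le> r * nrm ((R ^^ n) f)" using r(2) pow_mem that by simp
    also have "\<dots> \<le> r * (r ^ n * nrm f)" by (intro mult_left_mono Suc r(1))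
    finally show ?case by (simp add: mult.assoc)
  qed simp
  define a where "a = (\<lambda>n. ess_norm_on X nrm (T ^^ n))"
  have a_le: "a n \<le> r ^ n" for n
  proof -
    obtain K where K: "compact_op_on X nrm K" "\<And>f i. f \<in> X \<Longrightarrow> (T ^^ n) f i - K f i = (R ^^ n) f i"
      using cpt[of n] by auto
    show ?thesis
      unfolding a_def
      by (rule ess_norm_le[OF bounded_op_power[OF T] K(1)]) (use r(1) K(2) Rn in auto)
  qed
  have "convergent (\<lambda>n. root n (a n))"
  proof (rule submultiplicative_root_convergent)
    show "0 \<le> a n" for n unfolding a_def by (rule ess_norm_nonneg[OF bounded_op_power[OF T]])
    show "a (m + n) \<le> a m * a n" for m n
      unfolding a_def using ess_norm_comp[OF bounded_op_power[OF T] bounded_op_power[OF T], of m n]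
      by (simp add: funpow_add o_def)
  qed
  then have lim: "(\<lambda>n. root n (a n)) \<longlonglongrightarrow> ess_spectral_radius X nrm T"
    unfolding ess_spectral_radius_def a_def by (simp add: convergent_LIMSEQ_iff)
  have "root n (a n) \<le> r" if "n \<ge> 1" for n
  proof -
    have "root n (a n) \<le> root n (r ^ n)" using a_le that by simp
    then show ?thesis using r(1) that by (simp add: real_root_power_cancel)
  qed
  then show ?thesis by (intro LIMSEQ_le_const2[OF lim]) auto
qed

end

section \<open>The weighted supremum space and the weighted square-summable space\<close>

lemma BV_ball_iff:
  assumes V: "\<And>n. 0 < V n"
  shows "g \<in> BV_space V \<and> BV_norm V g \<le> M \<longleftrightarrow> (\<forall>n. cmod (g n) \<le> M * V n)"
proof
  assume g: "g \<in> BV_space V \<and> BV_norm V g \<le> M"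
  show "\<forall>n. cmod (g n) \<le> M * V n"
  proof
    fix n
    have "cmod (g n) / V n \<le> BV_norm V g"
      using g unfolding BV_norm_def BV_space_def by (intro cSUP_upper) auto
    then show "cmod (g n) \<le> M * V n" using g V[of n] by (simp add: pos_divide_le_eq[symmetric])
  qed
next
  assume "\<forall>n. cmod (g n) \<le> M * V n"
  then have le: "cmod (g n) / V n \<le> M" for n using V[of n] by (simp add: pos_divide_le_eq)
  then have "g \<in> BV_space V" unfolding BV_space_def by (auto intro!: bdd_aboveI[of _ M])
  moreover have "BV_norm V g \<le> M" unfolding BV_norm_def by (intro cSUP_least) (auto simp: le)
  ultimately show "g \<in> BV_space V \<and> BV_norm V g \<le> M" by blast
qed

lemma BV_bound:
  assumes "\<And>n. 0 < V n" "g \<in> BV_space V"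
  shows "cmod (g n) \<le> BV_norm V g * V n"
  using BV_ball_iff[where V=V and g=g and M="BV_norm V g"] assms by blast

lemma BV_nonneg:
  assumes "\<And>n. 0 < V n" "g \<in> BV_space V"
  shows "0 \<le> BV_norm V g"
  using order_trans[OF norm_ge_zero BV_bound[OF assms, of 0]] assms(1)[of 0]
  by (simp add: zero_le_mult_iff)

lemma seq_space_BV:
  assumes V: "\<And>n. 0 < V n"
  shows "seq_space (BV_space V) (BV_norm V)"
proof
  note iff = BV_ball_iff[where V=V, OF V]
  fix f g :: "nat \<Rightarrow> complex" and c :: complex and i j :: nat
  show "(\<lambda>_. 0) \<in> BV_space V" using iff[of "\<lambda>_. 0" 0] by simp
  have add: "(\<lambda>i. f i + g i) \<in> BV_space V \<and> BV_norm V (\<lambda>i. f i + g i) \<le> BV_norm V f + BV_norm V g"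
    if "f \<in> BV_space V" "g \<in> BV_space V"
    unfolding iff
  proof
    fix n
    show "cmod (f n + g n) \<le> (BV_norm V f + BV_norm V g) * V n"
      using norm_triangle_ineq[of "f n" "g n"] BV_bound[OF V that(1), of n] BV_bound[OF V that(2), of n]
      by (simp add: algebra_simps)
  qed
  show "f \<in> BV_space V \<Longrightarrow> g \<in> BV_space V \<Longrightarrow> (\<lambda>i. f i + g i) \<in> BV_space V" using add by blast
  show "f \<in> BV_space V \<Longrightarrow> g \<in> BV_space V \<Longrightarrow>
      BV_norm V (\<lambda>i. f i + g i) \<le> BV_norm V f + BV_norm V g" using add by blast
  have scale: "(\<lambda>i. c * f i) \<in> BV_space V \<and> BV_norm V (\<lambda>i. c * f i) \<le> cmod c * BV_norm V f"
    if "f \<in> BV_space V"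
    unfolding iff
    using BV_bound[OF V that] by (auto simp: norm_mult mult.assoc intro!: mult_left_mono)
  show "f \<in> BV_space V \<Longrightarrow> (\<lambda>i. c * f i) \<in> BV_space V" using scale by blast
  show "f \<in> BV_space V \<Longrightarrow> BV_norm V (\<lambda>i. c * f i) \<le> cmod c * BV_norm V f" using scale by blast
  show "f \<in> BV_space V \<Longrightarrow> 0 \<le> BV_norm V f" by (rule BV_nonneg[OF V])
  show "\<exists>w. \<forall>f\<in>BV_space V. cmod (f i) \<le> w * BV_norm V f"
    using BV_bound[OF V] by (intro exI[of _ "V i"]) (auto simp: mult.commute)
  show "(\<lambda>i. if i = j then 1 else 0) \<in> BV_space V"
  proof -
    have "\<forall>n. cmod (if n = j then 1 else 0) \<le> 1 / V j * V n" using less_imp_le[OF V] less_imp_neq[OF V] by auto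
    then show ?thesis using iff[of "\<lambda>i. if i = j then 1 else 0" "1 / V j"] by simp
  qed
next
  note iff = BV_ball_iff[where V=V, OF V]
  fix F :: "nat \<Rightarrow> nat \<Rightarrow> complex" and M h
  assume F: "\<And>k. F k \<in> BV_space V \<and> BV_norm V (F k) \<le> M" and lim: "\<And>i. (\<lambda>k. F k i) \<longlonglongrightarrow> h i"
  show "h \<in> BV_space V \<and> BV_norm V h \<le> M"
    unfolding iff
  proof
    fix n
    show "cmod (h n) \<le> M * V n"
      by (rule LIMSEQ_le_const2[OF tendsto_norm[OF lim]]) (use F iff in blast)
  qed
qed

text \<open>The norm is expressed through the finite Euclidean norms of the initial segments, for which
  Minkowski's inequality is available.\<close>

lemma l2_ball_iff:
  assumes \<pi>: "\<And>n. 0 < \<pi> n" and M: "0 \<le> M"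
  shows "f \<in> l2_space \<pi> \<and> l2_norm \<pi> f \<le> M \<longleftrightarrow>
    (\<forall>n. L2_set (\<lambda>i. cmod (f i) * sqrt (\<pi> i)) {..<n} \<le> M)"
proof -
  have L2: "L2_set (\<lambda>i. cmod (f i) * sqrt (\<pi> i)) {..<n} \<le> M \<longleftrightarrow> (\<Sum>i<n. (cmod (f i))\<^sup>2 * \<pi> i) \<le> M\<^sup>2" for n
  proof -
    have "(\<Sum>i<n. (cmod (f i) * sqrt (\<pi> i))\<^sup>2) = (\<Sum>i<n. (cmod (f i))\<^sup>2 * \<pi> i)"
      using \<pi> by (intro sum.cong) (auto simp: power_mult_distrib less_imp_le)
    then show ?thesis
      using real_sqrt_le_iff[of "\<Sum>i<n. (cmod (f i))\<^sup>2 * \<pi> i" "M\<^sup>2"] M by (simp add: L2_set_def)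
  qed
  have nonneg: "0 \<le> (cmod (f i))\<^sup>2 * \<pi> i" for i using \<pi>[of i] by simp
  show ?thesis
    unfolding L2
  proof
    assume f: "f \<in> l2_space \<pi> \<and> l2_norm \<pi> f \<le> M"
    then have "summable (\<lambda>i. (cmod (f i))\<^sup>2 * \<pi> i)" by (simp add: l2_space_def)
    moreover have "(\<Sum>i. (cmod (f i))\<^sup>2 * \<pi> i) \<le> M\<^sup>2"
      using f unfolding l2_norm_def by (auto dest: sqrt_le_D)
    ultimately show "\<forall>n. (\<Sum>i<n. (cmod (f i))\<^sup>2 * \<pi> i) \<le> M\<^sup>2"
      using sum_le_suminf[of "\<lambda>i. (cmod (f i))\<^sup>2 * \<pi> i"] nonneg order_trans by blast
  next
    assume le: "\<forall>n. (\<Sum>i<n. (cmod (f i))\<^sup>2 * \<pi> i) \<le> M\<^sup>2"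
    then have s: "summable (\<lambda>i. (cmod (f i))\<^sup>2 * \<pi> i)"
      using nonneg by (intro bounded_imp_summable[of _ "M\<^sup>2"])
        (auto simp: lessThan_Suc_atMost[symmetric] simp del: sum.lessThan_Suc)
    moreover have "(\<Sum>i. (cmod (f i))\<^sup>2 * \<pi> i) \<le> M\<^sup>2"
      using s le by (intro suminf_le_const) auto
    ultimately show "f \<in> l2_space \<pi> \<and> l2_norm \<pi> f \<le> M"
      using M by (simp add: l2_space_def l2_norm_def real_le_lsqrt suminf_nonneg nonneg)
  qed
qed

lemma l2_nonneg: "(\<And>n. 0 < \<pi> n) \<Longrightarrow> f \<in> l2_space \<pi> \<Longrightarrow> 0 \<le> l2_norm \<pi> f"
  unfolding l2_norm_def l2_space_def by (simp add: suminf_nonneg less_imp_le)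

lemma l2_partial:
  assumes "\<And>n. 0 < \<pi> n" "f \<in> l2_space \<pi>"
  shows "L2_set (\<lambda>i. cmod (f i) * sqrt (\<pi> i)) {..<n} \<le> l2_norm \<pi> f"
  using l2_ball_iff[where \<pi>=\<pi> and f=f, OF assms(1) l2_nonneg[OF assms]] assms by blast

lemma l2_coord:
  assumes \<pi>: "\<And>n. 0 < \<pi> n" "f \<in> l2_space \<pi>"
  shows "cmod (f i) * sqrt (\<pi> i) \<le> l2_norm \<pi> f"
proof -
  have "cmod (f i) * sqrt (\<pi> i) \<le> L2_set (\<lambda>i. cmod (f i) * sqrt (\<pi> i)) {..<Suc i}"
    using \<pi> by (intro member_le_L2_set) auto
  then show ?thesis using l2_partial[OF assms, of "Suc i"] by linarith
qed

lemma seq_space_l2: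
  assumes \<pi>: "\<And>n. 0 < \<pi> n"
  shows "seq_space (l2_space \<pi>) (l2_norm \<pi>)"
proof
  note iff = l2_ball_iff[where \<pi>=\<pi>, OF \<pi>]
  note nonneg = l2_nonneg[of \<pi>, OF \<pi>] and partial = l2_partial[of \<pi>, OF \<pi>]
  fix f g :: "nat \<Rightarrow> complex" and c :: complex and i j :: nat
  show "(\<lambda>_. 0) \<in> l2_space \<pi>" using iff[of 0 "\<lambda>_. 0"] by (simp add: L2_set_0')
  have add: "(\<lambda>i. f i + g i) \<in> l2_space \<pi> \<and> l2_norm \<pi> (\<lambda>i. f i + g i) \<le> l2_norm \<pi> f + l2_norm \<pi> g"
    if "f \<in> l2_space \<pi>" "g \<in> l2_space \<pi>"
  proof (subst iff)
    show "0 \<le> l2_norm \<pi> f + l2_norm \<pi> g" using nonneg that by (simp add: add_nonneg_nonneg)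
    show "\<forall>n. L2_set (\<lambda>i. cmod (f i + g i) * sqrt (\<pi> i)) {..<n} \<le> l2_norm \<pi> f + l2_norm \<pi> g"
    proof
      fix n
      have "L2_set (\<lambda>i. cmod (f i + g i) * sqrt (\<pi> i)) {..<n}
          \<le> L2_set (\<lambda>i. cmod (f i) * sqrt (\<pi> i) + cmod (g i) * sqrt (\<pi> i)) {..<n}"
        using \<pi> by (intro L2_set_mono)
          (auto simp: less_imp_le distrib_right[symmetric] norm_triangle_ineq intro!: mult_right_mono)
      also have "\<dots> \<le> L2_set (\<lambda>i. cmod (f i) * sqrt (\<pi> i)) {..<n} + L2_set (\<lambda>i. cmod (g i) * sqrt (\<pi> i)) {..<n}"
        by (rule L2_set_triangle_ineq)
      also have "\<dots> \<le> l2_norm \<pi> f + l2_norm \<pi> g" by (intro add_mono partial that)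
      finally show "L2_set (\<lambda>i. cmod (f i + g i) * sqrt (\<pi> i)) {..<n} \<le> l2_norm \<pi> f + l2_norm \<pi> g" .
    qed
  qed
  show "f \<in> l2_space \<pi> \<Longrightarrow> g \<in> l2_space \<pi> \<Longrightarrow> (\<lambda>i. f i + g i) \<in> l2_space \<pi>" using add by blast
  show "f \<in> l2_space \<pi> \<Longrightarrow> g \<in> l2_space \<pi> \<Longrightarrow>
      l2_norm \<pi> (\<lambda>i. f i + g i) \<le> l2_norm \<pi> f + l2_norm \<pi> g" using add by blast
  have scale: "(\<lambda>i. c * f i) \<in> l2_space \<pi> \<and> l2_norm \<pi> (\<lambda>i. c * f i) \<le> cmod c * l2_norm \<pi> f"
    if "f \<in> l2_space \<pi>"
  proof (subst iff)
    show "0 \<le> cmod c * l2_norm \<pi> f" using nonneg[OF that] by simp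
    show "\<forall>n. L2_set (\<lambda>i. cmod (c * f i) * sqrt (\<pi> i)) {..<n} \<le> cmod c * l2_norm \<pi> f"
    proof
      fix n
      have "L2_set (\<lambda>i. cmod (c * f i) * sqrt (\<pi> i)) {..<n}
          = cmod c * L2_set (\<lambda>i. cmod (f i) * sqrt (\<pi> i)) {..<n}"
        by (simp add: L2_set_right_distrib norm_mult mult.assoc)
      also have "\<dots> \<le> cmod c * l2_norm \<pi> f" by (intro mult_left_mono partial that) auto
      finally show "L2_set (\<lambda>i. cmod (c * f i) * sqrt (\<pi> i)) {..<n} \<le> cmod c * l2_norm \<pi> f" .
    qed
  qed
  show "f \<in> l2_space \<pi> \<Longrightarrow> (\<lambda>i. c * f i) \<in> l2_space \<pi>" using scale by blast
  show "f \<in> l2_space \<pi> \<Longrightarrow> l2_norm \<pi> (\<lambda>i. c * f i) \<le> cmod c * l2_norm \<pi> f" using scale by blast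
  show "f \<in> l2_space \<pi> \<Longrightarrow> 0 \<le> l2_norm \<pi> f" by (rule nonneg)
  show "\<exists>w. \<forall>f\<in>l2_space \<pi>. cmod (f i) \<le> w * l2_norm \<pi> f"
    using l2_coord[of \<pi> _ i, OF \<pi>] \<pi>[of i]
    by (intro exI[of _ "1 / sqrt (\<pi> i)"]) (simp add: pos_le_divide_eq)
  show "(\<lambda>i. if i = j then 1 else 0) \<in> l2_space \<pi>"
    unfolding l2_space_def by (auto intro!: summable_finite[of "{j}"] split: if_splits)
next
  note iff = l2_ball_iff[where \<pi>=\<pi>, OF \<pi>]
  fix F :: "nat \<Rightarrow> nat \<Rightarrow> complex" and M h
  assume F: "\<And>k. F k \<in> l2_space \<pi> \<and> l2_norm \<pi> (F k) \<le> M" and lim: "\<And>i. (\<lambda>k. F k i) \<longlonglongrightarrow> h i"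
  have M: "0 \<le> M" using F[of 0] l2_nonneg[of \<pi> "F 0", OF \<pi>] by linarith
  show "h \<in> l2_space \<pi> \<and> l2_norm \<pi> h \<le> M"
  proof (subst iff[OF M], rule allI)
    fix n
    have "(\<lambda>k. L2_set (\<lambda>i. cmod (F k i) * sqrt (\<pi> i)) {..<n})
        \<longlonglongrightarrow> L2_set (\<lambda>i. cmod (h i) * sqrt (\<pi> i)) {..<n}"
      unfolding L2_set_def by (intro tendsto_intros lim)
    then show "L2_set (\<lambda>i. cmod (h i) * sqrt (\<pi> i)) {..<n} \<le> M"
      by (rule LIMSEQ_le_const2) (use F iff[OF M] in blast)
  qed
qed

section \<open>Aperiodicity and simultaneous positivity\<close>

text \<open>The differences of elements of \<open>S\<close> form a subgroup of the integers. Its positive generator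
  \<open>d\<close> divides every element of \<open>S\<close>, so it is \<open>1\<close>, and \<open>S\<close> contains two consecutive numbers \<open>y\<close> and
  \<open>y + 1\<close>. If \<open>n \<ge> y * y\<close>, then division by \<open>y\<close> gives \<open>n = q * y + s\<close> with \<open>s < y \<le> q\<close>, that is
  \<open>n = (q - s) * y + s * (y + 1)\<close>.\<close>

lemma additive_set_contains_tail:
  fixes S :: "nat set"
  assumes add: "\<And>m n. m \<in> S \<Longrightarrow> n \<in> S \<Longrightarrow> m + n \<in> S" and zero: "0 \<in> S" and gcd: "Gcd S = 1"
  shows "\<exists>n0. \<forall>n\<ge>n0. n \<in> S"
proof -
  have mult: "k * m \<in> S" if "m \<in> S" for k m
    using that by (induction k) (auto simp: zero add)
  define D where "D = {d. d > 0 \<and> (\<exists>y\<in>S. y + d \<in> S)}"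
  obtain x where "x \<in> S" "x \<noteq> 0"
  proof (rule ccontr)
    assume "\<not> thesis"
    then have "S = {0}" using that zero by auto
    then show False using gcd by simp
  qed
  then have "x \<in> D" unfolding D_def using zero by (auto intro: bexI[of _ 0])
  then have dD: "Least (\<lambda>d. d \<in> D) \<in> D" by (rule LeastI)
  define d where "d = (LEAST d. d \<in> D)"
  have d: "d > 0" and "\<exists>y\<in>S. y + d \<in> S" using dD by (auto simp: d_def D_def)
  then obtain y where y: "y \<in> S" "y + d \<in> S" by blast
  have "d dvd x" if x: "x \<in> S" for x
  proof (rule ccontr)
    assume "\<not> d dvd x"
    then have pos: "x mod d > 0" by (simp add: mod_greater_zero_iff_not_dvd)
    let ?q = "x div d"
    \<comment> \<open>The remainder is itself a difference, of \<open>x + q y\<close> and \<open>q (y + d)\<close>.\<close>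
    have "x + ?q * y = ?q * (y + d) + x mod d"
      using div_mult_mod_eq[of x d] by (simp add: algebra_simps)
    then have "?q * (y + d) + x mod d \<in> S" using add[OF x mult[OF y(1), of ?q]] by simp
    then have "x mod d \<in> D" unfolding D_def using pos mult[OF y(2), of ?q] by auto
    then have "d \<le> x mod d" unfolding d_def by (rule Least_le)
    then show False using d mod_less_divisor[of d x] by linarith
  qed
  then have "d dvd Gcd S" by (rule Gcd_greatest)
  then have "d = 1" using gcd by simp
  then have y1: "y + 1 \<in> S" using y by simp
  have "n \<in> S" if n: "n \<ge> y * y" for n
  proof (cases "y = 0")
    case True
    then show ?thesis using mult[OF y1, of n] by simp
  next
    case False
    let ?q = "n div y" and ?s = "n mod y"
    have "?s < y" using False by simp
    moreover have "y \<le> ?q" using div_le_mono[OF n, of y] False by simp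
    ultimately have le: "?s \<le> ?q" by linarith
    have "(?q - ?s) * y + ?s * (y + 1) = ?q * y + ?s"
      using le by (simp add: diff_mult_distrib algebra_simps)
    then have "n = (?q - ?s) * y + ?s * (y + 1)" using div_mult_mod_eq[of n y] by simp
    then show ?thesis using add[OF mult[OF y(1)] mult[OF y1]] by metis
  qed
  then show ?thesis by blast
qed

context
  fixes P assumes markov: "markov_kernel P"
begin

lemma kernel_nonneg: "0 \<le> P i j" and kernel_sums: "P i sums 1"
  using markov by (auto simp: markov_kernel_def)

lemma kernel_power_bounds: "0 \<le> kernel_power P n i j \<and> kernel_power P n i j \<le> 1"
  and kernel_power_summable: "summable (\<lambda>k. P i k * kernel_power P n k j)"
proof -
  have bounds: "\<forall>i. 0 \<le> kernel_power P n i j \<and> kernel_power P n i j \<le> 1" for n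
  proof (induction n)
    case (Suc n)
    have s: "summable (\<lambda>k. P i k * kernel_power P n k j)" for i
      by (rule summable_comparison_test'[of "P i" 0])
        (use Suc kernel_sums[of i] kernel_nonneg in \<open>auto simp: sums_iff abs_mult mult_left_le\<close>)
    show ?case
    proof
      fix i
      have "(\<Sum>k. P i k * kernel_power P n k j) \<le> (\<Sum>k. P i k)"
        using Suc kernel_sums[of i] kernel_nonneg s by (intro suminf_le) (auto simp: sums_iff mult_left_le)
      then show "0 \<le> kernel_power P (Suc n) i j \<and> kernel_power P (Suc n) i j \<le> 1"
        using s Suc kernel_nonneg kernel_sums[of i] by (auto simp: sums_iff intro!: suminf_nonneg)
    qed
  qed simp
  then show "0 \<le> kernel_power P n i j \<and> kernel_power P n i j \<le> 1" by blast
  show "summable (\<lambda>k. P i k * kernel_power P n k j)"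
    by (rule summable_comparison_test'[of "P i" 0])
      (use bounds[of n] kernel_sums[of i] kernel_nonneg in \<open>auto simp: sums_iff abs_mult mult_left_le\<close>)
qed

lemma kernel_power_Suc_pos:
  "0 < kernel_power P (Suc n) i j \<longleftrightarrow> (\<exists>k. 0 < P i k \<and> 0 < kernel_power P n k j)"
proof -
  have nonneg: "0 \<le> P i k * kernel_power P n k j" for k
    using kernel_nonneg kernel_power_bounds by simp
  have "0 < kernel_power P (Suc n) i j \<longleftrightarrow> (\<exists>k. 0 < P i k * kernel_power P n k j)"
    using suminf_pos_iff[OF kernel_power_summable nonneg] by simp
  also have "\<dots> \<longleftrightarrow> (\<exists>k. 0 < P i k \<and> 0 < kernel_power P n k j)"
    using kernel_nonneg kernel_power_bounds by (auto simp: zero_less_mult_iff not_less[symmetric])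
  finally show ?thesis .
qed

lemma kernel_power_add_pos:
  "0 < kernel_power P m i j \<Longrightarrow> 0 < kernel_power P n j k \<Longrightarrow> 0 < kernel_power P (m + n) i k"
proof (induction m arbitrary: i)
  case 0
  then show ?case by (simp split: if_splits)
next
  case (Suc m)
  then obtain l where "0 < P i l" "0 < kernel_power P m l j" using kernel_power_Suc_pos by blast
  then show ?case using Suc kernel_power_Suc_pos[of "m + n" i k] by auto
qed

text \<open>By aperiodicity, all sufficiently large times are possible return times to \<open>j\<close>. So the times that
  the different points of \<open>F\<close> need to reach \<open>j\<close> can be padded with loops to a common value.\<close>

lemma eventually_positive_on_finite:
  assumes irr: "irreducible_kernel P" and aper: "aperiodic_kernel P" and F: "finite F"
  shows "\<exists>n\<ge>1. \<forall>i\<in>F. 0 < kernel_power P n i j"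
proof -
  define S where "S = {n. 0 < kernel_power P n j j}"
  have "\<exists>n0. \<forall>n\<ge>n0. n \<in> S"
  proof (rule additive_set_contains_tail)
    show "m + n \<in> S" if "m \<in> S" "n \<in> S" for m n
      using that kernel_power_add_pos unfolding S_def by blast
    show "0 \<in> S" by (simp add: S_def)
    have "S = insert 0 {n. 1 \<le> n \<and> 0 < kernel_power P n j j}" by (auto simp: S_def Suc_le_eq)
    then show "Gcd S = 1" using aper by (simp add: aperiodic_kernel_def)
  qed
  then obtain n0 where n0: "\<And>n. n \<ge> n0 \<Longrightarrow> 0 < kernel_power P n j j" unfolding S_def by blast
  have "\<forall>i. \<exists>n. 0 < kernel_power P n i j" using irr by (simp add: irreducible_kernel_def)
  from choice[OF this] obtain m where m: "\<And>i. 0 < kernel_power P (m i) i j" by auto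
  define n where "n = n0 + (\<Sum>i\<in>F. m i) + 1"
  have "0 < kernel_power P n i j" if "i \<in> F" for i
  proof -
    have "m i \<le> (\<Sum>i\<in>F. m i)" using F that by (intro member_le_sum) auto
    then have n: "n = m i + (n - m i)" "n - m i \<ge> n0" by (auto simp: n_def)
    show ?thesis using kernel_power_add_pos[OF m n0[OF n(2)], of i] n(1) by simp
  qed
  then show ?thesis by (intro exI[of _ n]) (auto simp: n_def)
qed

end

section \<open>Geometric contraction of weighted oscillations\<close>

lemma average_bound:
  fixes p :: "nat \<Rightarrow> real" and g :: "nat \<Rightarrow> complex"
  assumes p: "\<And>z. 0 \<le> p z" "p sums 1"
    and h: "\<And>z. cmod (g z - c) \<le> h z" "(\<lambda>z. p z * h z) sums H"
  shows "cmod ((\<Sum>z. of_real (p z) * g z) - c) \<le> H"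
proof -
  let ?d = "\<lambda>z. of_real (p z) * (g z - c)"
  have d: "cmod (?d z) \<le> p z * h z" for z
    using p h by (simp add: norm_mult mult_left_mono)
  have s: "summable ?d"
    by (rule summable_comparison_test'[of "\<lambda>z. p z * h z" 0]) (use h(2) d in \<open>auto simp: sums_iff\<close>)
  have "(\<lambda>z. of_real (p z) * c) sums (of_real 1 * c)" by (intro sums_mult2 sums_of_real p)
  then have "(\<lambda>z. ?d z + of_real (p z) * c) sums ((\<Sum>z. ?d z) + c)"
    using sums_add[OF summable_sums[OF s]] by simp
  then have "(\<Sum>z. of_real (p z) * g z) = (\<Sum>z. ?d z) + c"
    by (simp add: algebra_simps sums_iff)
  moreover have "cmod (\<Sum>z. ?d z) \<le> (\<Sum>z. p z * h z)"
    by (rule norm_suminf_le) (use h(2) d in \<open>auto simp: sums_iff\<close>)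
  ultimately show ?thesis using h(2) by (simp add: sums_iff)
qed

text \<open>Averaging \<open>g z - g w\<close> over independent \<open>z\<close> and \<open>w\<close> with laws \<open>p\<close> and \<open>q\<close> gives the
  difference of the two means. The point is the product \<open>u z * u w\<close>: it is carried along as the
  product of the two means of \<open>u\<close>.\<close>

lemma independent_coupling_bound:
  fixes p q W u :: "nat \<Rightarrow> real" and g :: "nat \<Rightarrow> complex"
  assumes p: "\<And>z. 0 \<le> p z" "p sums 1" and q: "\<And>z. 0 \<le> q z" "q sums 1"
    and W: "(\<lambda>z. p z * W z) sums pW" "(\<lambda>z. q z * W z) sums qW"
    and u: "(\<lambda>z. p z * u z) sums pu" "(\<lambda>z. q z * u z) sums qu"
    and g: "\<And>z w. cmod (g z - g w) \<le> A * (2 + W z + W w - 2 * u z * u w)"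
  shows "cmod ((\<Sum>z. of_real (p z) * g z) - (\<Sum>z. of_real (q z) * g z))
    \<le> A * (2 + pW + qW - 2 * pu * qu)"
proof -
  let ?G = "\<Sum>w. of_real (q w) * g w"
  have inner: "cmod (g z - ?G) \<le> A * (2 + W z + qW - 2 * u z * qu)" for z
  proof -
    have "(\<lambda>w. (2 + W z) * q w + q w * W w - 2 * u z * (q w * u w)) sums
        ((2 + W z) * 1 + qW - 2 * u z * qu)"
      by (intro sums_add sums_diff sums_mult W u q)
    from sums_mult[OF this, of A]
    have "(\<lambda>w. q w * (A * (2 + W w + W z - 2 * u w * u z))) sums (A * (2 + W z + qW - 2 * u z * qu))"
      by (simp add: algebra_simps)
    then have "cmod (?G - g z) \<le> A * (2 + W z + qW - 2 * u z * qu)"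
      by (intro average_bound[OF q g])
    then show ?thesis by (simp add: norm_minus_commute)
  qed
  have "(\<lambda>z. (2 + qW) * p z + p z * W z - 2 * qu * (p z * u z)) sums ((2 + qW) * 1 + pW - 2 * qu * pu)"
    by (intro sums_add sums_diff sums_mult W u p)
  from sums_mult[OF this, of A]
  have "(\<lambda>z. p z * (A * (2 + W z + qW - 2 * u z * qu))) sums (A * (2 + pW + qW - 2 * pu * qu))"
    by (simp add: algebra_simps)
  then show ?thesis by (rule average_bound[OF p inner])
qed

text \<open>This is the drift condition of the theory of geometric ergodicity with the additive constant
  written as \<open>(1 - \<gamma>) * B\<close>; then the \<open>n\<close>-step drift has constants \<open>\<gamma> ^ n\<close> and \<open>(1 - \<gamma> ^ n) * B\<close>.\<close>

locale drift_kernel =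
  fixes P :: "nat \<Rightarrow> nat \<Rightarrow> real" and V :: "nat \<Rightarrow> real" and \<gamma> B :: real
  assumes markov: "markov_kernel P"
    and V_nonneg: "0 \<le> V i"
    and V_summable: "summable (\<lambda>j. P i j * V j)"
    and \<gamma>: "0 < \<gamma>" "\<gamma> < 1" and B: "0 < B"
    and drift: "(\<Sum>j. P i j * V j) \<le> \<gamma> * V i + (1 - \<gamma>) * B"
begin

text \<open>Run two copies of the chain independently from \<open>x\<close> and \<open>y\<close>: they are both at the state \<open>j\<close>
  at time \<open>n\<close> with probability \<open>P\<^sup>n(x, j) * P\<^sup>n(y, j)\<close>, and on that event the difference of the
  values of \<open>f\<close> vanishes. The induction uses one-step couplings only.\<close>

lemma iterated_oscillation:
  assumes A: "0 \<le> A" and \<beta>: "0 \<le> \<beta>"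
    and f: "\<And>x y. cmod (f x - f y) \<le> A * (2 + \<beta> * V x + \<beta> * V y)"
  shows "cmod ((kernel_op P ^^ n) f x - (kernel_op P ^^ n) f y)
    \<le> A * (2 + \<beta> * (\<gamma> ^ n * V x + (1 - \<gamma> ^ n) * B) + \<beta> * (\<gamma> ^ n * V y + (1 - \<gamma> ^ n) * B)
           - 2 * kernel_power P n x j * kernel_power P n y j)"
proof (induction n arbitrary: x y)
  case 0
  show ?case
  proof (cases "x = j \<and> y = j")
    case True
    then show ?thesis using A \<beta> V_nonneg by simp
  next
    case False
    then show ?thesis using f[of x y] by auto
  qed
next
  case (Suc n)
  define W where "W = (\<lambda>x. \<beta> * (\<gamma> ^ n * V x + (1 - \<gamma> ^ n) * B))"
  define PV where "PV = (\<lambda>x. \<Sum>j. P x j * V j)"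
  define PW where "PW = (\<lambda>x. \<beta> * (\<gamma> ^ n * PV x + (1 - \<gamma> ^ n) * B))"
  have W: "(\<lambda>z. P x z * W z) sums PW x" for x
  proof -
    have "(\<lambda>z. \<beta> * (\<gamma> ^ n * (P x z * V z) + (1 - \<gamma> ^ n) * B * P x z)) sums
        (\<beta> * (\<gamma> ^ n * PV x + (1 - \<gamma> ^ n) * B * 1))"
      unfolding PV_def
      by (intro sums_add sums_mult summable_sums[OF V_summable] kernel_sums[OF markov])
    then show ?thesis unfolding W_def PW_def by (simp add: algebra_simps)
  qed
  have u: "(\<lambda>z. P x z * kernel_power P n z j) sums kernel_power P (Suc n) x j" for x
    using summable_sums[OF kernel_power_summable[OF markov]] by simp
  have "cmod ((\<Sum>z. of_real (P x z) * (kernel_op P ^^ n) f z) - (\<Sum>z. of_real (P y z) * (kernel_op P ^^ n) f z))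
     \<le> A * (2 + PW x + PW y - 2 * kernel_power P (Suc n) x j * kernel_power P (Suc n) y j)"
    by (rule independent_coupling_bound[OF kernel_nonneg[OF markov] kernel_sums[OF markov]
          kernel_nonneg[OF markov] kernel_sums[OF markov] W W u u])
      (use Suc in \<open>simp add: W_def\<close>)
  also have "\<dots> \<le> A * (2 + \<beta> * (\<gamma> ^ Suc n * V x + (1 - \<gamma> ^ Suc n) * B)
      + \<beta> * (\<gamma> ^ Suc n * V y + (1 - \<gamma> ^ Suc n) * B)
      - 2 * kernel_power P (Suc n) x j * kernel_power P (Suc n) y j)"
  proof -
    have "PW x \<le> \<beta> * (\<gamma> ^ Suc n * V x + (1 - \<gamma> ^ Suc n) * B)" for x
    proof -
      have "\<gamma> ^ n * PV x \<le> \<gamma> ^ n * (\<gamma> * V x + (1 - \<gamma>) * B)"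
        unfolding PV_def using drift \<gamma> by (intro mult_left_mono) auto
      then have "\<gamma> ^ n * PV x + (1 - \<gamma> ^ n) * B \<le> \<gamma> ^ Suc n * V x + (1 - \<gamma> ^ Suc n) * B"
        by (simp add: algebra_simps)
      then show ?thesis unfolding PW_def using \<beta> by (intro mult_left_mono)
    qed
    then show ?thesis using A by (intro mult_left_mono) (auto intro: add_mono)
  qed
  finally show ?case by (simp add: kernel_op_def[of P "(kernel_op P ^^ n) f"])
qed

text \<open>The contraction is a version of Harris' theorem. Let \<open>S = V x + V y\<close>. If \<open>S\<close> is
  large, then the drift makes the weight \<open>2 + \<beta> * S\<close> shrink by a fixed factor; if \<open>S\<close> is small, then
  each of the two copies is at \<open>j\<close> at time \<open>n0\<close> with probability at least \<open>\<delta>\<close>, and the constant \<open>2\<close>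
  shrinks.
  The choice \<open>2 * \<beta> * B = \<delta>\<^sup>2\<close> keeps the drift constant below the gain \<open>2 * \<delta>\<^sup>2\<close>.\<close>

theorem oscillation_contraction:
  assumes n0: "n0 \<ge> 1" and \<delta>: "0 < \<delta>"
    and minor: "\<forall>x. V x \<le> 4 * B / (1 - \<gamma>) \<longrightarrow> \<delta> \<le> kernel_power P n0 x j"
  shows "\<exists>\<beta>>0. \<exists>\<rho>>0. \<rho> < 1 \<and> (\<exists>C>0. \<forall>f A.
    0 \<le> A \<longrightarrow> (\<forall>x y. cmod (f x - f y) \<le> A * (2 + \<beta> * V x + \<beta> * V y)) \<longrightarrow>
    (\<forall>n x y. cmod ((kernel_op P ^^ n) f x - (kernel_op P ^^ n) f y)
       \<le> C * \<rho> ^ n * A * (2 + \<beta> * V x + \<beta> * V y)))"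
proof -
  define d where "d = min \<delta> 1"
  have d: "0 < d" "d \<le> 1" "d \<le> \<delta>" using \<delta> by (auto simp: d_def)
  have d2: "0 < d\<^sup>2" "d\<^sup>2 \<le> 1" using d by (auto simp: power_le_one)
  define \<beta> where "\<beta> = d\<^sup>2 / (2 * B)"
  have \<beta>: "0 < \<beta>" "2 * \<beta> * B = d\<^sup>2" using d2 B by (auto simp: \<beta>_def)
  define t0 where "t0 = 2 * d\<^sup>2 / (1 - \<gamma>)"
  define \<gamma>' where "\<gamma>' = (1 + \<gamma>) / 2"
  have t0: "0 < t0" using d2 \<gamma> by (simp add: t0_def)
  have \<gamma>': "0 < \<gamma>'" "\<gamma>' < 1" "\<gamma> < \<gamma>'" using \<gamma> by (auto simp: \<gamma>'_def)
  define c0 where "c0 = (2 + \<gamma>' * t0) / (2 + t0)"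
  have c0: "\<gamma>' \<le> c0" "c0 < 1" "(c0 - \<gamma>') * t0 = 2 * (1 - c0)"
  proof -
    show "\<gamma>' \<le> c0" unfolding c0_def using t0 \<gamma>' by (simp add: pos_le_divide_eq algebra_simps)
    show "c0 < 1" unfolding c0_def using t0 \<gamma>' by (simp add: pos_divide_less_eq)
    have "c0 * (2 + t0) = 2 + \<gamma>' * t0" unfolding c0_def using t0 by simp
    then show "(c0 - \<gamma>') * t0 = 2 * (1 - c0)" by (simp add: algebra_simps)
  qed
  define c where "c = max (1 - d\<^sup>2 / 2) c0"
  have c: "0 < c" "c < 1" "\<gamma>' \<le> c" "c0 \<le> c" "1 - d\<^sup>2 / 2 \<le> c"
    using c0 \<gamma>' d2 by (auto simp: c_def)
  have step: "cmod ((kernel_op P ^^ n0) f x - (kernel_op P ^^ n0) f y) \<le> c * A * (2 + \<beta> * V x + \<beta> * V y)"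
    if A: "0 \<le> A" and f: "\<And>x y. cmod (f x - f y) \<le> A * (2 + \<beta> * V x + \<beta> * V y)" for f A x y
  proof -
    define S where "S = V x + V y"
    define pp where "pp = kernel_power P n0 x j * kernel_power P n0 y j"
    have S: "0 \<le> S" "V x \<le> S" "V y \<le> S" using V_nonneg[of x] V_nonneg[of y] by (auto simp: S_def)
    have pp: "0 \<le> pp" unfolding pp_def using kernel_power_bounds[OF markov] by simp
    have g: "0 \<le> \<gamma> ^ n0" "\<gamma> ^ n0 \<le> \<gamma>"
      using \<gamma> n0 power_decreasing[of 1 n0 \<gamma>] by auto
    have "2 + \<beta> * (\<gamma> ^ n0 * V x + (1 - \<gamma> ^ n0) * B) + \<beta> * (\<gamma> ^ n0 * V y + (1 - \<gamma> ^ n0) * B)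
        - 2 * kernel_power P n0 x j * kernel_power P n0 y j
        = 2 + \<gamma> ^ n0 * (\<beta> * S) + (1 - \<gamma> ^ n0) * d\<^sup>2 - 2 * pp"
      unfolding S_def pp_def \<beta>(2)[symmetric] by (simp add: algebra_simps)
    also have "\<dots> \<le> 2 + \<gamma> * (\<beta> * S) + 1 * d\<^sup>2 - 2 * pp"
      using g S \<beta> d2 by (intro diff_right_mono add_mono mult_right_mono) auto
    also have "\<dots> \<le> c * (2 + \<beta> * S)"
    proof (cases "S \<le> 4 * B / (1 - \<gamma>)")
      case True
      then have "d \<le> kernel_power P n0 x j" "d \<le> kernel_power P n0 y j"
        using minor[rule_format, of x] minor[rule_format, of y] S d by auto
      then have "d\<^sup>2 \<le> pp" unfolding pp_def power2_eq_square using d by (intro mult_mono) auto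
      moreover have "\<gamma> * (\<beta> * S) \<le> c * (\<beta> * S)" using c \<gamma>' S \<beta> by (intro mult_right_mono) auto
      ultimately show ?thesis using c(5) by (simp add: algebra_simps)
    next
      case False
      then have t: "t0 \<le> \<beta> * S"
      proof -
        have "t0 = \<beta> * (4 * B / (1 - \<gamma>))" unfolding t0_def \<beta>(2)[symmetric] by simp
        also have "\<dots> \<le> \<beta> * S" using False \<beta> by (intro mult_left_mono) auto
        finally show ?thesis .
      qed
      have "(1 - \<gamma>) / 2 * t0 = d\<^sup>2" using \<gamma> by (simp add: t0_def)
      then have "d\<^sup>2 \<le> (1 - \<gamma>) / 2 * (\<beta> * S)" using mult_left_mono[OF t, of "(1 - \<gamma>) / 2"] \<gamma> by simp
      then have "2 + \<gamma> * (\<beta> * S) + 1 * d\<^sup>2 - 2 * pp \<le> 2 + \<gamma>' * (\<beta> * S)"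
        using pp unfolding \<gamma>'_def by (simp add: field_simps)
      also have "\<dots> \<le> c0 * (2 + \<beta> * S)"
        using mult_left_mono[OF t, of "c0 - \<gamma>'"] c0 by (simp add: algebra_simps)
      also have "\<dots> \<le> c * (2 + \<beta> * S)" using c S \<beta> by (intro mult_right_mono) auto
      finally show ?thesis .
    qed
    finally have "cmod ((kernel_op P ^^ n0) f x - (kernel_op P ^^ n0) f y) \<le> A * (c * (2 + \<beta> * S))"
      using iterated_oscillation[OF A _ f, where n=n0 and x=x and y=y and j=j] \<beta>(1) A
      by (meson less_imp_le mult_left_mono order_trans)
    then show ?thesis unfolding S_def by (simp add: algebra_simps)
  qed
  have steps: "cmod ((kernel_op P ^^ (k * n0)) f x - (kernel_op P ^^ (k * n0)) f y)
      \<le> c ^ k * A * (2 + \<beta> * V x + \<beta> * V y)"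
    if A: "0 \<le> A" and f: "\<And>x y. cmod (f x - f y) \<le> A * (2 + \<beta> * V x + \<beta> * V y)" for f A x y k
  proof (induction k arbitrary: x y)
    case 0
    then show ?case using f by simp
  next
    case (Suc k)
    have "cmod ((kernel_op P ^^ n0) ((kernel_op P ^^ (k * n0)) f) x - (kernel_op P ^^ n0) ((kernel_op P ^^ (k * n0)) f) y)
      \<le> c * (c ^ k * A) * (2 + \<beta> * V x + \<beta> * V y)"
      by (rule step) (use Suc A c in auto)
    then show ?case by (simp add: funpow_add mult.assoc)
  qed
  define \<rho> where "\<rho> = root n0 c"
  have \<rho>: "0 < \<rho>" "\<rho> < 1" "\<rho> ^ n0 = c"
    using c n0 by (auto simp: \<rho>_def real_root_pow_pos2)
  show ?thesis
  proof (rule exI[of _ \<beta>], rule conjI[rotated], rule exI[of _ \<rho>], rule conjI[rotated],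
      rule conjI[rotated], rule exI[of _ "2 / c"], intro conjI allI impI)
    fix f :: "nat \<Rightarrow> complex" and A n x y
    assume A: "0 \<le> A" and "\<forall>x y. cmod (f x - f y) \<le> A * (2 + \<beta> * V x + \<beta> * V y)"
    then have f: "cmod (f x - f y) \<le> A * (2 + \<beta> * V x + \<beta> * V y)" for x y by blast
    define k s where "k = n div n0" and "s = n mod n0"
    have n: "n = s + k * n0" and s: "s \<le> n0" using n0 by (auto simp: k_def s_def less_imp_le)
    have S: "0 \<le> \<beta> * V x" "0 \<le> \<beta> * V y" using \<beta> V_nonneg by auto
    have g: "0 \<le> \<gamma> ^ s" "\<gamma> ^ s \<le> 1" using \<gamma> by (auto simp: power_le_one)
    have "0 \<le> c ^ k * A" using A c by simp
    from iterated_oscillation[OF this less_imp_le[OF \<beta>(1)] steps[OF A f], where n=s and x=x and y=y and j=j]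
    have "cmod ((kernel_op P ^^ n) f x - (kernel_op P ^^ n) f y) \<le> c ^ k * A *
       (2 + \<beta> * (\<gamma> ^ s * V x + (1 - \<gamma> ^ s) * B) + \<beta> * (\<gamma> ^ s * V y + (1 - \<gamma> ^ s) * B)
           - 2 * kernel_power P s x j * kernel_power P s y j)"
      by (simp add: n funpow_add)
    also have "\<dots> \<le> c ^ k * A * (2 * (2 + \<beta> * V x + \<beta> * V y))"
    proof (rule mult_left_mono)
      have "\<gamma> ^ s * (\<beta> * V x) \<le> \<beta> * V x" "\<gamma> ^ s * (\<beta> * V y) \<le> \<beta> * V y"
        using g S by (auto simp: mult_left_le_one_le)
      moreover have "(1 - \<gamma> ^ s) * d\<^sup>2 \<le> 1" using g d2 by (intro mult_le_one) auto
      moreover have "0 \<le> kernel_power P s x j * kernel_power P s y j"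
        using kernel_power_bounds[OF markov] by simp
      moreover have "\<beta> * (\<gamma> ^ s * V x + (1 - \<gamma> ^ s) * B) + \<beta> * (\<gamma> ^ s * V y + (1 - \<gamma> ^ s) * B)
          = \<gamma> ^ s * (\<beta> * V x) + \<gamma> ^ s * (\<beta> * V y) + (1 - \<gamma> ^ s) * d\<^sup>2"
        unfolding \<beta>(2)[symmetric] by (simp add: algebra_simps)
      ultimately show "2 + \<beta> * (\<gamma> ^ s * V x + (1 - \<gamma> ^ s) * B) + \<beta> * (\<gamma> ^ s * V y + (1 - \<gamma> ^ s) * B)
           - 2 * kernel_power P s x j * kernel_power P s y j \<le> 2 * (2 + \<beta> * V x + \<beta> * V y)"
        using S by (simp add: mult.assoc)
    qed (use A c in simp)
    also have "\<dots> \<le> (\<rho> ^ n / c) * A * (2 * (2 + \<beta> * V x + \<beta> * V y))"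
    proof -
      have "c \<le> \<rho> ^ s" using power_decreasing[OF s, of \<rho>] \<rho> by simp
      then have "c * c ^ k \<le> \<rho> ^ s * c ^ k" using c by (intro mult_right_mono) auto
      also have "\<dots> = \<rho> ^ n" using n \<rho>(3) by (metis power_add power_mult mult.commute)
      finally have "c ^ k \<le> \<rho> ^ n / c" using c by (simp add: pos_le_divide_eq mult.commute)
      then show ?thesis using A S by (intro mult_right_mono) auto
    qed
    finally show "cmod ((kernel_op P ^^ n) f x - (kernel_op P ^^ n) f y)
        \<le> 2 / c * \<rho> ^ n * A * (2 + \<beta> * V x + \<beta> * V y)"
      by (simp only: mult_ac times_divide_eq_left times_divide_eq_right)
  qed (use \<beta> \<rho> c in auto)
qed

end

section \<open>A kernel acting on the two spaces of its invariant law\<close>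

lemma suminf_swap:
  fixes F :: "nat \<Rightarrow> nat \<Rightarrow> 'a :: banach"
  assumes inner: "\<And>j. (\<lambda>i. norm (F i j)) sums g j" and outer: "summable g"
  shows "(\<Sum>i. \<Sum>j. F i j) = (\<Sum>j. \<Sum>i. F i j)"
proof -
  have le_g: "norm (F i j) \<le> g j" for i j
    using sum_le_suminf[of "\<lambda>i. norm (F i j)" "{i}"] inner[of j] by (simp add: sums_iff)
  have g: "0 \<le> g j" for j using order_trans[OF norm_ge_zero le_g] .
  have "(\<lambda>p. norm (F (snd p) (fst p))) summable_on (UNIV \<times> UNIV)"
  proof (rule summable_on_SigmaI)
    show "((\<lambda>i. norm (F (snd (j, i)) (fst (j, i)))) has_sum g j) UNIV" for j
      using sums_nonneg_imp_has_sum[OF inner[of j]] by simp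
    show "g summable_on UNIV" by (rule summable_nonneg_imp_summable_on[OF outer g])
  qed auto
  then have "(\<lambda>p. F (snd p) (fst p)) summable_on (UNIV \<times> UNIV)"
    by (rule abs_summable_summable)
  then have S: "(\<lambda>(j, i). F i j) summable_on (UNIV \<times> UNIV)"
    by (simp add: case_prod_unfold)
  then have S': "(\<lambda>(i, j). F i j) summable_on (UNIV \<times> UNIV)"
    using summable_on_swap[of "\<lambda>(j, i). F i j" UNIV UNIV] by (simp add: case_prod_unfold)
  have to_suminf: "infsum f UNIV = suminf f" if "f summable_on UNIV" for f :: "nat \<Rightarrow> 'a"
    using has_sum_imp_sums[OF has_sum_infsum[OF that]] by (simp add: sums_iff)
  have "infsum (\<lambda>i. infsum (\<lambda>j. F i j) UNIV) UNIV = infsum (\<lambda>j. infsum (\<lambda>i. F i j) UNIV) UNIV"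
    by (rule infsum_swap_banach[OF S'])
  moreover have "infsum (\<lambda>j. F i j) UNIV = (\<Sum>j. F i j)" for i
    by (intro to_suminf norm_summable_imp_summable_on summable_comparison_test'[OF outer, of 0])
      (simp add: le_g)
  moreover have "infsum (\<lambda>i. F i j) UNIV = (\<Sum>i. F i j)" for j
    using inner[of j] by (intro to_suminf norm_summable_imp_summable_on) (simp add: sums_iff)
  moreover have "(\<lambda>i. infsum (\<lambda>j. F i j) UNIV) summable_on UNIV"
    using summable_on_Sigma_banach[OF S'] by simp
  moreover have "(\<lambda>j. infsum (\<lambda>i. F i j) UNIV) summable_on UNIV"
    using summable_on_Sigma_banach[OF S] by simp
  ultimately show ?thesis by (simp add: to_suminf)
qed

text \<open>The summability of \<open>sqrt \<pi> = \<pi> * V\<close> says that \<open>V\<close> is \<open>\<pi>\<close>-integrable, so that the mean is a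
  bounded functional on \<open>\<B>\<^sub>V\<close>, and with it on the smaller space \<open>\<ell>\<^sup>2(\<pi>)\<close>.\<close>

locale invariant_kernel =
  fixes P :: "nat \<Rightarrow> nat \<Rightarrow> real" and \<pi> :: "nat \<Rightarrow> real"
  assumes markov: "markov_kernel P"
    and \<pi>_pos: "0 < \<pi> i"
    and \<pi>_sums: "\<pi> sums 1"
    and invariant: "(\<lambda>i. \<pi> i * P i j) sums \<pi> j"
    and sqrt_summable: "summable (\<lambda>i. sqrt (\<pi> i))"
begin

abbreviation "V \<equiv> (\<lambda>n. 1 / sqrt (\<pi> n))"
abbreviation "T \<equiv> kernel_op P"
abbreviation "BV \<equiv> BV_space V"
abbreviation "nV \<equiv> BV_norm V"
abbreviation "L2 \<equiv> l2_space \<pi>"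
abbreviation "n2 \<equiv> l2_norm \<pi>"

definition PV :: "nat \<Rightarrow> real" where
  "PV i = (\<Sum>j. P i j * V j)"

definition root_mass :: real where
  "root_mass = (\<Sum>i. sqrt (\<pi> i))"

lemma P_nonneg: "0 \<le> P i j"
  using kernel_nonneg[OF markov] .

lemma \<pi>_neq_0: "\<pi> i \<noteq> 0"
  using \<pi>_pos[of i] by simp

lemma V_pos: "0 < V n"
  using \<pi>_pos by simp

lemma \<pi>_le_1: "\<pi> n \<le> 1"
  using sum_le_suminf[of \<pi> "{n}"] \<pi>_sums \<pi>_pos by (auto simp: sums_iff less_imp_le)

lemma V_ge_1: "1 \<le> V n"
  using \<pi>_le_1[of n] \<pi>_pos[of n] by simp

lemma \<pi>_V: "\<pi> n * V n = sqrt (\<pi> n)"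
  using \<pi>_pos[of n] by (simp add: real_div_sqrt less_imp_le)

lemma P_le: "P i j \<le> \<pi> j / \<pi> i"
proof -
  have "\<pi> i * P i j \<le> (\<Sum>i. \<pi> i * P i j)"
    using sum_le_suminf[of "\<lambda>i. \<pi> i * P i j" "{i}"] invariant[of j] P_nonneg \<pi>_pos
    by (auto simp: sums_iff less_imp_le)
  then show ?thesis
    using invariant[of j] \<pi>_pos[of i] by (simp add: sums_iff pos_le_divide_eq mult.commute)
qed

text \<open>Even rows that are not banded integrate \<open>V\<close>: by invariance, \<open>P i j\<close> decays like \<open>\<pi> j\<close>.\<close>

lemma PV_summable: "summable (\<lambda>j. P i j * V j)"
proof (rule summable_comparison_test')
  show "summable (\<lambda>j. sqrt (\<pi> j) / \<pi> i)" using sqrt_summable by (rule summable_divide)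
  fix j
  have "P i j * V j \<le> \<pi> j / \<pi> i * V j"
    using P_le less_imp_le[OF V_pos, of j] by (intro mult_right_mono)
  also have "\<dots> = sqrt (\<pi> j) / \<pi> i" using \<pi>_V[of j] by (simp add: field_simps)
  finally show "norm (P i j * V j) \<le> sqrt (\<pi> j) / \<pi> i" using P_nonneg \<pi>_pos by (simp add: less_imp_le)
qed

lemma PV_nonneg: "0 \<le> PV i"
  unfolding PV_def using PV_summable P_nonneg V_pos by (intro suminf_nonneg) (auto simp: less_imp_le)

sublocale BV: seq_space BV nV
  by (rule seq_space_BV[OF V_pos])

sublocale L2: seq_space L2 n2
  by (rule seq_space_l2[OF \<pi>_pos])

lemma l2_in_BV: "f \<in> L2 \<Longrightarrow> f \<in> BV \<and> nV f \<le> n2 f"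
  using l2_coord[of \<pi> f, OF \<pi>_pos] \<pi>_pos
  by (subst BV_ball_iff[of V, OF V_pos]) (simp add: pos_le_divide_eq)

lemma root_mass_nonneg: "0 \<le> root_mass"
  unfolding root_mass_def using sqrt_summable \<pi>_pos by (intro suminf_nonneg) (auto simp: less_imp_le)

lemma const_l2: "(\<lambda>_. c) \<in> L2 \<and> n2 (\<lambda>_. c) \<le> cmod c"
proof -
  have s: "(\<lambda>i. (cmod c)\<^sup>2 * \<pi> i) sums ((cmod c)\<^sup>2 * 1)" by (intro sums_mult \<pi>_sums)
  then show ?thesis by (simp add: l2_space_def l2_norm_def sums_iff)
qed

lemma T_terms_bound:
  assumes f: "f \<in> BV"
  shows "cmod (of_real (P i j) * f j) \<le> nV f * (P i j * V j)"
  using mult_left_mono[OF BV_bound[of V, OF V_pos f, of j] P_nonneg, of i j] P_nonneg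
  by (simp add: norm_mult mult.left_commute mult.commute)

lemma T_summable:
  assumes f: "f \<in> BV"
  shows "summable (\<lambda>j. cmod (of_real (P i j) * f j))"
  by (rule summable_comparison_test'[OF summable_mult[OF PV_summable, of "nV f"], of 0])
    (use T_terms_bound[OF f] in simp)

lemma T_bound:
  assumes f: "f \<in> BV"
  shows "cmod (T f i) \<le> nV f * PV i"
proof -
  have "cmod (T f i) \<le> (\<Sum>j. nV f * (P i j * V j))"
    unfolding kernel_op_def
    by (rule norm_suminf_le[OF T_terms_bound[OF f] summable_mult[OF PV_summable]])
  then show ?thesis unfolding PV_def suminf_mult[OF PV_summable] .
qed

lemma T_linear:
  assumes f: "f \<in> BV" and g: "g \<in> BV"
  shows "T (\<lambda>i. a * f i + b * g i) = (\<lambda>i. a * T f i + b * T g i)"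
proof
  fix i
  have "(\<lambda>j. a * (of_real (P i j) * f j) + b * (of_real (P i j) * g j)) sums (a * T f i + b * T g i)"
    unfolding kernel_op_def
    by (intro sums_add sums_mult summable_sums summable_norm_cancel[OF T_summable] f g)
  then show "T (\<lambda>i. a * f i + b * g i) i = a * T f i + b * T g i"
    unfolding kernel_op_def by (simp add: sums_iff algebra_simps)
qed

lemma T_add: "f \<in> BV \<Longrightarrow> g \<in> BV \<Longrightarrow> T (\<lambda>i. f i + g i) = (\<lambda>i. T f i + T g i)"
  using T_linear[of f g 1 1] by simp

lemma T_diff: "f \<in> BV \<Longrightarrow> g \<in> BV \<Longrightarrow> T (\<lambda>i. f i - g i) = (\<lambda>i. T f i - T g i)"
  using T_linear[of f g 1 "-1"] by simp

lemma T_const: "T (\<lambda>_. c) = (\<lambda>_. c)"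
proof
  fix i
  have "(\<lambda>j. of_real (P i j) * c) sums (of_real 1 * c)"
    by (intro sums_mult2 sums_of_real kernel_sums[OF markov])
  then show "T (\<lambda>_. c) i = c" by (simp add: kernel_op_def sums_iff)
qed

lemma mean_terms_bound:
  assumes f: "f \<in> BV"
  shows "cmod (f i * of_real (\<pi> i)) \<le> nV f * sqrt (\<pi> i)"
proof -
  have "cmod (f i * of_real (\<pi> i)) = \<pi> i * cmod (f i)" using \<pi>_pos[of i] by (simp add: norm_mult)
  also have "\<dots> \<le> \<pi> i * (nV f * V i)"
    using BV_bound[of V, OF V_pos f, of i] \<pi>_pos[of i] by (intro mult_left_mono) auto
  also have "\<dots> = nV f * (\<pi> i * V i)" by (simp only: mult.left_commute)
  also have "\<dots> = nV f * sqrt (\<pi> i)" unfolding \<pi>_V ..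
  finally show ?thesis .
qed

lemma mean_summable: "f \<in> BV \<Longrightarrow> summable (\<lambda>i. f i * of_real (\<pi> i))"
  by (rule summable_comparison_test'[of "\<lambda>i. nV f * sqrt (\<pi> i)" 0])
    (use mean_terms_bound sqrt_summable in \<open>auto intro!: summable_mult\<close>)

lemma mean_bound:
  assumes f: "f \<in> BV"
  shows "cmod (mean_op \<pi> f i) \<le> nV f * root_mass"
  unfolding mean_op_def root_mass_def suminf_mult[OF sqrt_summable, symmetric]
  by (rule norm_suminf_le[OF mean_terms_bound[OF f] summable_mult[OF sqrt_summable]])

lemma mean_linear:
  assumes f: "f \<in> BV" and g: "g \<in> BV"
  shows "mean_op \<pi> (\<lambda>i. a * f i + b * g i) = (\<lambda>i. a * mean_op \<pi> f i + b * mean_op \<pi> g i)"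
proof -
  have "(\<lambda>j. a * (f j * of_real (\<pi> j)) + b * (g j * of_real (\<pi> j))) sums
      (a * (\<Sum>i. f i * of_real (\<pi> i)) + b * (\<Sum>i. g i * of_real (\<pi> i)))"
    by (intro sums_add sums_mult summable_sums mean_summable f g)
  then show ?thesis unfolding mean_op_def by (simp add: sums_iff algebra_simps)
qed

lemma mean_add: "f \<in> BV \<Longrightarrow> g \<in> BV \<Longrightarrow> mean_op \<pi> (\<lambda>i. f i + g i) = (\<lambda>i. mean_op \<pi> f i + mean_op \<pi> g i)"
  using mean_linear[of f g 1 1] by simp

lemma mean_in_l2: "f \<in> BV \<Longrightarrow> mean_op \<pi> f \<in> L2 \<and> n2 (mean_op \<pi> f) \<le> nV f * root_mass"
  using const_l2[of "\<Sum>i. f i * of_real (\<pi> i)"] mean_bound[of f 0] unfolding mean_op_def by auto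

lemma T_mean: "T (mean_op \<pi> f) = mean_op \<pi> f"
  unfolding mean_op_def by (rule T_const)

text \<open>This is the invariance of \<open>\<pi>\<close>, extended from finitely supported functions to \<open>\<B>\<^sub>V\<close> by
  Fubini's theorem.\<close>

lemma mean_T:
  assumes f: "f \<in> BV"
  shows "mean_op \<pi> (T f) = mean_op \<pi> f"
proof -
  have "(\<Sum>i. T f i * of_real (\<pi> i)) = (\<Sum>i. \<Sum>j. of_real (\<pi> i * P i j) * f j)"
  proof (rule suminf_cong)
    fix i
    have "T f i * of_real (\<pi> i) = (\<Sum>j. of_real (P i j) * f j * of_real (\<pi> i))"
      unfolding kernel_op_def by (rule suminf_mult2[OF summable_norm_cancel[OF T_summable[OF f]]])
    then show "T f i * of_real (\<pi> i) = (\<Sum>j. of_real (\<pi> i * P i j) * f j)"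
      by (simp add: mult_ac)
  qed
  also have "\<dots> = (\<Sum>j. \<Sum>i. of_real (\<pi> i * P i j) * f j)"
  proof (rule suminf_swap)
    fix j
    show "(\<lambda>i. cmod (of_real (\<pi> i * P i j) * f j)) sums cmod (f j * of_real (\<pi> j))"
      using sums_mult2[OF invariant[of j], of "cmod (f j)"] P_nonneg \<pi>_pos
      by (simp add: norm_mult abs_mult mult.commute less_imp_le)
  next
    show "summable (\<lambda>j. cmod (f j * of_real (\<pi> j)))"
      by (rule summable_comparison_test'[of "\<lambda>i. nV f * sqrt (\<pi> i)" 0])
        (use mean_terms_bound[OF f] sqrt_summable in \<open>auto intro!: summable_mult\<close>)
  qed
  also have "\<dots> = (\<Sum>j. f j * of_real (\<pi> j))"
  proof (rule suminf_cong)
    fix j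
    have "(\<lambda>i. of_real (\<pi> i * P i j) * f j) sums (of_real (\<pi> j) * f j)"
      by (intro sums_mult2 sums_of_real invariant)
    then show "(\<Sum>i. of_real (\<pi> i * P i j) * f j) = f j * of_real (\<pi> j)"
      by (simp add: sums_iff mult.commute)
  qed
  finally show ?thesis by (simp add: mean_op_def)
qed

lemma spectral_gap_at_mono:
  assumes "spectral_gap_at X nrm P \<pi> \<rho>" "0 \<le> \<rho>" "\<rho> \<le> \<rho>'" and nonneg: "\<And>f. f \<in> X \<Longrightarrow> 0 \<le> nrm f"
  shows "spectral_gap_at X nrm P \<pi> \<rho>'"
proof -
  obtain C where C: "C > 0" "\<forall>n\<ge>1. \<forall>f\<in>X. (\<lambda>i. (T ^^ n) f i - mean_op \<pi> f i) \<in> X \<and>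
      nrm (\<lambda>i. (T ^^ n) f i - mean_op \<pi> f i) \<le> C * \<rho> ^ n * nrm f"
    using assms(1) unfolding spectral_gap_at_def by blast
  have "C * \<rho> ^ n * nrm f \<le> C * \<rho>' ^ n * nrm f" if "f \<in> X" for n f
    using nonneg[OF that] C(1) assms by (intro mult_right_mono mult_left_mono power_mono) auto
  then show ?thesis
    unfolding spectral_gap_at_def using C by (meson order_trans)
qed

end

section \<open>Splitting the kernel into finitely many rows and a contracting tail\<close>

text \<open>The finite-rank operator formed by the rows below \<open>M\<close> maps the large space \<open>\<B>\<^sub>V\<close> into the small
  space \<open>\<ell>\<^sup>2(\<pi>)\<close>; the remaining rows contract both norms by the same factor. Only this is used to
  compare the two spaces.\<close>

locale contracting_tail = invariant_kernel +
  fixes M :: nat and r :: real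
  assumes r: "0 \<le> r" "r < 1"
    and tail_PV: "i \<ge> M \<Longrightarrow> PV i \<le> r * V i"
    and tail_l2: "f \<in> L2 \<Longrightarrow> (\<lambda>i. if i < M then 0 else T f i) \<in> L2 \<and>
                    n2 (\<lambda>i. if i < M then 0 else T f i) \<le> r * n2 f"
begin

definition tail :: seq_op where "tail f = (\<lambda>i. if i < M then 0 else T f i)"
definition head :: seq_op where "head f = (\<lambda>i. if i < M then T f i else 0)"

abbreviation unit_seq :: "nat \<Rightarrow> nat \<Rightarrow> complex" where
  "unit_seq j \<equiv> (\<lambda>i. if i = j then 1 else 0)"

lemma split: "T f = (\<lambda>i. tail f i + head f i)"
  by (auto simp: tail_def head_def)

lemma head_eq_sum: "head f = (\<lambda>i. \<Sum>j<M. T f j * unit_seq j i)"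
proof
  fix i
  have "(\<Sum>j<M. T f j * unit_seq j i) = (\<Sum>j<M. if j = i then T f i else 0)"
    by (intro sum.cong) auto
  then show "head f i = (\<Sum>j<M. T f j * unit_seq j i)" by (simp add: head_def)
qed

definition head_const :: real where
  "head_const = (\<Sum>j<M. PV j * n2 (unit_seq j))"

lemma head_const_nonneg: "0 \<le> head_const"
  unfolding head_const_def using PV_nonneg L2.nrm_nonneg[OF L2.unit_mem] by (intro sum_nonneg) auto

lemma head_bound:
  assumes f: "f \<in> BV"
  shows "head f \<in> L2 \<and> n2 (head f) \<le> head_const * nV f"
proof -
  have sum: "head f \<in> L2 \<and> n2 (head f) \<le> (\<Sum>j<M. n2 (\<lambda>i. T f j * unit_seq j i))"
    unfolding head_eq_sum by (rule L2.sum_mem) (auto intro: L2.scale_mem L2.unit_mem)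
  have le: "(\<Sum>j<M. n2 (\<lambda>i. T f j * unit_seq j i)) \<le> (\<Sum>j<M. PV j * n2 (unit_seq j) * nV f)"
  proof (rule sum_mono)
    fix j
    have "n2 (\<lambda>i. T f j * unit_seq j i) = cmod (T f j) * n2 (unit_seq j)"
      by (rule L2.nrm_scale[OF L2.unit_mem])
    also have "\<dots> \<le> nV f * PV j * n2 (unit_seq j)"
      by (intro mult_right_mono T_bound f L2.nrm_nonneg L2.unit_mem)
    finally show "n2 (\<lambda>i. T f j * unit_seq j i) \<le> PV j * n2 (unit_seq j) * nV f"
      by (simp only: mult_ac)
  qed
  show ?thesis
    using conjunct1[OF sum] order_trans[OF conjunct2[OF sum] le]
    by (simp add: head_const_def sum_distrib_right)
qed

lemma head_BV:
  assumes f: "f \<in> BV"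
  shows "head f \<in> BV \<and> nV (head f) \<le> head_const * nV f"
  using head_bound[OF f] l2_in_BV[of "head f"] by auto

lemma tail_BV:
  assumes f: "f \<in> BV"
  shows "tail f \<in> BV \<and> nV (tail f) \<le> r * nV f"
proof (subst BV_ball_iff[of V, OF V_pos], rule allI)
  fix n
  have nonneg: "0 \<le> nV f" using BV.nrm_nonneg f .
  show "cmod (tail f n) \<le> r * nV f * V n"
  proof (cases "n < M")
    case True
    then show ?thesis using r nonneg \<pi>_pos[of n] by (simp add: tail_def)
  next
    case False
    then have "cmod (tail f n) \<le> nV f * PV n" using T_bound[OF f] by (simp add: tail_def)
    also have "\<dots> \<le> nV f * (r * V n)" using tail_PV[of n] False nonneg by (intro mult_left_mono) auto
    finally show ?thesis by (simp add: mult_ac)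
  qed
qed

lemma T_BV:
  assumes f: "f \<in> BV"
  shows "T f \<in> BV \<and> nV (T f) \<le> (r + head_const) * nV f"
proof -
  have t: "tail f \<in> BV" "nV (tail f) \<le> r * nV f" and h: "head f \<in> BV" "nV (head f) \<le> head_const * nV f"
    using tail_BV[OF f] head_BV[OF f] by auto
  show ?thesis unfolding split[of f]
    using BV.add_mem[OF t(1) h(1)] BV.nrm_add[OF t(1) h(1)] t(2) h(2) by (simp add: algebra_simps)
qed

lemma T_l2:
  assumes f: "f \<in> L2"
  shows "T f \<in> L2 \<and> n2 (T f) \<le> r * n2 f + head_const * nV f"
proof -
  have t: "tail f \<in> L2" "n2 (tail f) \<le> r * n2 f" using tail_l2[OF f] by (auto simp: tail_def)
  have h: "head f \<in> L2" "n2 (head f) \<le> head_const * nV f" using head_bound l2_in_BV[OF f] by auto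
  show ?thesis unfolding split[of f]
    using L2.add_mem[OF t(1) h(1)] L2.nrm_add[OF t(1) h(1)] t(2) h(2) by simp
qed

lemma bounded_BV: "bounded_op_on BV nV T"
  unfolding bounded_op_on_def linear_op_on_def
  using T_BV T_linear by (auto intro!: exI[of _ "r + head_const"])

lemma bounded_l2: "bounded_op_on L2 n2 T"
proof -
  have "n2 (T f) \<le> (r + head_const) * n2 f" if f: "f \<in> L2" for f
  proof -
    have "head_const * nV f \<le> head_const * n2 f"
      using l2_in_BV[OF f] head_const_nonneg by (intro mult_left_mono) auto
    then show ?thesis using T_l2[OF f] by (simp add: algebra_simps)
  qed
  then show ?thesis
    unfolding bounded_op_on_def linear_op_on_def
    using T_l2 T_linear l2_in_BV by (auto intro!: exI[of _ "r + head_const"])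
qed

lemma tail_linear:
  "f \<in> BV \<Longrightarrow> g \<in> BV \<Longrightarrow> tail (\<lambda>i. a * f i + b * g i) = (\<lambda>i. a * tail f i + b * tail g i)"
  by (auto simp: tail_def T_linear)

lemma head_compact:
  assumes "seq_space X nrm" and sub: "\<And>f. f \<in> X \<Longrightarrow> f \<in> BV \<and> nV f \<le> nrm f"
  shows "compact_op_on X nrm (\<lambda>f i. T f i - tail f i)"
proof -
  interpret X: seq_space X nrm by fact
  have "compact_op_on X nrm (\<lambda>f i. T f j * unit_seq j i)" for j
  proof (rule X.compact_op_rank_one[OF X.unit_mem, where B = "PV j"])
    show "T (\<lambda>i. a * f i + b * g i) j = a * T f j + b * T g j" if "f \<in> X" "g \<in> X" for f g a b
      using T_linear sub that by simp
    show "cmod (T f j) \<le> PV j * nrm f" if "f \<in> X" for f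
    proof -
      have "cmod (T f j) \<le> nV f * PV j" using T_bound sub that by blast
      also have "\<dots> \<le> nrm f * PV j" using sub that PV_nonneg by (intro mult_right_mono) auto
      finally show ?thesis by (simp add: mult.commute)
    qed
  qed
  then have "compact_op_on X nrm (\<lambda>f i. \<Sum>j\<in>{..<M}. T f j * unit_seq j i)"
    by (intro X.compact_op_sum) auto
  moreover have "(\<lambda>f i. \<Sum>j\<in>{..<M}. T f j * unit_seq j i) = (\<lambda>f i. T f i - tail f i)"
    unfolding head_eq_sum[symmetric] by (intro ext) (simp add: tail_def head_def)
  ultimately show ?thesis by simp
qed

lemma ess_radius_BV: "ess_spectral_radius BV nV T \<le> r"
proof (rule BV.ess_spectral_radius_le[OF bounded_BV])
  show "linear_op_on BV tail" unfolding linear_op_on_def using tail_BV tail_linear by auto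
  show "compact_op_on BV nV (\<lambda>f i. T f i - tail f i)" by (rule head_compact[OF BV.seq_space_axioms]) auto
qed (use r tail_BV in auto)

lemma ess_radius_l2: "ess_spectral_radius L2 n2 T \<le> r"
proof (rule L2.ess_spectral_radius_le[OF bounded_l2])
  show "linear_op_on L2 tail"
    unfolding linear_op_on_def using tail_l2 tail_linear l2_in_BV by (auto simp: tail_def[abs_def])
  show "compact_op_on L2 n2 (\<lambda>f i. T f i - tail f i)"
    by (rule head_compact[OF L2.seq_space_axioms l2_in_BV])
qed (use r tail_l2 in \<open>auto simp: tail_def\<close>)

subsection \<open>Transfer of the spectral gap\<close>

lemma T_pow_BV: "f \<in> BV \<Longrightarrow> (T ^^ n) f \<in> BV"
  using T_BV by (induction n) auto

lemma T_pow_add: "f \<in> BV \<Longrightarrow> g \<in> BV \<Longrightarrow> (T ^^ n) (\<lambda>i. f i + g i) = (\<lambda>i. (T ^^ n) f i + (T ^^ n) g i)"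
  by (induction n) (simp_all add: T_add T_pow_BV)

lemma mean_T_pow: "f \<in> BV \<Longrightarrow> mean_op \<pi> ((T ^^ n) f) = mean_op \<pi> f"
  by (induction n) (simp_all add: mean_T T_pow_BV)

text \<open>A sequence of norms with \<open>x (n + 1) \<le> r * x n + k * C * \<rho> ^ n\<close>, where \<open>k\<close> bounds the head,
  stays below \<open>D * \<rho> ^ n\<close> as soon as \<open>x 0 \<le> D\<close> and \<open>k * C \<le> D * (\<rho> - r)\<close>. The initial value
  \<open>1 + root_mass\<close> is a bound for the norm of \<open>I - \<Pi>\<close>.\<close>

lemma ex_rate_constant:
  assumes "0 \<le> C" and \<rho>: "r < \<rho>"
  obtains D where "1 + root_mass \<le> D" "0 < D" "head_const * C \<le> D * (\<rho> - r)"
proof (rule that)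
  let ?D = "(1 + root_mass) + head_const * C / (\<rho> - r)"
  have nonneg: "0 \<le> head_const * C / (\<rho> - r)" using head_const_nonneg assms by simp
  then show "1 + root_mass \<le> ?D" "0 < ?D" using root_mass_nonneg by auto
  have "?D * (\<rho> - r) = (1 + root_mass) * (\<rho> - r) + head_const * C"
    using \<rho> by (simp add: field_simps)
  then show "head_const * C \<le> ?D * (\<rho> - r)" using root_mass_nonneg \<rho> by simp
qed

text \<open>If \<open>g = f - \<Pi> f\<close> then \<open>T\<^sup>n\<^sup>+\<^sup>1 g = R (T\<^sup>n g) + K (T\<^sup>n g)\<close> with the tail \<open>R\<close> and the head \<open>K\<close>.
  The head sees only finitely many coordinates of \<open>T g\<close>, so its \<open>\<ell>\<^sup>2\<close> norm is controlled by the weaker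
  norm \<open>nV (T\<^sup>n g)\<close>, which decays like \<open>\<rho>\<^sup>n\<close> by hypothesis; and \<open>R\<close> contracts by \<open>r < \<rho>\<close>.\<close>

theorem gap_BV_imp_gap_l2:
  assumes gap: "spectral_gap_at BV nV P \<pi> \<rho>" and \<rho>: "r < \<rho>"
  shows "spectral_gap_at L2 n2 P \<pi> \<rho>"
proof -
  obtain C0 where C0: "C0 > 0" "\<And>n f. n \<ge> 1 \<Longrightarrow> f \<in> BV \<Longrightarrow>
      nV (\<lambda>i. (T ^^ n) f i - mean_op \<pi> f i) \<le> C0 * \<rho> ^ n * nV f"
    using gap unfolding spectral_gap_at_def by blast
  define C where "C = max C0 (1 + root_mass)"
  have \<rho>0: "0 < \<rho>" using \<rho> r by linarith
  have C: "0 < C" using C0 by (simp add: C_def)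
  obtain D where D: "1 + root_mass \<le> D" "0 < D" "head_const * C \<le> D * (\<rho> - r)"
    by (rule ex_rate_constant[OF less_imp_le[OF C] \<rho>])
  have main: "(\<lambda>i. (T ^^ n) f i - mean_op \<pi> f i) \<in> L2 \<and>
      n2 (\<lambda>i. (T ^^ n) f i - mean_op \<pi> f i) \<le> D * \<rho> ^ n * n2 f" if f: "f \<in> L2" for n f
  proof -
    define u where "u = (\<lambda>n i. (T ^^ n) f i - mean_op \<pi> f i)"
    have fB: "f \<in> BV" "nV f \<le> n2 f" using l2_in_BV[OF f] by auto
    have nonneg: "0 \<le> nV f" "0 \<le> n2 f" using BV.nrm_nonneg[OF fB(1)] L2.nrm_nonneg[OF f] by auto
    have mean: "mean_op \<pi> f \<in> L2" "n2 (mean_op \<pi> f) \<le> nV f * root_mass" using mean_in_l2[OF fB(1)] by auto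
    have meanB: "mean_op \<pi> f \<in> BV" "nV (mean_op \<pi> f) \<le> n2 (mean_op \<pi> f)" using l2_in_BV[OF mean(1)] by auto
    have u0: "u 0 \<in> L2" "n2 (u 0) \<le> (1 + root_mass) * n2 f"
    proof -
      show "u 0 \<in> L2" unfolding u_def using L2.diff_mem[OF f mean(1)] by simp
      have "n2 (u 0) \<le> n2 f + nV f * root_mass"
        unfolding u_def using L2.nrm_diff[OF f mean(1)] mean(2) by simp
      also have "nV f * root_mass \<le> n2 f * root_mass" using fB root_mass_nonneg by (intro mult_right_mono)
      finally show "n2 (u 0) \<le> (1 + root_mass) * n2 f" by (simp add: algebra_simps)
    qed
    have uV: "nV (u n) \<le> C * \<rho> ^ n * n2 f" for n
    proof (cases n)
      case 0
      have "nV (u 0) \<le> n2 (u 0)" using l2_in_BV[OF u0(1)] by simp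
      also have "\<dots> \<le> C * n2 f"
        using u0(2) nonneg mult_right_mono[of "1 + root_mass" C "n2 f"] by (simp add: C_def)
      finally show ?thesis using 0 by simp
    next
      case (Suc m)
      then have "nV (u n) \<le> C0 * \<rho> ^ n * nV f" unfolding u_def using C0(2)[of n f] fB by simp
      also have "\<dots> \<le> C * \<rho> ^ n * n2 f"
        using fB nonneg C0(1) \<rho>0 by (intro mult_mono) (auto simp: C_def)
      finally show ?thesis .
    qed
    have step: "u (Suc n) = T (u n)" for n
      unfolding u_def using T_diff[OF T_pow_BV[OF fB(1)] meanB(1)] T_mean by simp
    have "u n \<in> L2 \<and> n2 (u n) \<le> D * \<rho> ^ n * n2 f"
    proof (induction n)
      case 0
      then show ?case using u0 mult_right_mono[OF D(1) nonneg(2)] by simp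
    next
      case (Suc n)
      have "n2 (u (Suc n)) \<le> r * n2 (u n) + head_const * nV (u n)" using T_l2 Suc step by simp
      also have "\<dots> \<le> r * (D * \<rho> ^ n * n2 f) + head_const * (C * \<rho> ^ n * n2 f)"
        using Suc uV r head_const_nonneg by (intro add_mono mult_left_mono) auto
      also have "\<dots> = (r * D + head_const * C) * (\<rho> ^ n * n2 f)" by (simp add: algebra_simps)
      also have "\<dots> \<le> (D * \<rho>) * (\<rho> ^ n * n2 f)"
        using D(3) \<rho>0 nonneg by (intro mult_right_mono) (auto simp: algebra_simps)
      finally show ?case using T_l2 Suc step by (simp add: mult_ac)
    qed
    then show ?thesis by (simp add: u_def)
  qed
  then show ?thesis unfolding spectral_gap_at_def using D(2) by blast
qed

text \<open>Elements of \<open>\<B>\<^sub>V\<close> need not be square-summable, so here the splitting is used at the first step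
  instead of the last: \<open>(T\<^sup>n\<^sup>+\<^sup>1 - \<Pi>) f = (T\<^sup>n - \<Pi>) (R f) + (T\<^sup>n - \<Pi>) (K f)\<close>, where \<open>K f\<close> is finitely
  supported and hence subject to the hypothesis on \<open>\<ell>\<^sup>2(\<pi>)\<close>.\<close>

theorem gap_l2_imp_gap_BV:
  assumes gap: "spectral_gap_at L2 n2 P \<pi> \<rho>" and \<rho>: "r < \<rho>"
  shows "spectral_gap_at BV nV P \<pi> \<rho>"
proof -
  obtain C0 where C0: "C0 > 0" "\<And>n f. n \<ge> 1 \<Longrightarrow> f \<in> L2 \<Longrightarrow>
      (\<lambda>i. (T ^^ n) f i - mean_op \<pi> f i) \<in> L2 \<and>
      n2 (\<lambda>i. (T ^^ n) f i - mean_op \<pi> f i) \<le> C0 * \<rho> ^ n * n2 f"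
    using gap unfolding spectral_gap_at_def by blast
  define C where "C = max C0 (1 + root_mass)"
  have \<rho>0: "0 < \<rho>" using \<rho> r by linarith
  have C: "0 < C" using C0 by (simp add: C_def)
  obtain D where D: "1 + root_mass \<le> D" "0 < D" "head_const * C \<le> D * (\<rho> - r)"
    by (rule ex_rate_constant[OF less_imp_le[OF C] \<rho>])
  define E where "E = (\<lambda>n f i. (T ^^ n) f i - mean_op \<pi> f i)"
  have E_BV: "E n f \<in> BV" if f: "f \<in> BV" for n f
    unfolding E_def using T_pow_BV[OF f] mean_in_l2[OF f] l2_in_BV BV.diff_mem by auto
  have E0: "nV (E 0 f) \<le> (1 + root_mass) * nV f" if f: "f \<in> BV" for f
  proof -
    have m: "mean_op \<pi> f \<in> BV" "nV (mean_op \<pi> f) \<le> nV f * root_mass"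
      using mean_in_l2[OF f] l2_in_BV[of "mean_op \<pi> f"] by auto
    then show ?thesis unfolding E_def using BV.nrm_diff[OF f m(1)] by (simp add: algebra_simps)
  qed
  have E_l2: "nV (E n h) \<le> C * \<rho> ^ n * n2 h" if h: "h \<in> L2" for n h
  proof (cases n)
    case 0
    have hB: "h \<in> BV" "nV h \<le> n2 h" using l2_in_BV[OF h] by auto
    have "nV (E 0 h) \<le> (1 + root_mass) * nV h" by (rule E0[OF hB(1)])
    also have "\<dots> \<le> C * n2 h"
      using hB BV.nrm_nonneg[OF hB(1)] C by (intro mult_mono) (auto simp: C_def)
    finally show ?thesis using 0 by simp
  next
    case (Suc m)
    have "nV (E n h) \<le> n2 (E n h)" using C0(2)[of n h] h Suc l2_in_BV by (simp add: E_def)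
    also have "\<dots> \<le> C0 * \<rho> ^ n * n2 h" using C0(2)[of n h] h Suc by (simp add: E_def)
    also have "\<dots> \<le> C * \<rho> ^ n * n2 h"
      using L2.nrm_nonneg[OF h] \<rho>0 by (intro mult_right_mono) (auto simp: C_def)
    finally show ?thesis .
  qed
  have main: "nV (E n f) \<le> D * \<rho> ^ n * nV f" if "f \<in> BV" for n f
    using that
  proof (induction n arbitrary: f)
    case 0
    then show ?case using E0[OF 0] mult_right_mono[OF D(1) BV.nrm_nonneg[OF 0]] by simp
  next
    case (Suc n)
    note f = \<open>f \<in> BV\<close>
    have t: "tail f \<in> BV" "nV (tail f) \<le> r * nV f" using tail_BV[OF f] by auto
    have h: "head f \<in> L2" "n2 (head f) \<le> head_const * nV f" "head f \<in> BV"
      using head_bound[OF f] head_BV[OF f] by auto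
    have nonneg: "0 \<le> nV f" by (rule BV.nrm_nonneg[OF f])
    have "E (Suc n) f = E n (T f)"
      unfolding E_def using mean_T[OF f] by (simp add: funpow_swap1)
    also have "\<dots> = (\<lambda>i. E n (tail f) i + E n (head f) i)"
      unfolding E_def split[of f] T_pow_add[OF t(1) h(3)] mean_add[OF t(1) h(3)]
      by (simp add: algebra_simps)
    finally have "nV (E (Suc n) f) \<le> nV (E n (tail f)) + nV (E n (head f))"
      using BV.nrm_add[OF E_BV[OF t(1)] E_BV[OF h(3)]] by simp
    also have "\<dots> \<le> D * \<rho> ^ n * (r * nV f) + C * \<rho> ^ n * (head_const * nV f)"
    proof (rule add_mono)
      have "D * \<rho> ^ n * nV (tail f) \<le> D * \<rho> ^ n * (r * nV f)"
        using t(2) D \<rho>0 by (intro mult_left_mono) auto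
      then show "nV (E n (tail f)) \<le> D * \<rho> ^ n * (r * nV f)" using Suc.IH[OF t(1)] by linarith
      have "C * \<rho> ^ n * n2 (head f) \<le> C * \<rho> ^ n * (head_const * nV f)"
        using h(2) C \<rho>0 by (intro mult_left_mono) auto
      then show "nV (E n (head f)) \<le> C * \<rho> ^ n * (head_const * nV f)" using E_l2[OF h(1), of n] by linarith
    qed
    also have "\<dots> = (r * D + head_const * C) * (\<rho> ^ n * nV f)" by (simp add: algebra_simps)
    also have "\<dots> \<le> (D * \<rho>) * (\<rho> ^ n * nV f)"
      using D(3) \<rho>0 nonneg by (intro mult_right_mono) (auto simp: algebra_simps)
    finally show ?case by (simp add: mult_ac)
  qed
  then show ?thesis
    unfolding spectral_gap_at_def using D(2) E_BV unfolding E_def by blast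
qed

subsection \<open>Geometric ergodicity\<close>

text \<open>\<open>V\<close> tends to infinity because \<open>\<pi>\<close> is summable.\<close>

lemma V_level_finite: "finite {x. V x \<le> R}"
proof -
  have "\<pi> \<longlonglongrightarrow> 0" using \<pi>_sums by (intro summable_LIMSEQ_zero) (auto simp: sums_iff)
  then have "\<forall>\<^sub>F x in sequentially. \<pi> x < 1 / (\<bar>R\<bar> + 1)\<^sup>2"
    by (rule order_tendstoD(2)) simp
  then obtain N where N: "\<And>x. x \<ge> N \<Longrightarrow> \<pi> x < 1 / (\<bar>R\<bar> + 1)\<^sup>2" by (auto simp: eventually_sequentially)
  have "x < N" if "V x \<le> R" for x
  proof (rule ccontr)
    assume "\<not> x < N"
    then have "sqrt (\<pi> x) < sqrt (1 / (\<bar>R\<bar> + 1)\<^sup>2)" using N[of x] by simp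
    then have "sqrt (\<pi> x) < 1 / (\<bar>R\<bar> + 1)" by (simp add: real_sqrt_divide)
    then have "\<bar>R\<bar> + 1 < V x" using \<pi>_pos[of x] by (simp add: field_simps)
    then show False using that by linarith
  qed
  then have "{x. V x \<le> R} \<subseteq> {..<N}" by auto
  then show ?thesis using finite_lessThan by (rule finite_subset)
qed

text \<open>The contraction of the tail is a drift condition for \<open>V\<close>, and the positivity on finite sets is
  the corresponding minorization; so the oscillations of \<open>T\<^sup>n f\<close> decay geometrically. Averaging
  \<open>T\<^sup>n f x - T\<^sup>n f y\<close> over \<open>y\<close> with law \<open>\<pi>\<close> turns this into a bound on \<open>T\<^sup>n f - \<Pi> f\<close>.\<close>

theorem geometric_ergodicity:
  assumes irr: "irreducible_kernel P" and aper: "aperiodic_kernel P"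
  obtains \<rho> where "0 < \<rho>" "\<rho> < 1" "spectral_gap_at BV nV P \<pi> \<rho>"
proof -
  define \<gamma> where "\<gamma> = (1 + r) / 2"
  have \<gamma>: "0 < \<gamma>" "\<gamma> < 1" "r \<le> \<gamma>" using r by (auto simp: \<gamma>_def)
  define B where "B = (1 + (\<Sum>i<M. PV i)) / (1 - \<gamma>)"
  have sum_nonneg: "0 \<le> (\<Sum>i<M. PV i)" using PV_nonneg by (intro sum_nonneg) auto
  interpret drift_kernel P V \<gamma> B
  proof
    show "0 < B" unfolding B_def using sum_nonneg \<gamma> by simp
    show "(\<Sum>j. P i j * V j) \<le> \<gamma> * V i + (1 - \<gamma>) * B" for i
    proof (cases "i < M")
      case True
      then have "PV i \<le> (\<Sum>i<M. PV i)" using PV_nonneg by (intro member_le_sum) auto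
      also have "\<dots> \<le> (1 - \<gamma>) * B" using \<gamma> by (simp add: B_def)
      finally show ?thesis using \<gamma> V_pos[of i] by (simp add: PV_def add_increasing)
    next
      case False
      then have "PV i \<le> r * V i" by (intro tail_PV) simp
      also have "\<dots> \<le> \<gamma> * V i" using \<gamma> V_pos[of i] by (intro mult_right_mono) auto
      also have "\<dots> \<le> \<gamma> * V i + (1 - \<gamma>) * B" using \<gamma> sum_nonneg by (simp add: B_def)
      finally show ?thesis by (simp add: PV_def)
    qed
  qed (use markov V_pos PV_summable \<gamma> less_imp_le in auto)
  let ?F = "{x. V x \<le> 4 * B / (1 - \<gamma>)}"
  obtain n0 where n0: "n0 \<ge> 1" "\<And>i. i \<in> ?F \<Longrightarrow> 0 < kernel_power P n0 i 0"
    using eventually_positive_on_finite[OF markov irr aper V_level_finite, where j = 0] by blast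
  define \<delta> where "\<delta> = Min (insert 1 ((\<lambda>i. kernel_power P n0 i 0) ` ?F))"
  have fin: "finite (insert 1 ((\<lambda>i. kernel_power P n0 i 0) ` ?F))"
    using V_level_finite by simp
  have \<delta>: "0 < \<delta>" unfolding \<delta>_def using n0(2) by (subst Min_gr_iff[OF fin]) auto
  have minor: "\<forall>x. V x \<le> 4 * B / (1 - \<gamma>) \<longrightarrow> \<delta> \<le> kernel_power P n0 x 0"
    unfolding \<delta>_def by (intro allI impI Min_le[OF fin]) auto
  obtain \<beta> \<rho> C where \<beta>: "0 < \<beta>" and \<rho>: "0 < \<rho>" "\<rho> < 1" and C: "0 < C"
    and osc: "\<forall>f A. 0 \<le> A \<longrightarrow> (\<forall>x y. cmod (f x - f y) \<le> A * (2 + \<beta> * V x + \<beta> * V y)) \<longrightarrow>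
      (\<forall>n x y. cmod ((T ^^ n) f x - (T ^^ n) f y) \<le> C * \<rho> ^ n * A * (2 + \<beta> * V x + \<beta> * V y))"
    using oscillation_contraction[OF n0(1) \<delta> minor] by (elim exE conjE)
  define K where "K = C * (2 + \<beta> + \<beta> * root_mass) / \<beta>"
  have K: "0 < K" unfolding K_def using C \<beta> root_mass_nonneg by (simp add: add_pos_nonneg)
  have "(\<lambda>i. (T ^^ n) f i - mean_op \<pi> f i) \<in> BV \<and>
      nV (\<lambda>i. (T ^^ n) f i - mean_op \<pi> f i) \<le> K * \<rho> ^ n * nV f" if f: "f \<in> BV" for n f
  proof (subst BV_ball_iff[of V, OF V_pos], rule allI)
    fix x
    define A where "A = nV f / \<beta>"
    have A: "0 \<le> A" "\<beta> * A = nV f" using BV.nrm_nonneg[OF f] \<beta> by (auto simp: A_def)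
    have f_osc: "cmod (f x - f y) \<le> A * (2 + \<beta> * V x + \<beta> * V y)" for x y
    proof -
      have "cmod (f x - f y) \<le> nV f * V x + nV f * V y"
        using norm_triangle_ineq4[of "f x" "f y"] BV_bound[of V, OF V_pos f, of x]
          BV_bound[of V, OF V_pos f, of y] by linarith
      also have "\<dots> = A * (\<beta> * V x + \<beta> * V y)" unfolding A(2)[symmetric] by (simp only: algebra_simps)
      also have "\<dots> \<le> A * (2 + \<beta> * V x + \<beta> * V y)" using A by (intro mult_left_mono) auto
      finally show ?thesis .
    qed
    have Tf_osc: "cmod ((T ^^ n) f y - (T ^^ n) f x) \<le> C * \<rho> ^ n * A * (2 + \<beta> * V y + \<beta> * V x)" for y
      using osc[rule_format, OF A(1) f_osc] .
    let ?c = "C * \<rho> ^ n * A"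
    have c: "0 \<le> ?c" using C \<rho> A by simp
    have "(\<lambda>y. (2 + \<beta> * V x) * \<pi> y + \<beta> * sqrt (\<pi> y)) sums ((2 + \<beta> * V x) * 1 + \<beta> * root_mass)"
      unfolding root_mass_def by (intro sums_add sums_mult \<pi>_sums summable_sums sqrt_summable)
    from sums_mult[OF this, of ?c]
    have "(\<lambda>y. ?c * ((2 + \<beta> * V x) * \<pi> y + \<beta> * sqrt (\<pi> y))) sums (?c * (2 + \<beta> * V x + \<beta> * root_mass))"
      by (simp only: mult_1_right)
    moreover have "\<pi> y * (?c * (2 + \<beta> * V y + \<beta> * V x)) = ?c * ((2 + \<beta> * V x) * \<pi> y + \<beta> * sqrt (\<pi> y))" for y
    proof -
      have "\<pi> y * (?c * (2 + \<beta> * V y + \<beta> * V x)) = ?c * ((2 + \<beta> * V x) * \<pi> y + \<beta> * (\<pi> y * V y))"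
        by (simp only: algebra_simps)
      then show ?thesis unfolding \<pi>_V .
    qed
    ultimately have "(\<lambda>y. \<pi> y * (?c * (2 + \<beta> * V y + \<beta> * V x))) sums (?c * (2 + \<beta> * V x + \<beta> * root_mass))"
      by (simp only:)
    then have "cmod ((\<Sum>y. of_real (\<pi> y) * (T ^^ n) f y) - (T ^^ n) f x) \<le> ?c * (2 + \<beta> * V x + \<beta> * root_mass)"
      by (intro average_bound[OF less_imp_le[OF \<pi>_pos] \<pi>_sums Tf_osc])
    moreover have "(\<Sum>y. of_real (\<pi> y) * (T ^^ n) f y) = mean_op \<pi> f x"
      using fun_cong[OF mean_T_pow[OF f, of n], of x] by (simp add: mean_op_def mult.commute)
    ultimately have "cmod ((T ^^ n) f x - mean_op \<pi> f x) \<le> ?c * (2 + \<beta> * V x + \<beta> * root_mass)"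
      by (simp add: norm_minus_commute)
    also have "\<dots> \<le> ?c * ((2 + \<beta> + \<beta> * root_mass) * V x)"
    proof (rule mult_left_mono[OF _ c])
      have "(2 + \<beta> * root_mass) * 1 \<le> (2 + \<beta> * root_mass) * V x"
        using V_ge_1[of x] \<beta> root_mass_nonneg by (intro mult_left_mono) auto
      then show "2 + \<beta> * V x + \<beta> * root_mass \<le> (2 + \<beta> + \<beta> * root_mass) * V x"
        by (simp only: distrib_right mult_1_right)
    qed
    also have "\<dots> = K * \<rho> ^ n * nV f * V x" unfolding K_def A_def by simp
    finally show "cmod ((T ^^ n) f x - mean_op \<pi> f x) \<le> K * \<rho> ^ n * nV f * V x" .
  qed
  then have "spectral_gap_at BV nV P \<pi> \<rho>" unfolding spectral_gap_at_def using K by blast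
  then show ?thesis using that \<rho> by blast
qed

end

section \<open>The infima of the rates\<close>

text \<open>Rates are closed upwards, so only the behaviour above a threshold \<open>z\<close> matters for the
  bound \<open>z\<close> on an infimum. With \<open>z\<close> equal to \<open>\<alpha>\<close>, to the infimum for \<open>\<B>\<^sub>V\<close>, or to the maximum of
  \<open>\<alpha>\<close> and the infimum for \<open>\<ell>\<^sup>2(\<pi>)\<close>, this yields both comparisons of the two infima.\<close>

lemma (in invariant_kernel) gap_rate_transfer:
  assumes gap: "spectral_gap X nX P \<pi>" and nonneg: "\<And>f. f \<in> X \<Longrightarrow> 0 \<le> nX f"
    and z: "0 \<le> z" "z < 1" "gap_rate X nX P \<pi> \<le> z"
    and transfer: "\<And>\<rho>. z < \<rho> \<Longrightarrow> \<rho> < 1 \<Longrightarrow> spectral_gap_at X nX P \<pi> \<rho> \<Longrightarrow> spectral_gap_at Y nY P \<pi> \<rho>"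
  shows "gap_rate Y nY P \<pi> \<le> z"
proof (rule dense_ge_bounded[OF z(2)])
  let ?S = "\<lambda>X nX. {\<rho> \<in> {0<..<1}. spectral_gap_at X nX P \<pi> \<rho>}"
  have bdd: "bdd_below (?S X nX)" for X nX by (rule bdd_belowI[of _ 0]) auto
  fix \<rho> assume \<rho>: "z < \<rho>" "\<rho> < 1"
  have "?S X nX \<noteq> {}" using gap unfolding spectral_gap_def by auto
  moreover have "Inf (?S X nX) < \<rho>" using z(3) \<rho>(1) by (simp add: gap_rate_def)
  ultimately obtain \<rho>' where \<rho>': "\<rho>' \<in> ?S X nX" "\<rho>' < \<rho>" using cInf_less_iff[OF _ bdd] by blast
  then have "spectral_gap_at X nX P \<pi> \<rho>"
    by (intro spectral_gap_at_mono[of X nX \<rho>' \<rho>] nonneg) auto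
  then have "\<rho> \<in> ?S Y nY" using transfer \<rho> z(1) by auto
  then show "gap_rate Y nY P \<pi> \<le> \<rho>" unfolding gap_rate_def by (rule cInf_lower[OF _ bdd])
qed

text \<open>Everything follows once the tail can be made to contract by any factor above \<open>\<alpha>\<close>. A rate
  \<open>\<rho> > \<alpha>\<close> leaves room for a contraction factor \<open>r\<close> strictly between \<open>\<alpha>\<close> and \<open>\<rho>\<close>, which is
  what the two transfer theorems need.\<close>

theorem (in invariant_kernel) rates_from_tails:
  assumes irr: "irreducible_kernel P" and aper: "aperiodic_kernel P"
    and \<alpha>: "0 \<le> \<alpha>" "\<alpha> < 1"
    and tails: "\<And>r. \<alpha> < r \<Longrightarrow> r < 1 \<Longrightarrow> \<exists>M. contracting_tail P \<pi> M r"
  shows "spectral_gap L2 n2 P \<pi>" and "spectral_gap BV nV P \<pi>"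
    and "bounded_op_on L2 n2 T" and "bounded_op_on BV nV T"
    and "ess_spectral_radius BV nV T \<le> \<alpha>" and "ess_spectral_radius L2 n2 T \<le> \<alpha>"
    and "gap_rate BV nV P \<pi> \<le> \<alpha> \<Longrightarrow> gap_rate L2 n2 P \<pi> \<le> \<alpha>"
    and "gap_rate BV nV P \<pi> > \<alpha> \<Longrightarrow> gap_rate L2 n2 P \<pi> = gap_rate BV nV P \<pi>"
proof -
  have to_l2: "spectral_gap_at L2 n2 P \<pi> \<rho>" if \<rho>: "\<alpha> < \<rho>" "\<rho> < 1" "spectral_gap_at BV nV P \<pi> \<rho>" for \<rho>
  proof -
    obtain r where r: "\<alpha> < r" "r < \<rho>" using dense[OF \<rho>(1)] by auto
    then obtain M where "contracting_tail P \<pi> M r" using tails[of r] \<rho>(2) by auto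
    from contracting_tail.gap_BV_imp_gap_l2[OF this \<rho>(3) r(2)] show ?thesis .
  qed
  have to_BV: "spectral_gap_at BV nV P \<pi> \<rho>" if \<rho>: "\<alpha> < \<rho>" "\<rho> < 1" "spectral_gap_at L2 n2 P \<pi> \<rho>" for \<rho>
  proof -
    obtain r where r: "\<alpha> < r" "r < \<rho>" using dense[OF \<rho>(1)] by auto
    then obtain M where "contracting_tail P \<pi> M r" using tails[of r] \<rho>(2) by auto
    from contracting_tail.gap_l2_imp_gap_BV[OF this \<rho>(3) r(2)] show ?thesis .
  qed
  obtain r where r: "\<alpha> < r" "r < 1" using dense[OF \<alpha>(2)] by blast
  then obtain M where "contracting_tail P \<pi> M r" using tails[of r] by auto
  then interpret ct: contracting_tail P \<pi> M r .
  show "bounded_op_on L2 n2 T" by (rule ct.bounded_l2)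
  show "bounded_op_on BV nV T" by (rule ct.bounded_BV)
  obtain \<rho> where \<rho>: "0 < \<rho>" "\<rho> < 1" "spectral_gap_at BV nV P \<pi> \<rho>"
    by (rule ct.geometric_ergodicity[OF irr aper])
  then show gap_BV: "spectral_gap BV nV P \<pi>" unfolding spectral_gap_def by auto
  have "spectral_gap_at BV nV P \<pi> (max \<rho> r)"
    by (rule spectral_gap_at_mono[OF \<rho>(3)]) (use \<rho> BV.nrm_nonneg in auto)
  then have "spectral_gap_at L2 n2 P \<pi> (max \<rho> r)" using r \<rho> by (intro to_l2) auto
  then show gap_l2: "spectral_gap L2 n2 P \<pi>"
    unfolding spectral_gap_def using \<rho> r by (intro bexI[of _ "max \<rho> r"]) auto
  show "ess_spectral_radius BV nV T \<le> \<alpha>"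
  proof (rule dense_ge_bounded[OF \<alpha>(2)])
    fix r assume "\<alpha> < r" "r < 1"
    then obtain M where "contracting_tail P \<pi> M r" using tails[of r] by auto
    then show "ess_spectral_radius BV nV T \<le> r" by (rule contracting_tail.ess_radius_BV)
  qed
  show "ess_spectral_radius L2 n2 T \<le> \<alpha>"
  proof (rule dense_ge_bounded[OF \<alpha>(2)])
    fix r assume "\<alpha> < r" "r < 1"
    then obtain M where "contracting_tail P \<pi> M r" using tails[of r] by auto
    then show "ess_spectral_radius L2 n2 T \<le> r" by (rule contracting_tail.ess_radius_l2)
  qed
  show "gap_rate L2 n2 P \<pi> \<le> \<alpha>" if "gap_rate BV nV P \<pi> \<le> \<alpha>"
    by (rule gap_rate_transfer[OF gap_BV BV.nrm_nonneg \<alpha> that to_l2])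
  have rate_less_1: "gap_rate X nX P \<pi> < 1" if "spectral_gap X nX P \<pi>" for X nX
  proof -
    obtain \<rho> where "\<rho> \<in> {0<..<1}" "spectral_gap_at X nX P \<pi> \<rho>"
      using \<open>spectral_gap X nX P \<pi>\<close> unfolding spectral_gap_def by blast
    then have "gap_rate X nX P \<pi> \<le> \<rho>"
      unfolding gap_rate_def by (intro cInf_lower bdd_belowI[of _ 0]) auto
    then show ?thesis using \<open>\<rho> \<in> {0<..<1}\<close> by simp
  qed
  show "gap_rate L2 n2 P \<pi> = gap_rate BV nV P \<pi>" if *: "gap_rate BV nV P \<pi> > \<alpha>"
  proof (rule antisym)
    show "gap_rate L2 n2 P \<pi> \<le> gap_rate BV nV P \<pi>"
      by (rule gap_rate_transfer[OF gap_BV BV.nrm_nonneg])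
        (use rate_less_1[OF gap_BV] * \<alpha> to_l2 in auto)
    have "gap_rate BV nV P \<pi> \<le> max \<alpha> (gap_rate L2 n2 P \<pi>)"
      by (rule gap_rate_transfer[OF gap_l2 L2.nrm_nonneg])
        (use rate_less_1[OF gap_l2] \<alpha> to_BV in auto)
    then show "gap_rate BV nV P \<pi> \<le> gap_rate L2 n2 P \<pi>" using * by simp
  qed
qed

section \<open>Asymptotically homogeneous banded kernels\<close>

text \<open>Positivity propagates along the edges of the kernel: \<open>\<pi> k\<close> is at least \<open>\<pi> i * P i k\<close>.\<close>

lemma invariant_prob_pos:
  assumes irr: "irreducible_kernel P" and markov: "markov_kernel P" and inv: "invariant_prob P \<pi>"
  shows "0 < \<pi> j"
proof -
  have nonneg: "0 \<le> \<pi> i" for i using inv by (simp add: invariant_prob_def)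
  have edge: "0 < \<pi> k" if "0 < \<pi> i" "0 < P i k" for i k
  proof -
    have "(\<lambda>i. \<pi> i * P i k) sums \<pi> k" using inv by (simp add: invariant_prob_def)
    moreover have "0 \<le> \<pi> i * P i k" for i using nonneg kernel_nonneg[OF markov] by simp
    ultimately have "\<pi> i * P i k \<le> \<pi> k"
      using sum_le_suminf[of "\<lambda>i. \<pi> i * P i k" "{i}"] by (simp add: sums_iff)
    then show ?thesis using mult_pos_pos[OF that] by linarith
  qed
  have path: "0 < \<pi> i \<Longrightarrow> 0 < kernel_power P n i j \<Longrightarrow> 0 < \<pi> j" for i n
  proof (induction n arbitrary: i)
    case 0
    then show ?case by (simp split: if_splits)
  next
    case (Suc n)
    then obtain k where "0 < P i k" "0 < kernel_power P n k j"
      using kernel_power_Suc_pos[OF markov] by blast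
    then show ?case using Suc edge by blast
  qed
  have "\<exists>i. \<pi> i \<noteq> 0"
  proof (rule ccontr)
    assume "\<not> ?thesis"
    then have "\<pi> = (\<lambda>_. 0)" by auto
    then have "\<pi> sums 0" by simp
    moreover have "\<pi> sums 1" using inv by (simp add: invariant_prob_def)
    ultimately show False using sums_unique2 by fastforce
  qed
  then obtain i where "\<pi> i \<noteq> 0" by blast
  then have "0 < \<pi> i" using nonneg[of i] by simp
  moreover obtain n where "0 < kernel_power P n i j"
    using irr unfolding irreducible_kernel_def by blast
  ultimately show ?thesis by (rule path)
qed

locale banded_kernel =
  fixes P :: "nat \<Rightarrow> nat \<Rightarrow> real" and \<pi> :: "nat \<Rightarrow> real"
    and i0 N :: nat and a :: "int \<Rightarrow> real" and \<tau> :: real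
  assumes markov: "markov_kernel P"
    and \<pi>_pos: "0 < \<pi> i"
    and \<pi>_sums: "\<pi> sums 1"
    and invariant: "(\<lambda>i. \<pi> i * P i j) sums \<pi> j"
    and band: "i \<ge> i0 \<Longrightarrow> \<bar>int i - int j\<bar> > int N \<Longrightarrow> P i j = 0"
    and a_nonneg: "m \<in> {- int N..int N} \<Longrightarrow> 0 \<le> a m"
    and P_lim: "m \<in> {- int N..int N} \<Longrightarrow> (\<lambda>i. P i (nat (int i + m))) \<longlonglongrightarrow> a m"
    and \<tau>: "0 \<le> \<tau>" "\<tau> < 1"
    and ratio_lim: "(\<lambda>i. \<pi> (Suc i) / \<pi> i) \<longlonglongrightarrow> \<tau>"
    and drift: "(\<Sum>k = - int N..int N. of_int k * a k) < 0"
begin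

abbreviation "D \<equiv> {- int N..int N}"
abbreviation "sh i m \<equiv> nat (int i + m)"

text \<open>The ratio test applies because \<open>\<pi>\<close> decays geometrically.\<close>

lemma sqrt_summable: "summable (\<lambda>i. sqrt (\<pi> i))"
proof -
  have "\<tau> < (1 + \<tau>) / 2" using \<tau> by simp
  then have "\<forall>\<^sub>F i in sequentially. \<pi> (Suc i) / \<pi> i < (1 + \<tau>) / 2" by (rule order_tendstoD(2)[OF ratio_lim])
  then obtain n where n: "\<And>i. i \<ge> n \<Longrightarrow> \<pi> (Suc i) / \<pi> i < (1 + \<tau>) / 2" by (auto simp: eventually_sequentially)
  show ?thesis
  proof (rule summable_ratio_test)
    show "sqrt ((1 + \<tau>) / 2) < 1" using \<tau> by simp
    fix i assume "n \<le> i"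
    then have "\<pi> (Suc i) \<le> (1 + \<tau>) / 2 * \<pi> i" using n[of i] \<pi>_pos[of i] by (simp add: pos_divide_less_eq)
    then have "sqrt (\<pi> (Suc i)) \<le> sqrt ((1 + \<tau>) / 2) * sqrt (\<pi> i)"
      by (simp add: real_sqrt_mult[symmetric])
    then show "norm (sqrt (\<pi> (Suc i))) \<le> sqrt ((1 + \<tau>) / 2) * norm (sqrt (\<pi> i))"
      using \<pi>_pos by (simp add: less_imp_le)
  qed
qed

sublocale invariant_kernel P \<pi>
  by unfold_locales (fact markov \<pi>_pos \<pi>_sums invariant sqrt_summable)+

lemma inj_shift: "N \<le> i \<Longrightarrow> inj_on (sh i) D"
  by (auto simp: inj_on_def)

lemma band_sums:
  fixes g :: "nat \<Rightarrow> 'b :: real_normed_vector"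
  assumes i: "N \<le> i" and g: "\<And>j. \<bar>int i - int j\<bar> > int N \<Longrightarrow> g j = 0"
  shows "g sums (\<Sum>m\<in>D. g (sh i m))"
proof -
  have "g sums (\<Sum>j\<in>sh i ` D. g j)"
  proof (rule sums_finite)
    fix j assume "j \<notin> sh i ` D"
    then have "int j - int i \<notin> D" by force
    then show "g j = 0" by (intro g) auto
  qed simp
  then show ?thesis by (simp add: sum.reindex[OF inj_shift[OF i]] o_def)
qed

lemma ratio_power: "(\<lambda>i. \<pi> (i + k) / \<pi> i) \<longlonglongrightarrow> \<tau> ^ k"
proof (induction k)
  case 0
  then show ?case using \<pi>_neq_0 by simp
next
  case (Suc k)
  have "(\<lambda>i. \<pi> (Suc (i + k)) / \<pi> (i + k) * (\<pi> (i + k) / \<pi> i)) \<longlonglongrightarrow> \<tau> * \<tau> ^ k"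
    by (intro tendsto_mult Suc LIMSEQ_ignore_initial_segment ratio_lim)
  then show ?case using \<pi>_neq_0 by simp
qed

lemma ratio_neg: "m < 0 \<Longrightarrow> (\<lambda>i. \<pi> i / \<pi> (sh i m)) \<longlonglongrightarrow> \<tau> ^ nat (- m)"
  by (rule LIMSEQ_offset[of _ "nat (- m)"]) (use ratio_power[of "nat (- m)"] in simp)

lemma ratio_int:
  assumes "0 < \<tau>"
  shows "(\<lambda>i. \<pi> i / \<pi> (sh i m)) \<longlonglongrightarrow> \<tau> powr (- of_int m)"
proof (cases "m < 0")
  case True
  then have "\<tau> powr (- of_int m) = \<tau> ^ nat (- m)" using assms by (simp add: powr_realpow[symmetric])
  then show ?thesis using ratio_neg[OF True] by simp
next
  case False
  then have sh: "sh i m = i + nat m" for i by simp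
  have "(\<lambda>i. inverse (\<pi> (i + nat m) / \<pi> i)) \<longlonglongrightarrow> inverse (\<tau> ^ nat m)"
    by (intro tendsto_inverse ratio_power) (use assms in simp)
  moreover have "inverse (\<tau> ^ nat m) = \<tau> powr (- of_int m)"
    using False assms by (simp add: powr_minus powr_realpow[symmetric])
  ultimately show ?thesis unfolding sh by simp
qed

text \<open>The weight \<open>P(i, i + m) * sqrt (\<pi> i / \<pi> (i + m))\<close> of the shift by \<open>m\<close> is the square root of
  \<open>P(i, i + m) * P\<^sup>*(i + m, i)\<close>. It is the entry of \<open>P\<close> conjugated by \<open>V\<close>, and equally the entry of
  \<open>P\<close> transported to the unweighted \<open>\<ell>\<^sup>2\<close>; this is why the same \<open>\<alpha>\<^sub>0\<close> governs both spaces.\<close>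

definition weight :: "int \<Rightarrow> nat \<Rightarrow> real" where
  "weight m i = P i (sh i m) * sqrt (\<pi> i / \<pi> (sh i m))"

definition weight_lim :: "int \<Rightarrow> real" where
  "weight_lim m = (if \<tau> > 0 then a m * \<tau> powr (- of_int m / 2) else if m = 0 then a 0 else 0)"

definition \<alpha> :: real where
  "\<alpha> = (\<Sum>m\<in>D. weight_lim m)"

lemma weight_nonneg: "0 \<le> weight m i"
  unfolding weight_def using P_nonneg \<pi>_pos by (simp add: less_imp_le)

lemma weight_tendsto:
  assumes m: "m \<in> D"
  shows "weight m \<longlonglongrightarrow> weight_lim m"
proof (cases "0 < \<tau>")
  case True
  have "(\<lambda>i. P i (sh i m) * sqrt (\<pi> i / \<pi> (sh i m))) \<longlonglongrightarrow> a m * sqrt (\<tau> powr (- of_int m))"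
    by (intro tendsto_intros P_lim m ratio_int True)
  moreover have "sqrt (\<tau> powr (- of_int m)) = \<tau> powr (- of_int m / 2)"
    using True by (simp add: powr_half_sqrt[symmetric] powr_powr)
  ultimately show ?thesis using True unfolding weight_def[abs_def] weight_lim_def by simp
next
  case False
  then have \<tau>0: "\<tau> = 0" using \<tau> by simp
  consider "m = 0" | "m < 0" | "m > 0" by linarith
  then show ?thesis
  proof cases
    case 1
    then show ?thesis using P_lim[OF m] False \<pi>_neq_0 by (simp add: weight_def[abs_def] weight_lim_def)
  next
    case 2
    have "(\<lambda>i. P i (sh i m) * sqrt (\<pi> i / \<pi> (sh i m))) \<longlonglongrightarrow> a m * sqrt (\<tau> ^ nat (- m))"
      by (intro tendsto_intros P_lim m ratio_neg 2)
    then show ?thesis using 2 \<tau>0 unfolding weight_def[abs_def] weight_lim_def by (simp add: zero_power)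
  next
    case 3
    then have sh: "sh i m = i + nat m" for i by simp
    have lim: "(\<lambda>i. sqrt (\<pi> (i + nat m) / \<pi> i)) \<longlonglongrightarrow> sqrt (\<tau> ^ nat m)"
      by (intro tendsto_intros ratio_power)
    \<comment> \<open>Here the factor \<open>sqrt (\<pi> i / \<pi> (i + m))\<close> blows up; invariance bounds \<open>P\<close> by its inverse square.\<close>
    have "weight m i \<le> sqrt (\<pi> (i + nat m) / \<pi> i)" for i
    proof -
      let ?q = "\<pi> (i + nat m) / \<pi> i"
      have q: "0 < ?q" using \<pi>_pos by simp
      have "weight m i \<le> ?q * sqrt (\<pi> i / \<pi> (i + nat m))"
        unfolding weight_def sh using P_le \<pi>_pos by (intro mult_right_mono) (auto simp: less_imp_le)
      also have "\<dots> = ?q / sqrt ?q" by (simp add: real_sqrt_divide)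
      also have "\<dots> = sqrt ?q" using q by (simp only: real_div_sqrt less_imp_le)
      finally show ?thesis .
    qed
    then have "weight m \<longlonglongrightarrow> 0"
      using lim 3 \<tau>0 weight_nonneg
      by (intro tendsto_sandwich[OF _ _ tendsto_const, of 0 "weight m" sequentially
            "\<lambda>i. sqrt (\<pi> (i + nat m) / \<pi> i)"]) (auto simp: zero_power)
    then show ?thesis using 3 False by (simp add: weight_lim_def)
  qed
qed

lemma weight_lim_nonneg: "m \<in> D \<Longrightarrow> 0 \<le> weight_lim m"
  unfolding weight_lim_def using a_nonneg[of m] by auto

lemma \<alpha>_nonneg: "0 \<le> \<alpha>"
  unfolding \<alpha>_def using weight_lim_nonneg by (intro sum_nonneg) auto

lemma \<alpha>_eq: "\<alpha> = (if \<tau> > 0 then (\<Sum>m\<in>D. a m * \<tau> powr (- of_int m / 2)) else a 0)"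
  unfolding \<alpha>_def weight_lim_def by (simp add: sum.delta)

lemma sum_a: "(\<Sum>m\<in>D. a m) = 1"
proof -
  have lim: "(\<lambda>i. \<Sum>m\<in>D. P i (sh i m)) \<longlonglongrightarrow> (\<Sum>m\<in>D. a m)" by (intro tendsto_sum P_lim)
  have "\<forall>\<^sub>F i in sequentially. (\<Sum>m\<in>D. P i (sh i m)) = 1"
    using eventually_ge_at_top[of "max i0 N"]
  proof eventually_elim
    case (elim i)
    then have "P i sums (\<Sum>m\<in>D. P i (sh i m))" using band by (intro band_sums) auto
    then show ?case using sums_unique2 kernel_sums[OF markov] by blast
  qed
  then have "(\<lambda>i. \<Sum>m\<in>D. P i (sh i m)) \<longlonglongrightarrow> 1" by (rule tendsto_eventually)
  then show ?thesis using LIMSEQ_unique lim by blast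
qed

lemma ex_nonzero_step: "\<exists>m\<in>D. m \<noteq> 0 \<and> 0 < a m"
proof (rule ccontr)
  assume "\<not> ?thesis"
  then have "of_int k * a k = 0" if "k \<in> D" for k using a_nonneg[OF that] that by force
  then have "(\<Sum>k\<in>D. of_int k * a k) = 0" by (intro sum.neutral) auto
  then show False using drift by simp
qed

text \<open>Column \<open>j\<close> of the invariance equation, divided by \<open>\<pi> j\<close>, becomes in the limit the assertion
  that \<open>\<phi>(s) = (\<Sum>m. a m * \<tau> powr (- m * s))\<close> satisfies \<open>\<phi>(1) \<le> 1\<close>; there is only an inequality, since
  the rows below \<open>i0\<close> may contribute to every column.\<close>

lemma sum_a_ratio_le:
  assumes "0 < \<tau>"
  shows "(\<Sum>m\<in>D. a m * \<tau> powr (- of_int m)) \<le> 1"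
proof -
  let ?h = "\<lambda>m i. P i (sh i m) * (\<pi> i / \<pi> (sh i m))"
  have lim: "(\<lambda>j. ?h m (nat (int j - m))) \<longlonglongrightarrow> a m * \<tau> powr (- of_int m)" if m: "m \<in> D" for m
  proof -
    have h: "?h m \<longlonglongrightarrow> a m * \<tau> powr (- of_int m)" by (intro tendsto_mult P_lim m ratio_int assms)
    have shift: "filterlim (\<lambda>j. nat (int j - m)) sequentially sequentially"
      unfolding filterlim_at_top
    proof
      fix z
      show "\<forall>\<^sub>F j in sequentially. z \<le> nat (int j - m)"
        by (rule eventually_sequentiallyI[of "z + nat \<bar>m\<bar>"]) auto
    qed
    show ?thesis using filterlim_compose[OF h shift] .
  qed
  have sum_lim: "(\<lambda>j. \<Sum>m\<in>D. ?h m (nat (int j - m))) \<longlonglongrightarrow> (\<Sum>m\<in>D. a m * \<tau> powr (- of_int m))"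
    by (intro tendsto_sum lim)
  have le: "(\<Sum>m\<in>D. ?h m (nat (int j - m))) \<le> 1" if j: "N \<le> j" for j
  proof -
    let ?i = "\<lambda>m. nat (int j - m)"
    have "(\<Sum>m\<in>D. ?h m (?i m)) = (\<Sum>m\<in>D. \<pi> (?i m) * P (?i m) j / \<pi> j)"
      using j by (intro sum.cong) (auto simp: mult.commute)
    also have "\<dots> = (\<Sum>m\<in>D. \<pi> (?i m) * P (?i m) j) / \<pi> j" by (simp add: sum_divide_distrib)
    also have "(\<Sum>m\<in>D. \<pi> (?i m) * P (?i m) j) = (\<Sum>i\<in>?i ` D. \<pi> i * P i j)"
      using j by (subst sum.reindex) (auto simp: inj_on_def)
    also have "\<dots> \<le> \<pi> j"
      using sum_le_suminf[of "\<lambda>i. \<pi> i * P i j" "?i ` D"] invariant[of j] P_nonneg \<pi>_pos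
      by (auto simp: sums_iff less_imp_le)
    finally show ?thesis using \<pi>_pos[of j] by (simp add: divide_right_mono)
  qed
  show ?thesis by (rule LIMSEQ_le_const2[OF sum_lim]) (intro exI[of _ N] allI impI le)
qed

text \<open>For \<open>\<tau> > 0\<close>, \<open>\<alpha>\<close> is the value at \<open>1/2\<close> of the convex function \<open>\<phi>\<close> with \<open>\<phi>(0) = 1\<close> and
  \<open>\<phi>(1) \<le> 1\<close>, and \<open>\<phi>(0) - 2 \<phi>(1/2) + \<phi>(1)\<close> is a sum of squares that is positive because the negative
  drift excludes \<open>a 0 = 1\<close>.\<close>

lemma \<alpha>_less_1: "\<alpha> < 1"
proof -
  obtain m where m: "m \<in> D" "m \<noteq> 0" "0 < a m" using ex_nonzero_step by blast
  show ?thesis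
  proof (cases "0 < \<tau>")
    case True
    define s where "s = (\<lambda>m::int. \<tau> powr (- of_int m / 2))"
    have s2: "(s k)\<^sup>2 = \<tau> powr (- of_int k)" for k
      unfolding s_def using True by (simp add: power2_eq_square powr_add[symmetric])
    have "s m \<noteq> 1" unfolding s_def using True \<tau> m by (simp add: powr_def)
    then have "0 < a m * (1 - s m)\<^sup>2" using m by simp
    also have "\<dots> \<le> (\<Sum>k\<in>D. a k * (1 - s k)\<^sup>2)"
      using m a_nonneg by (intro member_le_sum) auto
    also have "\<dots> = (\<Sum>k\<in>D. a k - 2 * (a k * s k) + a k * \<tau> powr (- of_int k))"
      unfolding s2[symmetric] by (intro sum.cong) (auto simp: power2_eq_square algebra_simps)
    also have "\<dots> = 1 - 2 * \<alpha> + (\<Sum>k\<in>D. a k * \<tau> powr (- of_int k))"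
      using True sum_a by (simp add: \<alpha>_eq s_def sum.distrib sum_subtractf sum_distrib_left)
    finally show ?thesis using sum_a_ratio_le[OF True] by linarith
  next
    case False
    have "a 0 < a 0 + a m" using m by simp
    also have "\<dots> = sum a {0, m}" using m by simp
    also have "\<dots> \<le> sum a D" using m a_nonneg by (intro sum_mono2) auto
    finally show ?thesis using False sum_a by (simp add: \<alpha>_eq)
  qed
qed

lemma alpha0_eq: "alpha0 \<pi> P N = ereal \<alpha>"
proof -
  have "limsup (\<lambda>i. ereal (sqrt (P i (sh i m) * adjoint_kernel \<pi> P (sh i m) i))) = ereal (weight_lim m)"
    if m: "m \<in> D" for m
  proof -
    have "sqrt (P i (sh i m) * adjoint_kernel \<pi> P (sh i m) i) = weight m i" for i
    proof -
      have "P i (sh i m) * adjoint_kernel \<pi> P (sh i m) i = (P i (sh i m))\<^sup>2 * (\<pi> i / \<pi> (sh i m))"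
        by (simp add: adjoint_kernel_def power2_eq_square)
      then show ?thesis
        unfolding weight_def using P_nonneg by (simp only: real_sqrt_mult real_sqrt_abs abs_of_nonneg)
    qed
    then show ?thesis
      using weight_tendsto[OF m] by (simp add: lim_imp_Limsup)
  qed
  then show ?thesis unfolding alpha0_def \<alpha>_def by simp
qed

lemma weight_V: "P i (sh i m) * V (sh i m) = weight m i * V i"
  unfolding weight_def using \<pi>_pos[of i] by (simp add: real_sqrt_divide)

text \<open>The substitution \<open>j = i + m\<close> turns the weighted sum over \<open>i\<close> into a part of the sum that defines
  the norm of \<open>f\<close>, up to the squares of the weights.\<close>

lemma contracting_shift:
  assumes f: "f \<in> L2" and M: "\<And>i. i \<ge> M \<Longrightarrow> weight m i \<le> l" and l: "0 \<le> l"
    and m: "m \<in> D" "N \<le> M"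
  shows "(\<lambda>i. if i < M then 0 else of_real (P i (sh i m)) * f (sh i m)) \<in> L2 \<and>
    n2 (\<lambda>i. if i < M then 0 else of_real (P i (sh i m)) * f (sh i m)) \<le> l * n2 f"
proof (subst l2_ball_iff[where \<pi>=\<pi>, OF \<pi>_pos], goal_cases)
  case 1
  then show ?case using l L2.nrm_nonneg[OF f] by simp
next
  case 2
  let ?h = "\<lambda>i. cmod (f i) * sqrt (\<pi> i)"
  let ?k = "\<lambda>i. if i < M then 0 else ?h (sh i m)"
  show ?case
  proof
    fix n
    have "L2_set (\<lambda>i. cmod (if i < M then 0 else of_real (P i (sh i m)) * f (sh i m)) * sqrt (\<pi> i)) {..<n}
      \<le> L2_set (\<lambda>i. l * ?k i) {..<n}"
    proof (rule L2_set_mono)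
      fix i
      show "cmod (if i < M then 0 else of_real (P i (sh i m)) * f (sh i m)) * sqrt (\<pi> i) \<le> l * ?k i"
      proof (cases "i < M")
        case False
        have "cmod (of_real (P i (sh i m)) * f (sh i m)) * sqrt (\<pi> i) = weight m i * ?h (sh i m)"
          unfolding weight_def using P_nonneg[of i "sh i m"] \<pi>_pos[of "sh i m"]
          by (simp add: norm_mult real_sqrt_divide)
        also have "\<dots> \<le> l * ?h (sh i m)"
          using M[of i] False \<pi>_pos by (intro mult_right_mono) (auto simp: less_imp_le)
        finally show ?thesis using False by simp
      qed simp
    qed (use less_imp_le[OF \<pi>_pos] in \<open>simp add: norm_mult\<close>)
    also have "\<dots> = l * L2_set ?k {..<n}" using l by (simp only: L2_set_right_distrib)
    also have "L2_set ?k {..<n} \<le> L2_set ?h {..<n + N}"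
    proof -
      have "(\<Sum>i<n. (?k i)\<^sup>2) = (\<Sum>i\<in>{M..<n}. (?h (sh i m))\<^sup>2)"
        by (rule sum.mono_neutral_cong_right) auto
      also have "\<dots> = (\<Sum>j\<in>(\<lambda>i. sh i m) ` {M..<n}. (?h j)\<^sup>2)"
        using m by (subst sum.reindex) (auto simp: inj_on_def)
      also have "\<dots> \<le> (\<Sum>j<n + N. (?h j)\<^sup>2)" using m by (intro sum_mono2) auto
      finally show ?thesis unfolding L2_set_def by (rule real_sqrt_le_mono)
    qed
    also have "L2_set ?h {..<n + N} \<le> n2 f" by (rule l2_partial[of \<pi>, OF \<pi>_pos f])
    finally show "L2_set (\<lambda>i. cmod (if i < M then 0 else of_real (P i (sh i m)) * f (sh i m)) * sqrt (\<pi> i)) {..<n}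
      \<le> l * n2 f" using l by (simp add: mult_left_mono)
  qed
qed

text \<open>Far out, each of the \<open>2 N + 1\<close> weights is within \<open>\<epsilon>\<close> of its limit, and the limits add up to
  \<open>\<alpha>\<close>. On \<open>\<B>\<^sub>V\<close> the sum of the weights is \<open>P V / V\<close>; on \<open>\<ell>\<^sup>2(\<pi>)\<close> the triangle inequality adds up
  the norms of the weighted shifts.\<close>

theorem ex_contracting_tail:
  assumes r: "\<alpha> < r" "r < 1"
  shows "\<exists>M. contracting_tail P \<pi> M r"
proof -
  define \<epsilon> where "\<epsilon> = (r - \<alpha>) / (2 * real N + 1)"
  have \<epsilon>: "0 < \<epsilon>" using r by (simp add: \<epsilon>_def)
  define l where "l = (\<lambda>m. weight_lim m + \<epsilon>)"
  have l: "0 \<le> l m" if "m \<in> D" for m using weight_lim_nonneg[OF that] \<epsilon> by (simp add: l_def)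
  have sum_l: "(\<Sum>m\<in>D. l m) = r"
    by (simp add: l_def sum.distrib \<alpha>_def[symmetric] \<epsilon>_def)
  have "\<forall>\<^sub>F i in sequentially. \<forall>m\<in>D. weight m i < l m"
    using \<epsilon> by (intro eventually_ball_finite ballI order_tendstoD(2)[OF weight_tendsto]) (auto simp: l_def)
  then obtain M0 where M0: "\<forall>i\<ge>M0. \<forall>m\<in>D. weight m i < l m"
    unfolding eventually_sequentially by blast
  define M where "M = max M0 (max i0 N)"
  have M: "N \<le> M" "i0 \<le> M" and M_weight: "\<And>i m. i \<ge> M \<Longrightarrow> m \<in> D \<Longrightarrow> weight m i \<le> l m"
    using M0 by (auto simp: M_def intro: less_imp_le)
  have "contracting_tail P \<pi> M r"
  proof
    show "0 \<le> r" "r < 1" using r \<alpha>_nonneg by auto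
    show "PV i \<le> r * V i" if i: "M \<le> i" for i
    proof -
      have "(\<lambda>j. P i j * V j) sums (\<Sum>m\<in>D. P i (sh i m) * V (sh i m))"
        using M i band by (intro band_sums) auto
      then have "PV i = (\<Sum>m\<in>D. weight m i * V i)" unfolding PV_def weight_V by (simp add: sums_iff)
      also have "\<dots> \<le> (\<Sum>m\<in>D. l m * V i)"
        using M_weight[OF i] V_pos[of i] by (intro sum_mono mult_right_mono) auto
      also have "\<dots> = r * V i" by (simp only: sum_distrib_right[symmetric] sum_l)
      finally show ?thesis .
    qed
    fix f assume f: "f \<in> L2"
    let ?g = "\<lambda>m i. if i < M then 0 else of_real (P i (sh i m)) * f (sh i m)"
    have "(\<lambda>i. if i < M then 0 else T f i) = (\<lambda>i. \<Sum>m\<in>D. ?g m i)"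
    proof
      fix i
      show "(if i < M then 0 else T f i) = (\<Sum>m\<in>D. ?g m i)"
      proof (cases "i < M")
        case False
        then have "(\<lambda>j. of_real (P i j) * f j) sums (\<Sum>m\<in>D. of_real (P i (sh i m)) * f (sh i m))"
          using M band by (intro band_sums) auto
        then show ?thesis using False by (simp add: kernel_op_def sums_iff)
      qed simp
    qed
    moreover have g: "?g m \<in> L2 \<and> n2 (?g m) \<le> l m * n2 f" if "m \<in> D" for m
      by (rule contracting_shift[OF f M_weight[OF _ that] l[OF that] that M(1)])
    then have "(\<lambda>i. \<Sum>m\<in>D. ?g m i) \<in> L2 \<and> n2 (\<lambda>i. \<Sum>m\<in>D. ?g m i) \<le> (\<Sum>m\<in>D. n2 (?g m))"
      by (intro L2.sum_mem) auto
    moreover have "(\<Sum>m\<in>D. n2 (?g m)) \<le> (\<Sum>m\<in>D. l m * n2 f)" using g by (intro sum_mono) auto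
    moreover have "(\<Sum>m\<in>D. l m * n2 f) = r * n2 f" by (simp only: sum_distrib_right[symmetric] sum_l)
    ultimately show "(\<lambda>i. if i < M then 0 else T f i) \<in> L2 \<and> n2 (\<lambda>i. if i < M then 0 else T f i) \<le> r * n2 f"
      by simp
  qed
  then show ?thesis by blast
qed

end

theorem proposition1:
  fixes P :: "nat \<Rightarrow> nat \<Rightarrow> real" and \<pi> V :: "nat \<Rightarrow> real"
    and i0 N :: nat and a :: "int \<Rightarrow> real" and \<tau> :: real
  assumes "markov_kernel P" and "irreducible_kernel P" and "aperiodic_kernel P"
    and "unique_invariant_prob P \<pi>"
    and "N \<ge> 1"
    and "\<And>i j. i \<ge> i0 \<Longrightarrow> \<bar>int i - int j\<bar> > int N \<Longrightarrow> P i j = 0"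
    and "\<And>m. m \<in> {- int N..int N} \<Longrightarrow> a m \<in> {0..1}"
    and "\<And>m. m \<in> {- int N..int N} \<Longrightarrow> (\<lambda>i. P i (nat (int i + m))) \<longlonglongrightarrow> a m"
    and "\<tau> \<in> {0..<1}"
    and "(\<lambda>i. \<pi> (Suc i) / \<pi> i) \<longlonglongrightarrow> \<tau>"
    and "(\<Sum>k = - int N..int N. of_int k * a k) < 0"
    and V: "V = (\<lambda>n. \<pi> n powr (- (1 / 2)))"
  shows
    "alpha0 \<pi> P N =
       ereal (if \<tau> > 0 then (\<Sum>m = - int N..int N. a m * \<tau> powr (- of_int m / 2)) else a 0)
     \<and> alpha0 \<pi> P N < 1
     \<and> spectral_gap (l2_space \<pi>) (l2_norm \<pi>) P \<pi>
     \<and> spectral_gap (BV_space V) (BV_norm V) P \<pi>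
     \<and> bounded_op_on (l2_space \<pi>) (l2_norm \<pi>) (kernel_op P)
     \<and> bounded_op_on (BV_space V) (BV_norm V) (kernel_op P)
     \<and> ereal (max (ess_spectral_radius (BV_space V) (BV_norm V) (kernel_op P))
                  (ess_spectral_radius (l2_space \<pi>) (l2_norm \<pi>) (kernel_op P))) \<le> alpha0 \<pi> P N
     \<and> (ereal (gap_rate (BV_space V) (BV_norm V) P \<pi>) \<le> alpha0 \<pi> P N \<longrightarrow>
          ereal (gap_rate (l2_space \<pi>) (l2_norm \<pi>) P \<pi>) \<le> alpha0 \<pi> P N)
     \<and> (ereal (gap_rate (BV_space V) (BV_norm V) P \<pi>) > alpha0 \<pi> P N \<longrightarrow>
          gap_rate (l2_space \<pi>) (l2_norm \<pi>) P \<pi> = gap_rate (BV_space V) (BV_norm V) P \<pi>)"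
proof -
  have inv: "invariant_prob P \<pi>" using assms(4) by (simp add: unique_invariant_prob_def)
  have pos: "0 < \<pi> i" for i by (rule invariant_prob_pos[OF assms(2,1) inv])
  interpret banded_kernel P \<pi> i0 N a \<tau>
    by unfold_locales (use assms pos inv in \<open>auto simp: invariant_prob_def\<close>)
  have V_eq: "V = (\<lambda>n. 1 / sqrt (\<pi> n))"
    unfolding assms(12) using pos by (simp add: powr_minus powr_half_sqrt less_imp_le inverse_eq_divide)
  note results = rates_from_tails[OF assms(2,3) \<alpha>_nonneg \<alpha>_less_1 ex_contracting_tail]
  show ?thesis
    unfolding V_eq alpha0_eq
    using results \<alpha>_eq \<alpha>_less_1 by simp
qed

end
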